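(* All vector bundles on the projective line $\mathbb{P}^1$ split into a direct sum of line bundles.
   Context: $\mathbb{P}^1$ denotes the projective line over the ground field. A vector bundle is identified with its sheaf of sections: a vector bundle on $\mathbb{P}^1$ means a locally free sheaf of finite rank on $\mathbb{P}^1$, and a line bundle means a locally free sheaf of rank $1$. That a vector bundle splits into a direct sum of line bundles means that it is isomorphic to a finite direct sum of line bundles. *)

theory Defs
  imports
    "HOL-Analysis.Abstract_Topology"
    "HOL-Computational_Algebra.Polynomial"
    "HOL-Computational_Algebra.Fraction_Field"
    "HOL-Algebra.Module"
    "HOL-Algebra.Ideal"
begin

section \<open>Sheaves of modules on a ringed space\<close>

record ('p, 'r) ringed_space =
  space_top :: "'p topology"
  ring_sec :: "'p set \<Rightarrow> 'r ring"
  ring_res :: "'p set \<Rightarrow> 'p set \<Rightarrow> 'r \<Rightarrow> 'r"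

text \<open>Both restriction maps take the larger open set first: \<open>res F U V\<close> maps the sections
  over \<open>U\<close> to those over \<open>V\<close>, for \<open>V \<subseteq> U\<close>. The values of \<open>sec\<close> and \<open>res\<close> on sets that are not
  open are never used.\<close>

record ('p, 'r, 'm) mod_sheaf =
  sec :: "'p set \<Rightarrow> ('r, 'm) module"
  res :: "'p set \<Rightarrow> 'p set \<Rightarrow> 'm \<Rightarrow> 'm"

locale sheaf_of_modules =
  fixes X :: "('p, 'r) ringed_space" and F :: "('p, 'r, 'm) mod_sheaf"
  assumes sec_module:
      "openin (space_top X) U \<Longrightarrow> Module.module (ring_sec X U) (sec F U)"
    and res_closed:
      "\<lbrakk>openin (space_top X) U; openin (space_top X) V; V \<subseteq> U; s \<in> carrier (sec F U)\<rbrakk>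
        \<Longrightarrow> res F U V s \<in> carrier (sec F V)"
    and res_add:
      "\<lbrakk>openin (space_top X) U; openin (space_top X) V; V \<subseteq> U;
        s \<in> carrier (sec F U); t \<in> carrier (sec F U)\<rbrakk>
        \<Longrightarrow> res F U V (s \<oplus>\<^bsub>sec F U\<^esub> t) = res F U V s \<oplus>\<^bsub>sec F V\<^esub> res F U V t"
    and res_smult:
      "\<lbrakk>openin (space_top X) U; openin (space_top X) V; V \<subseteq> U;
        r \<in> carrier (ring_sec X U); s \<in> carrier (sec F U)\<rbrakk>
        \<Longrightarrow> res F U V (r \<odot>\<^bsub>sec F U\<^esub> s) = ring_res X U V r \<odot>\<^bsub>sec F V\<^esub> res F U V s"
    and res_id:
      "\<lbrakk>openin (space_top X) U; s \<in> carrier (sec F U)\<rbrakk> \<Longrightarrow> res F U U s = s"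
    and res_comp:
      "\<lbrakk>openin (space_top X) U; openin (space_top X) V; openin (space_top X) W;
        W \<subseteq> V; V \<subseteq> U; s \<in> carrier (sec F U)\<rbrakk>
        \<Longrightarrow> res F V W (res F U V s) = res F U W s"
    and locality:
      "\<lbrakk>\<And>V. V \<in> \<U> \<Longrightarrow> openin (space_top X) V;
        s \<in> carrier (sec F (\<Union>\<U>)); t \<in> carrier (sec F (\<Union>\<U>));
        \<And>V. V \<in> \<U> \<Longrightarrow> res F (\<Union>\<U>) V s = res F (\<Union>\<U>) V t\<rbrakk>
        \<Longrightarrow> s = t"
    and gluing:
      "\<lbrakk>\<And>V. V \<in> \<U> \<Longrightarrow> openin (space_top X) V;
        \<And>V. V \<in> \<U> \<Longrightarrow> f V \<in> carrier (sec F V);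
        \<And>V W. \<lbrakk>V \<in> \<U>; W \<in> \<U>\<rbrakk> \<Longrightarrow> res F V (V \<inter> W) (f V) = res F W (V \<inter> W) (f W)\<rbrakk>
        \<Longrightarrow> \<exists>s \<in> carrier (sec F (\<Union>\<U>)). \<forall>V \<in> \<U>. res F (\<Union>\<U>) V s = f V"

definition module_iso ::
    "('r, 'x) ring_scheme \<Rightarrow> ('r, 'm) module \<Rightarrow> ('r, 'n) module \<Rightarrow> ('m \<Rightarrow> 'n) set" where
  "module_iso R M N = {h. bij_betw h (carrier M) (carrier N) \<and>
     (\<forall>x \<in> carrier M. \<forall>y \<in> carrier M. h (x \<oplus>\<^bsub>M\<^esub> y) = h x \<oplus>\<^bsub>N\<^esub> h y) \<and>
     (\<forall>r \<in> carrier R. \<forall>x \<in> carrier M. h (r \<odot>\<^bsub>M\<^esub> x) = r \<odot>\<^bsub>N\<^esub> h x)}"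

text \<open>\<open>sheaf_iso_on X W F G\<close>: the restrictions of \<open>F\<close> and \<open>G\<close> to the open subspace \<open>W\<close> are
  isomorphic.\<close>

definition sheaf_iso_on ::
    "('p, 'r) ringed_space \<Rightarrow> 'p set \<Rightarrow> ('p, 'r, 'm) mod_sheaf \<Rightarrow> ('p, 'r, 'n) mod_sheaf \<Rightarrow> bool" where
  "sheaf_iso_on X W F G \<longleftrightarrow> (\<exists>\<phi>.
     (\<forall>U. openin (space_top X) U \<and> U \<subseteq> W \<longrightarrow> \<phi> U \<in> module_iso (ring_sec X U) (sec F U) (sec G U)) \<and>
     (\<forall>U V. openin (space_top X) U \<and> openin (space_top X) V \<and> V \<subseteq> U \<and> U \<subseteq> W \<longrightarrow>
        (\<forall>s \<in> carrier (sec F U). \<phi> V (res F U V s) = res G U V (\<phi> U s))))"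

abbreviation sheaf_iso ::
    "('p, 'r) ringed_space \<Rightarrow> ('p, 'r, 'm) mod_sheaf \<Rightarrow> ('p, 'r, 'n) mod_sheaf \<Rightarrow> bool" where
  "sheaf_iso X F G \<equiv> sheaf_iso_on X (topspace (space_top X)) F G"

text \<open>The record type of modules extends that of rings; the locale \<^locale>\<open>Module.module\<close> ignores
  the fields \<open>mult\<close> and \<open>one\<close>.\<close>

definition direct_sum :: "'i set \<Rightarrow> ('i \<Rightarrow> ('p, 'r, 'm) mod_sheaf) \<Rightarrow> ('p, 'r, 'i \<Rightarrow> 'm) mod_sheaf" where
  "direct_sum I L =
    \<lparr>sec = (\<lambda>U. \<lparr>carrier = (\<Pi>\<^sub>E i\<in>I. carrier (sec (L i) U)),
                mult = undefined, one = undefined,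
                zero = (\<lambda>i\<in>I. \<zero>\<^bsub>sec (L i) U\<^esub>),
                add = (\<lambda>s t. \<lambda>i\<in>I. s i \<oplus>\<^bsub>sec (L i) U\<^esub> t i),
                smult = (\<lambda>r s. \<lambda>i\<in>I. r \<odot>\<^bsub>sec (L i) U\<^esub> s i)\<rparr>),
     res = (\<lambda>U V s. \<lambda>i\<in>I. res (L i) U V (s i))\<rparr>"

definition structure_sheaf :: "('p, 'r) ringed_space \<Rightarrow> ('p, 'r, 'r) mod_sheaf" where
  "structure_sheaf X =
    \<lparr>sec = (\<lambda>U. \<lparr>carrier = carrier (ring_sec X U),
                mult = mult (ring_sec X U), one = one (ring_sec X U),
                zero = zero (ring_sec X U), add = add (ring_sec X U),
                smult = mult (ring_sec X U)\<rparr>),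
     res = ring_res X\<rparr>"

definition free_sheaf :: "('p, 'r) ringed_space \<Rightarrow> nat \<Rightarrow> ('p, 'r, nat \<Rightarrow> 'r) mod_sheaf" where
  "free_sheaf X n = direct_sum {..<n} (\<lambda>_. structure_sheaf X)"

definition vector_bundle :: "('p, 'r) ringed_space \<Rightarrow> ('p, 'r, 'm) mod_sheaf \<Rightarrow> bool" where
  "vector_bundle X F \<longleftrightarrow> sheaf_of_modules X F \<and>
     (\<forall>p \<in> topspace (space_top X). \<exists>U n. openin (space_top X) U \<and> p \<in> U \<and>
        sheaf_iso_on X U F (free_sheaf X n))"

definition line_bundle :: "('p, 'r) ringed_space \<Rightarrow> ('p, 'r, 'm) mod_sheaf \<Rightarrow> bool" where
  "line_bundle X F \<longleftrightarrow> sheaf_of_modules X F \<and>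
     (\<forall>p \<in> topspace (space_top X). \<exists>U. openin (space_top X) U \<and> p \<in> U \<and>
        sheaf_iso_on X U F (free_sheaf X 1))"


section \<open>The projective line as $\mathrm{Proj}\, k[x,y]$\<close>

text \<open>\<^typ>\<open>'k poly poly\<close> is $k[x,y]$, where the coefficient of $x^i y^j$ in \<open>f\<close> is
  \<open>coeff (coeff f j) i\<close>.\<close>

definition homogeneous :: "nat \<Rightarrow> 'k::field poly poly \<Rightarrow> bool" where
  "homogeneous d f \<longleftrightarrow> (\<forall>i j. coeff (coeff f j) i \<noteq> 0 \<longrightarrow> i + j = d)"

definition hom_component :: "nat \<Rightarrow> 'k::field poly poly \<Rightarrow> 'k poly poly" where
  "hom_component d f = (\<Sum>j\<le>d. monom (monom (coeff (coeff f j) (d - j)) (d - j)) j)"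

definition kxy :: "'k::field poly poly ring" where
  "kxy = \<lparr>carrier = UNIV, mult = (*), one = 1, zero = 0, add = (+)\<rparr>"

definition homogeneous_ideal :: "'k::field poly poly set \<Rightarrow> bool" where
  "homogeneous_ideal I \<longleftrightarrow> ideal I kxy \<and> (\<forall>f \<in> I. \<forall>d. hom_component d f \<in> I)"

definition irrelevant_ideal :: "'k::field poly poly set" where
  "irrelevant_ideal = {f. hom_component 0 f = 0}"

type_synonym 'k P1_point = "'k poly poly set"

definition P1_points :: "'k::field P1_point set" where
  "P1_points = {P. primeideal P kxy \<and> homogeneous_ideal P \<and> \<not> irrelevant_ideal \<subseteq> P}"

definition P1_top :: "'k::field P1_point topology" where
  "P1_top = topology (\<lambda>U. \<exists>I. homogeneous_ideal I \<and> U = {P \<in> P1_points. \<not> I \<subseteq> P})"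

lemma ideal_kxy_iff: "ideal I kxy \<longleftrightarrow> 0 \<in> I \<and> (\<forall>a\<in>I. \<forall>b\<in>I. a + b \<in> I) \<and> (\<forall>a\<in>I. \<forall>r. r * a \<in> I)"
  (is "?A = ?B")
proof
  assume ?A
  then interpret ideal I kxy .
  show ?B using additive_subgroup.zero_closed[OF is_additive_subgroup] additive_subgroup.a_closed[OF is_additive_subgroup] I_l_closed
    by (auto simp: kxy_def)
next
  assume B: ?B
  have x: "\<exists>y. x + y = 0" for x :: "'a poly poly" by (rule exI[of _ "-x"]) simp
  have R: "ring kxy" apply (rule ringI) apply (rule abelian_groupI) using x apply (simp_all add: kxy_def algebra_simps x)[6]
   by (auto intro!: abelian_groupI monoidI intro: exI[of _ "- _"] simp: kxy_def algebra_simps x[simplified])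
  show ?A
  proof (rule idealI[OF R])
    have m: "- a \<in> I" if "a \<in> I" for a using B that by (metis mult_minus1)
    interpret ring kxy by (rule R)
    have inv: "inv\<^bsub>add_monoid kxy\<^esub> a = - a" for a
      using minus_equality[of "-a" a] by (auto simp: kxy_def a_inv_def)
    show "subgroup I (add_monoid kxy)"
    proof
      show "inv\<^bsub>add_monoid kxy\<^esub> x \<in> I" if "x \<in> I" for x using that m inv by metis
    qed (use B in \<open>auto simp: kxy_def\<close>)
  qed (use B in \<open>auto simp: kxy_def mult.commute\<close>)
qed

lemma homogeneous_ideal_Inter: "\<forall>P\<in>\<I>. homogeneous_ideal P \<Longrightarrow> homogeneous_ideal (\<Inter>\<I>)"
  by (auto simp: homogeneous_ideal_def ideal_kxy_iff)

lemma primeideal_kxy_Int: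
  assumes "primeideal P kxy" "ideal I kxy" "ideal J kxy" "I \<inter> J \<subseteq> P"
  shows "I \<subseteq> P \<or> J \<subseteq> P"
proof (rule ccontr)
  assume "\<not> ?thesis" then obtain a b where "a \<in> I" "b \<in> J" "a \<notin> P" "b \<notin> P" by auto
  then have "a * b \<in> I \<inter> J" using assms(2,3) by (auto simp: ideal_kxy_iff) (metis mult.commute)
  then show False using primeideal.I_prime[OF assms(1), of a b] assms(4) \<open>a \<notin> P\<close> \<open>b \<notin> P\<close> by (auto simp: kxy_def)
qed

lemma istopology_P1: "istopology (\<lambda>U. \<exists>I. homogeneous_ideal I \<and> U = {P \<in> P1_points. \<not> I \<subseteq> P})"
  unfolding istopology_def
proof (intro conjI allI impI)
  fix S T :: "'a P1_point set" assume "\<exists>I. homogeneous_ideal I \<and> S = {P \<in> P1_points. \<not> I \<subseteq> P}"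
   "\<exists>I. homogeneous_ideal I \<and> T = {P \<in> P1_points. \<not> I \<subseteq> P}"
  then obtain I J where "homogeneous_ideal I" "homogeneous_ideal J" "S = {P \<in> P1_points. \<not> I \<subseteq> P}" "T = {P \<in> P1_points. \<not> J \<subseteq> P}" by auto
  then show "\<exists>I. homogeneous_ideal I \<and> S \<inter> T = {P \<in> P1_points. \<not> I \<subseteq> P}"
    using homogeneous_ideal_Inter[of "{I,J}"] primeideal_kxy_Int[of _ I J] by (intro exI[of _ "I \<inter> J"]) (auto simp: P1_points_def homogeneous_ideal_def)
next
  fix K :: "'a P1_point set set" assume K: "\<forall>U\<in>K. \<exists>I. homogeneous_ideal I \<and> U = {P \<in> P1_points. \<not> I \<subseteq> P}"
  let ?J = "\<Inter>(P1_points - \<Union>K)"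
  have "homogeneous_ideal ?J" by (rule homogeneous_ideal_Inter) (auto simp: P1_points_def)
  moreover have "\<Union>K = {P \<in> P1_points. \<not> ?J \<subseteq> P}"
  proof (intro equalityI subsetI)
    fix P assume "P \<in> \<Union>K" then obtain U where "P \<in> U" "U \<in> K" by blast
    then obtain I where I: "U = {P \<in> P1_points. \<not> I \<subseteq> P}" using K by meson
    have "I \<subseteq> ?J" using I \<open>U \<in> K\<close> by blast
    moreover have "P \<in> P1_points" "\<not> I \<subseteq> P" using I \<open>P \<in> U\<close> by blast+
    ultimately show "P \<in> {P \<in> P1_points. \<not> ?J \<subseteq> P}" by (metis (mono_tags, lifting) mem_Collect_eq subset_trans)
  next
    fix P assume "P \<in> {P \<in> P1_points. \<not> ?J \<subseteq> P}" then show "P \<in> \<Union>K" by blast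
  qed
  ultimately show "\<exists>I. homogeneous_ideal I \<and> \<Union>K = {P \<in> P1_points. \<not> I \<subseteq> P}" by blast
qed

lemma openin_P1_top: "openin P1_top U \<longleftrightarrow> (\<exists>I. homogeneous_ideal I \<and> U = {P \<in> P1_points. \<not> I \<subseteq> P})"
  unfolding P1_top_def by (simp only: topology_inverse'[OF istopology_P1])

text \<open>Since $k[x,y]$ is a domain, the degree zero part of its homogeneous localisation at a point
  \<open>P\<close> is the subring of the field of fractions consisting of the \<open>a / b\<close> with \<open>a\<close>, \<open>b\<close> homogeneous
  of the same degree and \<open>b \<notin> P\<close>. A section over \<open>U\<close> is a function on \<open>U\<close> with values in these
  local rings that is locally given by one such fraction.\<close>

type_synonym 'k P1_fun = "'k P1_point \<Rightarrow> 'k poly poly fract"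

definition P1_sections :: "'k::field P1_point set \<Rightarrow> 'k P1_fun set" where
  "P1_sections U = {s \<in> extensional U. \<forall>P \<in> U. \<exists>V d a b.
     openin P1_top V \<and> P \<in> V \<and> V \<subseteq> U \<and> homogeneous d a \<and> homogeneous d b \<and>
     (\<forall>Q \<in> V. b \<notin> Q \<and> s Q = Fract a b)}"

definition P1 :: "('k::field P1_point, 'k P1_fun) ringed_space" where
  "P1 = \<lparr>space_top = P1_top,
         ring_sec = (\<lambda>U. \<lparr>carrier = P1_sections U,
                         mult = (\<lambda>s t. \<lambda>P\<in>U. s P * t P), one = (\<lambda>P\<in>U. 1),
                         zero = (\<lambda>P\<in>U. 0), add = (\<lambda>s t. \<lambda>P\<in>U. s P + t P)\<rparr>),
         ring_res = (\<lambda>U V s. restrict s V)\<rparr>"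

end

(*
  Write t = x/y and K = k(t).  A trivialisation near the point at infinity, y = 0, identifies every
  section over a nonempty open set with its value in K^n at the generic point, so the bundle becomes
  a family of lattices M_P in K^n, with M_P the standard lattice at infinity.  The intersection M0 of
  the M_P over the finite points P is a k[t]-lattice, and the maximal degree of the entries is a norm
  on K^n whose unit ball is the lattice at infinity.  Choose b_1, b_2, ... in M0 successively of least
  norm d_i outside the span of the previous ones.  Minimality forces the norm of a sum of a_i b_i to
  be the maximum of deg a_i + d_i, and the b_i to generate M0.  Hence the b_i simultaneously
  diagonalise all M_P, and the bundle is the direct sum of the line bundles O(-d_i).
*)

theory Submission
  imports Defs "HOL-Library.Function_Algebras" "HOL-Computational_Algebra.Polynomial_Factorial"
begin

subsection \<open>The degree of rational functions\<close>

text \<open>What turns local data into lattices is that every nonempty open set of P^1 contains the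
  generic point, so sections over any two nonempty open sets can be compared in one vector space.
  The obstacle is that M0 is defined by infinitely many conditions, one for each finite point. Only
  finitely many of these points lie outside the fixed neighbourhood of infinity, and at the others
  M_P is the standard lattice. Hence finitely many polynomial denominators bound M0 from above, so
  that least norms exist, and from below, so that M0 spans K^n. A basis adapted to M0 also describes
  M_P at a finite P because M_P is the localisation of M0 at P: the finitely many poles of a germ at
  P can be cleared by a polynomial that does not vanish at P. At infinity the norm formula says that
  a combination of the b_i lies in the unit ball exactly when deg a_i \<le> -d_i, which is the stalk
  of O(-d_i) there. The ground field is arbitrary, so the finite points are all prime ideals of
  k[t], the zero ideal included, and not only values of t.\<close>

definition deg_le :: "'k::field poly fract \<Rightarrow> int \<Rightarrow> bool" where
  "deg_le c d \<longleftrightarrow> (\<exists>p q. q \<noteq> 0 \<and> c = Fract p q \<and> (p = 0 \<or> int (degree p) \<le> int (degree q) + d))"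

text \<open>Cross-multiplying two representatives shows that deg p - deg q depends only on the
  fraction. Being a relation, \<open>deg_le\<close> gives 0 degree minus infinity without an
  exceptional value.\<close>

lemma deg_le_Fract:
  assumes "q \<noteq> 0"
  shows "deg_le (Fract p q) d \<longleftrightarrow> p = 0 \<or> int (degree p) \<le> int (degree q) + d"
proof
  assume "deg_le (Fract p q) d"
  then obtain p' q' where *: "q' \<noteq> 0" "Fract p q = Fract p' q'"
      "p' = 0 \<or> int (degree p') \<le> int (degree q') + d"
    by (auto simp: deg_le_def)
  have eq: "p * q' = p' * q" using * assms by (simp add: eq_fract)
  show "p = 0 \<or> int (degree p) \<le> int (degree q) + d"
  proof (cases "p = 0")
    case False
    then have "p' \<noteq> 0" using eq * by auto
    have "degree p + degree q' = degree p' + degree q"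
      using arg_cong[OF eq, of degree] False \<open>p' \<noteq> 0\<close> * assms by (simp add: degree_mult_eq)
    then show ?thesis using * \<open>p' \<noteq> 0\<close> by linarith
  qed simp
qed (use assms in \<open>auto simp: deg_le_def\<close>)

lemma Fract_zero_iff: "(q::'a::idom) \<noteq> 0 \<Longrightarrow> Fract p q = 0 \<longleftrightarrow> p = 0"
  by (simp add: Zero_fract_def eq_fract)

lemma deg_le_0 [simp]: "deg_le 0 d"
  by (simp add: Zero_fract_def deg_le_Fract)

lemma deg_le_poly: "deg_le (Fract p 1) d \<longleftrightarrow> p = 0 \<or> int (degree p) \<le> d"
  by (simp add: deg_le_Fract)

lemma deg_le_mono: "deg_le c d \<Longrightarrow> d \<le> e \<Longrightarrow> deg_le c e"
  by (cases c) (auto simp: deg_le_Fract)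

lemma deg_le_exists: "\<exists>d. deg_le c d"
proof (cases c)
  case (Fract p q)
  then have "deg_le c (int (degree p))" by (simp add: deg_le_Fract)
  then show ?thesis ..
qed

lemma deg_le_mult:
  assumes "deg_le a d" "deg_le b e"
  shows "deg_le (a * b) (d + e)"
proof -
  obtain p q where a: "a = Fract p q" "q \<noteq> 0" by (cases a)
  obtain r s where b: "b = Fract r s" "s \<noteq> 0" by (cases b)
  show ?thesis using assms a b
    by (cases "p = 0"; cases "r = 0") (auto simp: deg_le_Fract degree_mult_eq)
qed

lemma deg_le_uminus: "deg_le a d \<Longrightarrow> deg_le (- a) d"
  by (cases a) (simp add: deg_le_Fract)

lemma deg_le_add:
  assumes "deg_le a d" "deg_le b d"
  shows "deg_le (a + b) d"
proof -
  obtain p q where a: "a = Fract p q" "q \<noteq> 0" by (cases a)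
  obtain r s where b: "b = Fract r s" "s \<noteq> 0" by (cases b)
  have p: "p = 0 \<or> int (degree p) \<le> int (degree q) + d" using assms(1) a by (simp add: deg_le_Fract)
  have r: "r = 0 \<or> int (degree r) \<le> int (degree s) + d" using assms(2) b by (simp add: deg_le_Fract)
  have 1: "p * s = 0 \<or> int (degree (p * s)) \<le> int (degree (q * s)) + d"
    using p a b by (cases "p = 0") (auto simp: degree_mult_eq)
  have 2: "r * q = 0 \<or> int (degree (r * q)) \<le> int (degree (q * s)) + d"
    using r a b by (cases "r = 0") (auto simp: degree_mult_eq)
  have "p * s + r * q = 0 \<or> int (degree (p * s + r * q)) \<le> int (degree (q * s)) + d"
  proof (cases "p * s = 0 \<or> r * q = 0")
    case True
    then show ?thesis using 1 2 by auto
  next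
    case False
    then show ?thesis using 1 2 degree_add_le_max[of "p * s" "r * q"] by linarith
  qed
  then show ?thesis using a b by (simp add: deg_le_Fract)
qed

lemma deg_le_diff: "deg_le a d \<Longrightarrow> deg_le b d \<Longrightarrow> deg_le (a - b) d"
  using deg_le_add[of a d "- b"] deg_le_uminus[of b d] by simp

lemma deg_le_sum: "(\<And>i. i \<in> I \<Longrightarrow> deg_le (f i) d) \<Longrightarrow> deg_le (sum f I) d"
  by (induction I rule: infinite_finite_induct) (auto intro: deg_le_add)

text \<open>Division with remainder: the quotient is the polynomial part, and the remainder over the
  denominator has negative degree.\<close>

lemma poly_part:
  fixes c :: "'k::field poly fract"
  shows "\<exists>p. deg_le (c - Fract p 1) (- 1)"
proof -
  obtain p q where c: "c = Fract p q" "q \<noteq> 0" by (cases c)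
  have "c - Fract (p div q) 1 = Fract (p mod q) q"
    using c by (simp add: minus_div_mult_eq_mod)
  moreover have "p mod q = 0 \<or> degree (p mod q) < degree q" using c(2) by (rule degree_mod_less)
  ultimately have "deg_le (c - Fract (p div q) 1) (- 1)" using c by (auto simp: deg_le_Fract)
  then show ?thesis ..
qed

definition tvar :: "'k::field poly fract" where "tvar = Fract (monom 1 1) 1"

lemma tvar_nonzero [simp]: "tvar \<noteq> 0"
  by (simp add: tvar_def Fract_zero_iff)

lemma tvar_power: "tvar ^ n = Fract (monom 1 n) 1"
  by (induction n) (auto simp: tvar_def mult_monom One_fract_def monom_0 simp flip: one_pCons)

lemma tvar_powi_nonneg: "d \<ge> 0 \<Longrightarrow> tvar powi d = Fract (monom 1 (nat d)) 1"
  by (simp add: power_int_def tvar_power)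

lemma deg_le_tvar: "deg_le ((tvar :: 'k::field poly fract) powi d) d"
proof (cases "d \<ge> 0")
  case True
  then show ?thesis by (simp add: tvar_powi_nonneg deg_le_Fract degree_monom_eq)
next
  case False
  then have "(tvar :: 'k poly fract) powi d = Fract 1 (monom 1 (nat (- d)))"
    by (simp add: power_int_def power_inverse tvar_power)
  moreover have "deg_le (Fract 1 (monom (1::'k::field) (nat (- d)))) d"
    using False by (subst deg_le_Fract) (auto simp: degree_monom_eq)
  ultimately show ?thesis by simp
qed

text \<open>The polynomial part of a function of degree at most 0 again has degree at most 0, so it
  is a constant.\<close>

lemma leading_coeff_0:
  fixes c :: "'k::field poly fract"
  assumes "deg_le c 0"
  shows "\<exists>l. deg_le (c - Fract [:l:] 1) (- 1)"
proof -
  obtain p where p: "deg_le (c - Fract p 1) (- 1)" using poly_part by blast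
  then have "deg_le (c - Fract p 1) 0" by (rule deg_le_mono) simp
  from deg_le_diff[OF assms this] have "deg_le (Fract p 1) 0" by simp
  then have "degree p = 0" by (auto simp: deg_le_poly)
  then show ?thesis using p by (metis degree_eq_zeroE)
qed

text \<open>Multiplication by t^(-d) reduces this to degree 0. The scalar is the coefficient of t^d
  in the expansion at infinity, and it is 0 when the bound d is not attained.\<close>

lemma leading_coeff:
  fixes c :: "'k::field poly fract"
  assumes "deg_le c d"
  shows "\<exists>l. deg_le (c - Fract [:l:] 1 * tvar powi d) (d - 1)"
proof -
  have "deg_le (c * tvar powi (- d)) (d + - d)" using assms deg_le_tvar by (rule deg_le_mult)
  then obtain l where "deg_le (c * tvar powi (- d) - Fract [:l:] 1) (- 1)" using leading_coeff_0 by auto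
  from deg_le_mult[OF this deg_le_tvar[of d]]
  have "deg_le ((c * tvar powi (- d) - Fract [:l:] 1) * tvar powi d) (d - 1)" by simp
  moreover have "(c * tvar powi (- d) - Fract [:l:] 1) * tvar powi d = c - Fract [:l:] 1 * tvar powi d"
    by (simp add: left_diff_distrib mult.assoc flip: power_int_add)
  ultimately show ?thesis by auto
qed

abbreviation poly_vals :: "'k::field poly fract set" where
  "poly_vals \<equiv> range (\<lambda>p. Fract p 1)"

subsection \<open>Reduced bases of polynomial lattices\<close>

text \<open>Vectors with entries in $k(t)$ are functions on the natural numbers.\<close>

definition scal :: "'a::field \<Rightarrow> (nat \<Rightarrow> 'a) \<Rightarrow> nat \<Rightarrow> 'a" where
  "scal c v = (\<lambda>j. c * v j)"

interpretation vec: vector_space "scal :: 'a::field \<Rightarrow> (nat \<Rightarrow> 'a) \<Rightarrow> nat \<Rightarrow> 'a"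
  by unfold_locales (auto simp: scal_def algebra_simps)

section \<open>Finite linear combinations and spans over K\<close>

definition comb :: "nat \<Rightarrow> (nat \<Rightarrow> 'a::field) \<Rightarrow> (nat \<Rightarrow> nat \<Rightarrow> 'a) \<Rightarrow> nat \<Rightarrow> 'a" where
  "comb m a w = (\<lambda>j. \<Sum>i<m. a i * w i j)"

lemma comb_add: "comb m a w + comb m b w = comb m (a + b) w"
  by (auto simp: comb_def sum.distrib algebra_simps)

lemma comb_diff: "comb m a w - comb m b w = comb m (a - b) w"
  by (auto simp: comb_def sum_subtractf algebra_simps)

lemma comb_scal: "scal c (comb m a w) = comb m (scal c a) w"
  by (auto simp: comb_def scal_def sum_distrib_left algebra_simps)

lemma comb_Suc: "comb (Suc m) a w = comb m a w + scal (a m) (w m)"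
  by (auto simp: comb_def scal_def)

lemma comb_cong: "(\<And>i. i < m \<Longrightarrow> a i = b i) \<Longrightarrow> comb m a w = comb m b w"
  by (simp add: comb_def)

text \<open>Picks the last nonzero coefficient of a combination, the index at which the minimality
  of the greedy choice is contradicted.\<close>

lemma ex_last_index:
  fixes m :: nat
  assumes "i < m" "P i"
  shows "\<exists>j<m. P j \<and> (\<forall>i. j < i \<longrightarrow> i < m \<longrightarrow> \<not> P i)"
proof -
  define J where "J = {i. i < m \<and> P i}"
  have "finite J" "J \<noteq> {}" using assms by (auto simp: J_def)
  then obtain j where "j \<in> J" "\<forall>i\<in>J. i \<le> j" by (meson Max_in Max_ge)
  then have "j < m \<and> P j \<and> (\<forall>i. j < i \<longrightarrow> i < m \<longrightarrow> \<not> P i)"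
    unfolding J_def by (auto simp: not_le)
  then show ?thesis ..
qed

lemma comb_trunc:
  assumes "j < m" "\<And>i. j < i \<Longrightarrow> i < m \<Longrightarrow> a i = 0"
  shows "comb m a w = comb (Suc j) a w"
  unfolding comb_def
  by (intro ext sum.mono_neutral_right) (use assms in \<open>auto simp: not_less_eq\<close>)

definition spn :: "nat \<Rightarrow> (nat \<Rightarrow> nat \<Rightarrow> 'a::field) \<Rightarrow> (nat \<Rightarrow> 'a) set" where
  "spn m w = range (\<lambda>a. comb m a w)"

lemma spn_mono:
  assumes "m \<le> n"
  shows "spn m w \<subseteq> spn n w"
proof
  fix v assume "v \<in> spn m w"
  then obtain a where "v = comb m a w" by (auto simp: spn_def)
  also have "\<dots> = comb n (\<lambda>i. if i < m then a i else 0) w"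
    unfolding comb_def by (intro ext sum.mono_neutral_cong_left) (use assms in auto)
  finally show "v \<in> spn n w" by (auto simp: spn_def)
qed

text \<open>\<open>spn\<close> keeps the coefficients explicit; this link makes the exchange lemma
  and the closure properties of \<open>vec.span\<close> available for it.\<close>

lemma spn_eq_span: "spn m w = vec.span (w ` {..<m})"
proof (induction m)
  case 0
  then show ?case by (auto simp: spn_def comb_def)
next
  case (Suc m)
  have "vec.span (w ` {..<Suc m}) = {x. \<exists>k. x - scal k (w m) \<in> spn m w}"
    using vec.span_insert[of "w m" "w ` {..<m}"] by (simp add: lessThan_Suc Suc)
  also have "\<dots> = spn (Suc m) w"
  proof (intro equalityI subsetI)
    fix x assume "x \<in> {x. \<exists>k. x - scal k (w m) \<in> spn m w}"
    then obtain k a where "x - scal k (w m) = comb m a w" by (auto simp: spn_def)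
    then have "x = comb m a w + scal k (w m)" by (simp add: algebra_simps)
    also have "\<dots> = comb (Suc m) (a(m := k)) w"
      by (simp add: comb_Suc cong: comb_cong)
    finally show "x \<in> spn (Suc m) w" by (auto simp: spn_def)
  next
    fix x assume "x \<in> spn (Suc m) w"
    then obtain a where "x = comb (Suc m) a w" by (auto simp: spn_def)
    then have "x - scal (a m) (w m) = comb m a w" by (simp add: comb_Suc)
    then show "x \<in> {x. \<exists>k. x - scal k (w m) \<in> spn m w}" by (auto simp: spn_def)
  qed
  finally show ?case by simp
qed

text \<open>Otherwise, subtracting the lower terms and dividing by \<open>a j\<close> would put
  \<open>w j\<close> into the span of its predecessors.\<close>

lemma top_coeff_not_in_spn:
  assumes "\<And>i. i < m \<Longrightarrow> w i \<notin> spn i w" "j < m" "a j \<noteq> 0"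
  shows "comb (Suc j) a w \<notin> spn j w"
proof
  assume "comb (Suc j) a w \<in> spn j w"
  then have "comb (Suc j) a w - comb j a w \<in> spn j w"
    using vec.span_diff by (metis spn_eq_span rangeI spn_def)
  then have "scal (a j) (w j) \<in> spn j w" by (simp add: comb_Suc)
  then have "scal (inverse (a j)) (scal (a j) (w j)) \<in> spn j w"
    by (simp only: spn_eq_span vec.span_scale)
  then show False using assms by auto
qed

text \<open>Vectors that each avoid the span of their predecessors are independent, and they lie in
  the span of n unit vectors, so the exchange lemma applies. This is what stops the greedy
  choice.\<close>

lemma greedy_length_bound:
  fixes w :: "nat \<Rightarrow> nat \<Rightarrow> 'a::field"
  assumes "\<And>i. i < m \<Longrightarrow> w i \<notin> spn i w" "\<And>i j. i < m \<Longrightarrow> n \<le> j \<Longrightarrow> w i j = 0"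
  shows "m \<le> n"
proof -
  define e :: "nat \<Rightarrow> nat \<Rightarrow> 'a" where "e i j = (if i = j then 1 else 0)" for i j
  have ind: "\<not> vec.dependent (w ` {..<l})" if "l \<le> m" for l
    using that
  proof (induction l)
    case (Suc l)
    have "w l \<notin> vec.span (w ` {..<l})" using assms(1)[of l] Suc by (simp add: spn_eq_span)
    then show ?case using Suc by (simp add: lessThan_Suc vec.independent_insert)
  qed (simp add: vec.independent_empty)
  have sub: "w i \<in> vec.span (e ` {..<n})" if "i < m" for i
  proof -
    have "w i = comb n (w i) e"
      using assms(2)[OF that] by (auto simp: comb_def e_def if_distrib not_less cong: if_cong)
    then show ?thesis by (metis spn_def spn_eq_span rangeI)
  qed
  have inj: "inj_on w {..<m}"
  proof (rule linorder_inj_onI')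
    fix i j :: nat assume "j \<in> {..<m}" "i < j"
    then have "w j \<notin> spn j w" "w i \<in> spn j w"
      using assms(1) by (auto simp: spn_eq_span intro: vec.span_base)
    then show "w i \<noteq> w j" by auto
  qed
  have "card (w ` {..<m}) \<le> card (e ` {..<n})"
    using vec.independent_span_bound[of "e ` {..<n}" "w ` {..<m}"] ind[of m] sub by auto
  also have "\<dots> \<le> n" by (metis card_image_le card_lessThan finite_lessThan)
  finally show ?thesis using inj by (simp add: card_image)
qed

section \<open>The maximal degree of the entries as a norm on K^n\<close>

definition vdeg_le :: "(nat \<Rightarrow> 'k::field poly fract) \<Rightarrow> int \<Rightarrow> bool" where
  "vdeg_le v d \<longleftrightarrow> (\<forall>j. deg_le (v j) d)"

text \<open>The ultrametric half of the norm formula, valid for arbitrary vectors;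
  \<open>greedy_orthogonal\<close> is the converse for a greedy family.\<close>

lemma vdeg_le_comb:
  assumes "\<And>i. i < m \<Longrightarrow> deg_le (a i) (e - d i)" "\<And>i. i < m \<Longrightarrow> vdeg_le (b i) (d i)"
  shows "vdeg_le (comb m a b) e"
proof -
  have "deg_le (a i * b i j) e" if "i < m" for i j
    using deg_le_mult[OF assms(1)[OF that], of "b i j" "d i"] assms(2)[OF that]
    by (simp add: vdeg_le_def)
  then show ?thesis by (auto simp: vdeg_le_def comb_def intro: deg_le_sum)
qed

lemma vdeg_le_scal: "deg_le c d \<Longrightarrow> vdeg_le v e \<Longrightarrow> vdeg_le (scal c v) (d + e)"
  by (auto simp: vdeg_le_def scal_def intro: deg_le_mult)

lemma vdeg_le_diff: "vdeg_le v e \<Longrightarrow> vdeg_le w e \<Longrightarrow> vdeg_le (v - w) e"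
  by (auto simp: vdeg_le_def intro: deg_le_diff)

lemma vdeg_le_mono: "vdeg_le v d \<Longrightarrow> d \<le> e \<Longrightarrow> vdeg_le v e"
  by (auto simp: vdeg_le_def intro: deg_le_mono)

lemma vdeg_le_exists:
  assumes "\<And>j. n \<le> j \<Longrightarrow> v j = 0"
  shows "\<exists>d. vdeg_le v d"
proof -
  have "\<forall>j. \<exists>d. deg_le (v j) d" using deg_le_exists by blast
  then obtain f where f: "deg_le (v j) (f j)" for j by metis
  have "deg_le (v j) (\<Sum>j<n. \<bar>f j\<bar>)" for j
  proof (cases "j < n")
    case True
    then have "f j \<le> (\<Sum>j<n. \<bar>f j\<bar>)"
      using member_le_sum[of j "{..<n}" "\<lambda>j. \<bar>f j\<bar>"] by force
    then show ?thesis using f deg_le_mono by blast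
  qed (use assms in simp)
  then show ?thesis by (auto simp: vdeg_le_def)
qed

text \<open>A k[t]-submodule of K^n that is discrete for the norm: \<open>bounded\<close> says that
  nonzero vectors have degree at least B. Finite generation is a consequence, obtained through the
  greedy choice.\<close>

locale poly_lattice =
  fixes M :: "(nat \<Rightarrow> 'k::field poly fract) set" and n :: nat and B :: int
  assumes zero: "0 \<in> M"
    and add: "v \<in> M \<Longrightarrow> w \<in> M \<Longrightarrow> v + w \<in> M"
    and smult: "c \<in> poly_vals \<Longrightarrow> v \<in> M \<Longrightarrow> scal c v \<in> M"
    and supp: "v \<in> M \<Longrightarrow> n \<le> j \<Longrightarrow> v j = 0"
    and bounded: "v \<in> M \<Longrightarrow> vdeg_le v d \<Longrightarrow> d < B \<Longrightarrow> v = 0"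
begin

lemma comb_closed:
  assumes "\<And>i. i < m \<Longrightarrow> a i \<in> poly_vals" "\<And>i. i < m \<Longrightarrow> b i \<in> M"
  shows "comb m a b \<in> M"
  using assms
proof (induction m)
  case 0
  have "comb 0 a b = 0" by (auto simp: comb_def)
  then show ?case using zero by metis
qed (auto simp: comb_Suc intro!: add smult)

text \<open>The excluded span is taken over K and not over k[t], which keeps the chosen vectors
  independent and hence at most n in number. That they nevertheless generate over k[t] is
  \<open>greedy_generates\<close>.\<close>

definition greedy where
  "greedy m b d \<longleftrightarrow> (\<forall>i<m. b i \<in> M \<and> b i \<notin> spn i b \<and> vdeg_le (b i) (d i) \<and>
     (\<forall>v\<in>M - spn i b. \<forall>e. vdeg_le v e \<longrightarrow> d i \<le> e))"

text \<open>Vectors outside the span are nonzero, so their degrees are bounded below by B. Shifting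
  by B turns the degrees into natural numbers, where a least one exists.\<close>

lemma minimal_vector:
  assumes "v \<in> M - spn m b"
  shows "\<exists>v d. v \<in> M - spn m b \<and> vdeg_le v d \<and> (\<forall>w\<in>M - spn m b. \<forall>e. vdeg_le w e \<longrightarrow> d \<le> e)"
proof -
  define S where "S = {k. \<exists>w\<in>M - spn m b. vdeg_le w (B + int k)}"
  have ge: "B \<le> e" if "w \<in> M - spn m b" "vdeg_le w e" for w e
  proof (rule ccontr)
    assume "\<not> B \<le> e"
    then have "w = 0" using that bounded by auto
    then show False using that by (simp add: spn_eq_span vec.span_zero)
  qed
  obtain e where "vdeg_le v e" using vdeg_le_exists supp assms by (metis DiffD1)
  then have "nat (e - B) \<in> S" using ge[OF assms] assms by (auto simp: S_def)
  define k where "k = (LEAST k. k \<in> S)"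
  have "k \<in> S" unfolding k_def using \<open>nat (e - B) \<in> S\<close> by (rule LeastI)
  then obtain w where w: "w \<in> M - spn m b" "vdeg_le w (B + int k)" by (auto simp: S_def)
  have "B + int k \<le> e" if "u \<in> M - spn m b" "vdeg_le u e" for u e
  proof -
    have "nat (e - B) \<in> S" using ge[OF that] that by (auto simp: S_def)
    then have "k \<le> nat (e - B)" unfolding k_def by (rule Least_le)
    then show ?thesis using ge[OF that] by linarith
  qed
  then show ?thesis using w by blast
qed

text \<open>If the lattice were never exhausted, the choice could be continued to n + 1 steps, more
  than the dimension allows.\<close>

lemma greedy_exists: "\<exists>m b d. greedy m b d \<and> M \<subseteq> spn m b"
proof (rule ccontr)
  assume no: "\<not> ?thesis"
  have "\<exists>b d. greedy m b d" for m
  proof (induction m)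
    case (Suc m)
    then obtain b d where bd: "greedy m b d" by blast
    then obtain v e where v: "v \<in> M - spn m b" "vdeg_le v e"
        "\<forall>w\<in>M - spn m b. \<forall>f. vdeg_le w f \<longrightarrow> e \<le> f"
      using no minimal_vector by (metis DiffI subsetI)
    have *: "spn i (b(m := v)) = spn i b" if "i \<le> m" for i
      using that by (auto simp: spn_def comb_def)
    have "greedy (Suc m) (b(m := v)) (d(m := e))"
      using bd v by (auto simp: greedy_def less_Suc_eq *)
    then show ?case by blast
  qed (simp add: greedy_def)
  then obtain b d where bd: "greedy (Suc n) b d" by blast
  have "Suc n \<le> n"
    by (rule greedy_length_bound[of _ b]) (use bd supp in \<open>auto simp: greedy_def\<close>)
  then show False by simp
qed

text \<open>Spans grow, so \<open>b j\<close> was already a candidate when the earlier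
  \<open>b i\<close> was chosen.\<close>

lemma greedy_mono:
  assumes "greedy m b d" "i \<le> j" "j < m"
  shows "d i \<le> d j"
proof -
  have "b j \<in> M - spn i b" "vdeg_le (b j) (d j)"
    using assms spn_mono[of i j b] by (auto simp: greedy_def)
  then show ?thesis using assms unfolding greedy_def by (meson order_le_less_trans)
qed

text \<open>If the leading terms of the \<open>a i * b i\<close> of highest degree cancelled, they would yield a vector
  of the lattice contradicting the minimality of the last \<open>b j\<close> involved.\<close>

lemma greedy_orthogonal_step:
  assumes g: "greedy m b d" and v: "vdeg_le (comb m a b) (e - 1)"
    and a: "\<And>i. i < m \<Longrightarrow> deg_le (a i) (e - d i)"
  shows "\<forall>i<m. deg_le (a i) (e - 1 - d i)"
proof -
  have "\<forall>i. \<exists>l. i < m \<longrightarrow> deg_le (a i - Fract [:l:] 1 * tvar powi (e - d i)) (e - d i - 1)"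
    using leading_coeff[OF a] by blast
  then obtain l where l: "i < m \<Longrightarrow> deg_le (a i - Fract [:l i:] 1 * tvar powi (e - d i)) (e - d i - 1)" for i
    by metis
  have "l i = 0" if im: "i < m" for i
  proof (rule ccontr)
    assume "l i \<noteq> 0"
    then obtain j where j: "j < m" "l j \<noteq> 0" "\<And>i. j < i \<Longrightarrow> i < m \<Longrightarrow> l i = 0"
      using ex_last_index[of i m "\<lambda>i. l i \<noteq> 0"] im by blast
    \<comment> \<open>The leading terms divided by t^(e - d j). The coefficient at j becomes the
      nonzero constant \<open>l j\<close>, and the earlier ones are polynomials because
      \<open>d i \<le> d j\<close>; so the combination lies in the lattice.\<close>
    define c where "c = (\<lambda>i. Fract [:l i:] 1 * tvar powi (d j - d i))"
    define w where "w = comb (Suc j) c b"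
    have c0: "c i = 0" if "j < i" "i < m" for i
      using j(3)[OF that] by (simp add: c_def Fract_zero_iff)
    have w': "w = comb m c b" unfolding w_def using comb_trunc[OF j(1) c0] by simp
    have cp: "c i \<in> poly_vals" if "i < Suc j" for i
      using greedy_mono[OF g _ j(1), of i] that by (auto simp: c_def tvar_powi_nonneg)
    have "w \<in> M"
      unfolding w_def by (rule comb_closed) (use cp g j in \<open>auto simp: greedy_def\<close>)
    moreover have "w \<notin> spn j b"
      unfolding w_def using g j
      by (intro top_coeff_not_in_spn) (auto simp: greedy_def c_def Fract_zero_iff)
    moreover have "vdeg_le w (d j - 1)"
    proof -
      \<comment> \<open>Scaled back, \<open>w\<close> is the part of the given combination made of
        leading terms. It differs from the whole by a remainder of degree at most e - 1, and the
        whole has degree at most e - 1 by assumption.\<close>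
      have "scal (tvar powi (e - d j)) w = comb m a b - comb m (a - scal (tvar powi (e - d j)) c) b"
        by (simp add: w' comb_scal comb_diff)
      moreover have "scal (tvar powi (e - d j)) c i = Fract [:l i:] 1 * tvar powi (e - d i)" for i
        by (simp add: scal_def c_def mult.left_commute flip: power_int_add)
      then have "vdeg_le (comb m (a - scal (tvar powi (e - d j)) c) b) (e - 1)"
        using l g by (intro vdeg_le_comb[where d = d]) (auto simp: greedy_def algebra_simps)
      ultimately have "vdeg_le (scal (tvar powi (e - d j)) w) (e - 1)"
        using v vdeg_le_diff by metis
      from vdeg_le_scal[OF deg_le_tvar[of "d j - e"] this]
      show ?thesis by (simp flip: power_int_add)
    qed
    ultimately have "d j \<le> d j - 1" using g j(1) unfolding greedy_def by blast
    then show False by simp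
  qed
  then show ?thesis using l by (auto simp: fract_collapse algebra_simps)
qed

text \<open>Some crude bound e + r on the degrees of all terms always exists; r applications of
  \<open>greedy_orthogonal_step\<close> lower it to e.\<close>

lemma greedy_orthogonal:
  assumes g: "greedy m b d" and v: "vdeg_le (comb m a b) e" and "i < m"
  shows "deg_le (a i) (e - d i)"
proof -
  have "\<forall>i. \<exists>d. deg_le (a i) d" using deg_le_exists by blast
  then obtain f where f: "deg_le (a i) (f i)" for i by metis
  \<comment> \<open>A sum of absolute values dominates the excess of every single term at
    once.\<close>
  define r where "r = nat (\<Sum>i<m. \<bar>f i + d i - e\<bar>)"
  have "f i \<le> e + int r - d i" if "i < m" for i
    using member_le_sum[of i "{..<m}" "\<lambda>i. \<bar>f i + d i - e\<bar>"] that by (simp add: r_def)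
  then have "\<forall>i<m. deg_le (a i) (e + int r - d i)" using f deg_le_mono by blast
  then have "\<forall>i<m. deg_le (a i) (e - d i)"
  proof (induction r)
    case (Suc r)
    have "\<forall>i<m. deg_le (a i) (e + int (Suc r) - 1 - d i)"
      by (rule greedy_orthogonal_step[OF g]) (use Suc v in \<open>auto intro: vdeg_le_mono\<close>)
    then show ?case using Suc by (simp add: algebra_simps)
  qed simp
  then show ?thesis using \<open>i < m\<close> by blast
qed

text \<open>Subtracting the polynomial parts of the coefficients keeps the vector in the lattice and
  leaves coefficients of negative degree. If j were the last nonzero one, the degree of the vector
  would be below \<open>d j\<close> although it lies outside the span of the predecessors of
  \<open>b j\<close>, against minimality.\<close>

lemma greedy_generates:
  assumes g: "greedy m b d" and "comb m a b \<in> M" "i < m"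
  shows "a i \<in> poly_vals"
proof -
  have "\<forall>i. \<exists>p. deg_le (a i - Fract p 1) (- 1)" using poly_part by blast
  then obtain p where p: "deg_le (a i - Fract (p i) 1) (- 1)" for i by metis
  define c where "c = (\<lambda>i. a i - Fract (p i) 1)"
  have "comb m (\<lambda>i. Fract (- p i) 1) b \<in> M"
    using g by (intro comb_closed) (auto simp: greedy_def)
  with assms(2) have "comb m a b + comb m (\<lambda>i. Fract (- p i) 1) b \<in> M" by (rule add)
  moreover have "a + (\<lambda>i. Fract (- p i) 1) = c" by (auto simp: c_def fun_eq_iff simp flip: minus_fract)
  ultimately have cM: "comb m c b \<in> M" by (simp add: comb_add)
  have "c i = 0" if im: "i < m" for i
  proof (rule ccontr)
    assume "c i \<noteq> 0"
    then obtain j where j: "j < m" "c j \<noteq> 0" "\<And>i. j < i \<Longrightarrow> i < m \<Longrightarrow> c i = 0"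
      using ex_last_index[of i m "\<lambda>i. c i \<noteq> 0"] im by blast
    have *: "comb m c b = comb (Suc j) c b" by (rule comb_trunc) (use j in auto)
    have "comb (Suc j) c b \<notin> spn j b"
      using g j by (intro top_coeff_not_in_spn) (auto simp: greedy_def)
    moreover have "vdeg_le (comb (Suc j) c b) (d j - 1)"
    proof (rule vdeg_le_comb[where d = d])
      fix i assume "i < Suc j"
      then have "d i \<le> d j" using greedy_mono[OF g _ j(1)] by simp
      then show "deg_le (c i) (d j - 1 - d i)" using p[of i] unfolding c_def by (auto elim: deg_le_mono)
    qed (use g j in \<open>auto simp: greedy_def\<close>)
    ultimately have "d j \<le> d j - 1" using g j(1) cM unfolding * greedy_def by blast
    then show False by simp
  qed
  then show ?thesis using \<open>i < m\<close> by (simp add: c_def)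
qed

text \<open>All that the geometry uses of the greedy choice. Linear independence over K is contained
  in the last clause, since the zero vector satisfies every degree bound.\<close>

theorem reduced_basis:
  "\<exists>m b d. (\<forall>i<m. b i \<in> M \<and> vdeg_le (b i) (d i)) \<and> M \<subseteq> spn m b \<and>
     (\<forall>a. comb m a b \<in> M \<longrightarrow> (\<forall>i<m. a i \<in> poly_vals)) \<and>
     (\<forall>a e. vdeg_le (comb m a b) e \<longrightarrow> (\<forall>i<m. deg_le (a i) (e - d i)))"
proof -
  obtain m b d where g: "greedy m b d" "M \<subseteq> spn m b" using greedy_exists by blast
  show ?thesis
    by (intro exI[of _ m] exI[of _ b] exI[of _ d])
      (use g greedy_generates[OF g(1)] greedy_orthogonal[OF g(1)] in \<open>auto simp: greedy_def\<close>)
qed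

end

lemma deg_le_all_imp_0:
  assumes "\<And>d. deg_le c d"
  shows "c = 0"
proof (cases c)
  case (Fract p q)
  then show ?thesis using assms[of "- int (degree q) - 1"]
    by (auto simp: deg_le_Fract fract_collapse)
qed

subsection \<open>Homogeneous polynomials and dehomogenisation\<close>

definition dehom :: "'k::field poly poly \<Rightarrow> 'k poly" where
  "dehom f = poly f 1"

text \<open>This is y^d p(x/y). Terms of p of degree above d are dropped, hence the conditions
  \<open>degree p \<le> d\<close> below.\<close>

definition homog :: "nat \<Rightarrow> 'k::field poly \<Rightarrow> 'k poly poly" where
  "homog d p = (\<Sum>j\<le>d. monom (monom (coeff p (d - j)) (d - j)) j)"

lemma coeff_homog: "coeff (coeff (homog d p) j) i = (if i + j = d then coeff p i else 0)"
proof -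
  have "coeff (homog d p) j = (\<Sum>l\<le>d. if l = j then monom (coeff p (d - l)) (d - l) else 0)"
    by (simp add: homog_def coeff_sum)
  then show ?thesis by auto
qed

lemma coeff_hom_component:
  "coeff (coeff (hom_component d f) j) i = (if i + j = d then coeff (coeff f j) i else 0)"
proof -
  have "coeff (hom_component d f) j
      = (\<Sum>l\<le>d. if l = j then monom (coeff (coeff f l) (d - l)) (d - l) else 0)"
    by (simp add: hom_component_def coeff_sum)
  then show ?thesis by auto
qed

lemma poly_poly_eqI: "(\<And>i j. coeff (coeff f j) i = coeff (coeff g j) i) \<Longrightarrow> f = g"
  by (intro poly_eqI)

lemma homogeneous_homog: "homogeneous d (homog d p)"
  by (auto simp: homogeneous_def coeff_homog split: if_splits)

lemma homogeneous_hom_component: "homogeneous d (hom_component d f)"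
  by (auto simp: homogeneous_def coeff_hom_component split: if_splits)

lemma homogeneous_0 [simp]: "homogeneous d 0"
  by (simp add: homogeneous_def)

lemma homogeneous_add: "homogeneous d f \<Longrightarrow> homogeneous d g \<Longrightarrow> homogeneous d (f + g)"
  unfolding homogeneous_def by (metis add_0 coeff_add)

lemma homogeneous_mult:
  assumes "homogeneous d f" "homogeneous e g"
  shows "homogeneous (d + e) (f * g)"
  unfolding homogeneous_def
proof (intro allI impI)
  fix i j assume "coeff (coeff (f * g) j) i \<noteq> 0"
  then have "(\<Sum>l\<le>j. \<Sum>k\<le>i. coeff (coeff f l) k * coeff (coeff g (j - l)) (i - k)) \<noteq> 0"
    by (simp add: coeff_mult coeff_sum)
  then obtain l k where *: "l \<le> j" "k \<le> i" "coeff (coeff f l) k * coeff (coeff g (j - l)) (i - k) \<noteq> 0"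
    by (metis (no_types, lifting) atMost_iff sum.neutral)
  then have "k + l = d" "(i - k) + (j - l) = e" using assms by (auto simp: homogeneous_def)
  then show "i + j = d + e" using * by simp
qed

lemma poly_as_sum:
  fixes f :: "'a::comm_semiring_1 poly"
  shows "degree f \<le> n \<Longrightarrow> poly f x = (\<Sum>j\<le>n. coeff f j * x ^ j)"
  unfolding poly_altdef by (rule sum.mono_neutral_left) (force intro: le_degree)+

text \<open>Setting y = 1 merges all monomials x^i y^j with the same i, and a form of degree d
  contains only the one with j = d - i.\<close>

lemma coeff_dehom_homogeneous:
  assumes "homogeneous d f"
  shows "coeff (dehom f) i = (if i \<le> d then coeff (coeff f (d - i)) i else 0)"
proof -
  define n where "n = max d (degree f)"
  have "coeff (dehom f) i = (\<Sum>j\<le>n. coeff (coeff f j) i)"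
    unfolding dehom_def by (subst poly_as_sum[of _ n]) (simp_all add: n_def coeff_sum)
  also have "\<dots> = (\<Sum>j\<le>n. if j = d - i \<and> i \<le> d then coeff (coeff f j) i else 0)"
    using assms by (intro sum.cong) (force simp: homogeneous_def)+
  also have "\<dots> = (if i \<le> d then coeff (coeff f (d - i)) i else 0)"
    by (auto simp: n_def)
  finally show ?thesis .
qed

lemma dehom_homog: "degree p \<le> d \<Longrightarrow> dehom (homog d p) = p"
  by (intro poly_eqI) (auto simp: coeff_dehom_homogeneous[OF homogeneous_homog] coeff_homog coeff_eq_0)

lemma degree_dehom: "homogeneous d f \<Longrightarrow> degree (dehom f) \<le> d"
  by (intro degree_le) (simp add: coeff_dehom_homogeneous)

lemma homog_dehom:
  assumes "homogeneous d f"
  shows "homog d (dehom f) = f"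
proof (rule poly_poly_eqI)
  fix i j
  show "coeff (coeff (homog d (dehom f)) j) i = coeff (coeff f j) i"
  proof (cases "i + j = d")
    case True
    then have "d - i = j" "i \<le> d" by auto
    then show ?thesis using True by (simp add: coeff_homog coeff_dehom_homogeneous[OF assms])
  next
    case False
    then show ?thesis using assms by (auto simp: coeff_homog homogeneous_def)
  qed
qed

lemma dehom_inject: "homogeneous d f \<Longrightarrow> homogeneous d g \<Longrightarrow> dehom f = dehom g \<Longrightarrow> f = g"
  by (metis homog_dehom)

lemma dehom_simps [simp]: "dehom (f + g) = dehom f + dehom g" "dehom (f * g) = dehom f * dehom g"
  "dehom 0 = 0" "dehom 1 = 1" "dehom (- f) = - dehom f"
  by (simp_all add: dehom_def)

text \<open>Both sides are forms of the same degree, so they may be compared after setting y =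
  1.\<close>

lemma homog_mult:
  assumes "degree p \<le> d" "degree q \<le> e"
  shows "homog d p * homog e q = homog (d + e) (p * q)"
proof (rule dehom_inject)
  have "degree (p * q) \<le> d + e" using assms degree_mult_le[of p q] by linarith
  then show "dehom (homog d p * homog e q) = dehom (homog (d + e) (p * q))"
    using assms by (simp add: dehom_homog)
qed (auto intro: homogeneous_mult homogeneous_homog)

lemma homog_add: "homog d (p + q) = homog d p + homog d q"
  by (rule poly_poly_eqI) (simp add: coeff_homog)

lemma homog_0 [simp]: "homog d 0 = 0"
  by (rule poly_poly_eqI) (simp add: coeff_homog)

lemma homog_eq_0_iff: "degree p \<le> d \<Longrightarrow> homog d p = 0 \<longleftrightarrow> p = 0"
  using dehom_homog[of p d] by auto

lemma homogeneous_1: "homogeneous 0 (1 :: 'k::field poly poly)"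
  by (auto simp: homogeneous_def coeff_1 split: if_splits)

lemma homogeneous_dehom_0_iff: "homogeneous d f \<Longrightarrow> dehom f = 0 \<longleftrightarrow> f = 0"
  by (metis dehom_simps(3) homog_0 homog_dehom)

text \<open>Every sufficiently large cut-off works, so that one cut-off can serve two polynomials in
  \<open>hom_component_mult\<close>.\<close>

lemma sum_hom_components: "\<exists>n. \<forall>m\<ge>n. f = (\<Sum>d\<le>m. hom_component d f)"
proof -
  \<comment> \<open>The degree in y plus the sum of the degrees of all coefficients bounds the total
    degree of every monomial.\<close>
  define n where "n = degree f + (\<Sum>j\<le>degree f. degree (coeff f j))"
  have "coeff (coeff f j) i = 0" if "i + j > n" for i j
  proof (cases "j \<le> degree f")
    case True
    then have "degree (coeff f j) \<le> (\<Sum>j\<le>degree f. degree (coeff f j))"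
      using member_le_sum[of j "{..degree f}" "\<lambda>j. degree (coeff f j)"] by auto
    then show ?thesis using that True by (intro coeff_eq_0) (simp add: n_def)
  qed (simp add: coeff_eq_0)
  then have "f = (\<Sum>d\<le>m. hom_component d f)" if "m \<ge> n" for m
    using that by (intro poly_poly_eqI) (auto simp: coeff_sum coeff_hom_component not_le)
  then show ?thesis by blast
qed

subsection \<open>The function field\<close>

text \<open>The embedding of $k(t)$ into $k(x,y)$ as the fractions of degree zero, with $t = x/y$.\<close>

definition iota :: "'k::field poly fract \<Rightarrow> 'k poly poly fract" where
  "iota c = (SOME u. \<exists>p q d. q \<noteq> 0 \<and> degree p \<le> d \<and> degree q \<le> d \<and> c = Fract p q \<and>
     u = Fract (homog d p) (homog d q))"

text \<open>Neither the representative chosen in \<open>iota\<close> nor the common degree d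
  matters: both sides of a cross-multiplied identity homogenise to the same form.\<close>

lemma iota_Fract:
  assumes "q \<noteq> 0" "degree p \<le> d" "degree q \<le> d"
  shows "iota (Fract p q) = Fract (homog d p) (homog d q)"
  unfolding iota_def
proof (rule some_equality)
  fix u assume "\<exists>p' q' e. q' \<noteq> 0 \<and> degree p' \<le> e \<and> degree q' \<le> e \<and> Fract p q = Fract p' q' \<and>
     u = Fract (homog e p') (homog e q')"
  then obtain p' q' e where *: "q' \<noteq> 0" "degree p' \<le> e" "degree q' \<le> e" "Fract p q = Fract p' q'"
     "u = Fract (homog e p') (homog e q')" by blast
  then have "p' * q = p * q'" using assms by (simp add: eq_fract)
  then have "homog e p' * homog d q = homog d p * homog e q'"
    using assms * by (simp add: homog_mult add.commute)
  then show "u = Fract (homog d p) (homog d q)"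
    using * assms by (simp add: eq_fract homog_eq_0_iff)
qed (use assms in blast)

lemma Fract_cases_degree:
  obtains p q d where "c = Fract p q" "q \<noteq> 0" "degree p \<le> d" "degree q \<le> d"
proof -
  obtain p q where "c = Fract p q" "q \<noteq> 0" by (cases c)
  then show ?thesis using that[of p q "max (degree p) (degree q)"] by simp
qed

lemma iota_inject: "iota c = iota c' \<longleftrightarrow> c = c'"
proof
  assume eq: "iota c = iota c'"
  obtain p q d where c: "c = Fract p q" "q \<noteq> 0" "degree p \<le> d" "degree q \<le> d" by (rule Fract_cases_degree)
  obtain p' q' e where c': "c' = Fract p' q'" "q' \<noteq> 0" "degree p' \<le> e" "degree q' \<le> e" by (rule Fract_cases_degree)
  have "homog d p * homog e q' = homog e p' * homog d q"
    using eq c c' by (simp add: iota_Fract eq_fract homog_eq_0_iff)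
  from arg_cong[OF this, of dehom] have "p * q' = p' * q" using c c' by (simp add: dehom_homog)
  then show "c = c'" using c c' by (simp add: eq_fract)
qed simp

lemma iota_mult: "iota (c * c') = iota c * iota c'"
proof -
  obtain p q d where c: "c = Fract p q" "q \<noteq> 0" "degree p \<le> d" "degree q \<le> d" by (rule Fract_cases_degree)
  obtain p' q' e where c': "c' = Fract p' q'" "q' \<noteq> 0" "degree p' \<le> e" "degree q' \<le> e" by (rule Fract_cases_degree)
  have "degree (p * p') \<le> d + e" "degree (q * q') \<le> d + e"
    using c c' degree_mult_le[of p p'] degree_mult_le[of q q'] by linarith+
  then show ?thesis using c c' by (simp add: iota_Fract homog_mult)
qed

lemma iota_add: "iota (c + c') = iota c + iota c'"
proof -
  obtain p q d where c: "c = Fract p q" "q \<noteq> 0" "degree p \<le> d" "degree q \<le> d" by (rule Fract_cases_degree)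
  obtain p' q' e where c': "c' = Fract p' q'" "q' \<noteq> 0" "degree p' \<le> e" "degree q' \<le> e" by (rule Fract_cases_degree)
  have 1: "degree (p * q') \<le> d + e" "degree (p' * q) \<le> d + e" "degree (q * q') \<le> d + e"
    using c c' degree_mult_le[of p q'] degree_mult_le[of p' q] degree_mult_le[of q q'] by linarith+
  then have 2: "degree (p * q' + p' * q) \<le> d + e" by (simp add: degree_add_le)
  have "homog d p * homog e q' + homog e p' * homog d q = homog (d + e) (p * q' + p' * q)"
    using c c' by (simp add: homog_add homog_mult add.commute[of e d])
  then show ?thesis using c c' 1 2 by (simp add: iota_Fract homog_mult homog_eq_0_iff)
qed

lemma iota_0 [simp]: "iota 0 = 0"
  by (metis iota_add add_0 add_cancel_right_right)

lemma iota_1 [simp]: "iota 1 = 1"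
proof -
  have "iota (1 :: 'a poly fract) \<noteq> 0" using iota_inject[of "1 :: 'a poly fract" 0] by simp
  \<comment> \<open>A nonzero idempotent of a field is 1.\<close>
  then show ?thesis using iota_mult[of "1 :: 'a poly fract" 1] by simp
qed

lemma iota_uminus: "iota (- c) = - iota c"
  using iota_add[of c "- c"] by (simp add: eq_neg_iff_add_eq_0 add.commute)

text \<open>The image of \<open>iota\<close> contains every fraction of forms of equal degree, so
  the values of regular functions can be read in k(t).\<close>

lemma homogeneous_fraction:
  assumes "homogeneous d a" "homogeneous d b" "b \<noteq> 0"
  shows "Fract a b = iota (Fract (dehom a) (dehom b))"
  using assms by (subst iota_Fract[of _ _ d]) (auto simp: degree_dehom homog_dehom homogeneous_dehom_0_iff)

subsection \<open>Points of the projective line\<close>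

lemma P1_pointsD:
  assumes "P \<in> P1_points"
  shows "0 \<in> P" "a \<in> P \<Longrightarrow> b \<in> P \<Longrightarrow> a + b \<in> P" "a \<in> P \<Longrightarrow> r * a \<in> P" "a \<in> P \<Longrightarrow> a * r \<in> P"
    "a * b \<in> P \<Longrightarrow> a \<in> P \<or> b \<in> P" "1 \<notin> P" "f \<in> P \<Longrightarrow> hom_component d f \<in> P"
proof -
  interpret primeideal P kxy using assms by (simp add: P1_points_def)
  have I: "ideal P kxy" by (rule is_ideal)
  show "0 \<in> P" "a \<in> P \<Longrightarrow> b \<in> P \<Longrightarrow> a + b \<in> P" and *: "a \<in> P \<Longrightarrow> r * a \<in> P" for a b r
    using I by (auto simp: ideal_kxy_iff)
  show "a \<in> P \<Longrightarrow> a * r \<in> P" using *[of a r] by (simp add: mult.commute)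
  show "a * b \<in> P \<Longrightarrow> a \<in> P \<or> b \<in> P" using I_prime[of a b] by (simp add: kxy_def)
  show "1 \<notin> P"
  proof
    assume "1 \<in> P"
    then have "r \<in> P" for r using *[of 1 r] by simp
    then show False using I_notcarr by (auto simp: kxy_def)
  qed
  show "f \<in> P \<Longrightarrow> hom_component d f \<in> P"
    using assms by (simp add: P1_points_def homogeneous_ideal_def)
qed

lemma cring_kxy: "cring kxy"
  by (unfold_locales)
    (auto simp: kxy_def algebra_simps Units_def intro: exI[of _ "- _"])

lemma primeideal_kxyI:
  assumes "0 \<in> P" "\<And>a b. a \<in> P \<Longrightarrow> b \<in> P \<Longrightarrow> a + b \<in> P" "\<And>a r. a \<in> P \<Longrightarrow> r * a \<in> P"
    "\<And>a b. a * b \<in> P \<Longrightarrow> a \<in> P \<or> b \<in> P" "1 \<notin> P"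
  shows "primeideal P kxy"
proof (rule primeidealI)
  show "ideal P kxy" using assms by (simp add: ideal_kxy_iff)
qed (use assms in \<open>auto simp: kxy_def cring_kxy[unfolded kxy_def]\<close>)

lemma P1_pointsI:
  assumes "0 \<in> P" "\<And>a b. a \<in> P \<Longrightarrow> b \<in> P \<Longrightarrow> a + b \<in> P" "\<And>a r. a \<in> P \<Longrightarrow> r * a \<in> P"
    "\<And>a b. a * b \<in> P \<Longrightarrow> a \<in> P \<or> b \<in> P" "1 \<notin> P" "\<And>f d. f \<in> P \<Longrightarrow> hom_component d f \<in> P"
    "g \<in> irrelevant_ideal" "g \<notin> P"
  shows "P \<in> P1_points"
  using assms primeideal_kxyI[OF assms(1-5)]
  by (auto simp: P1_points_def homogeneous_ideal_def ideal_kxy_iff)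

text \<open>An element is the sum of its homogeneous components, which stay in \<open>I\<close>;
  hence inclusions into a point are decided by forms.\<close>

lemma point_subset_homogeneous:
  assumes "P \<in> P1_points" "\<And>f d. f \<in> I \<Longrightarrow> hom_component d f \<in> I"
    "\<And>f d. f \<in> I \<Longrightarrow> homogeneous d f \<Longrightarrow> f \<in> P"
  shows "I \<subseteq> P"
proof
  fix f assume "f \<in> I"
  obtain n where n: "f = (\<Sum>d\<le>n. hom_component d f)" using sum_hom_components by blast
  have "hom_component d f \<in> P" for d
    using assms(2,3) \<open>f \<in> I\<close> homogeneous_hom_component by blast
  then have "(\<Sum>d\<le>n. hom_component d f) \<in> P" for n
    by (induction n) (auto intro: P1_pointsD(2)[OF assms(1)])
  then show "f \<in> P" using n by metis
qed

abbreviation xvar :: "'k::field poly poly" where "xvar \<equiv> homog 1 (monom 1 1)"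
abbreviation yvar :: "'k::field poly poly" where "yvar \<equiv> homog 1 1"

definition eta :: "'k::field P1_point" where "eta = {0}"
text \<open>The ideal (y), since \<open>coeff f 0\<close> is the part of \<open>f\<close> free of
  y.\<close>

definition infpt :: "'k::field P1_point" where "infpt = {f. coeff f 0 = 0}"

lemma xvar_irrelevant: "xvar \<in> irrelevant_ideal"
  unfolding irrelevant_ideal_def
  by (auto intro!: poly_poly_eqI simp: coeff_hom_component coeff_homog)

lemma xvar_nonzero: "(xvar :: 'k::field poly poly) \<noteq> 0"
  by (subst homog_eq_0_iff) (auto simp: degree_monom_eq)

lemma hom_component_0 [simp]: "hom_component d 0 = 0"
  by (rule poly_poly_eqI) (simp add: coeff_hom_component)

lemma eta_point: "eta \<in> P1_points"
  using xvar_irrelevant xvar_nonzero by (intro P1_pointsI[of _ xvar]) (auto simp: eta_def simp del: One_nat_def)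

lemma xvar_not_infpt: "xvar \<notin> infpt"
proof
  assume "(xvar :: 'a poly poly) \<in> infpt"
  then have "coeff (coeff (xvar :: 'a poly poly) 0) 1 = 0" by (simp add: infpt_def)
  then show False by (simp add: coeff_homog)
qed

lemma infpt_point: "infpt \<in> P1_points"
proof (rule P1_pointsI[of _ xvar])
  show "hom_component d f \<in> infpt" if "f \<in> infpt" for f :: "'a poly poly" and d
    using that by (auto simp: infpt_def intro: poly_eqI simp: coeff_hom_component)
qed (use xvar_irrelevant xvar_not_infpt in \<open>auto simp: infpt_def coeff_mult_0 simp del: One_nat_def\<close>)

lemma yvar_in_infpt: "yvar \<in> infpt"
  by (auto simp: infpt_def coeff_homog intro: poly_eqI)

text \<open>The only monomial of degree d free of y is x^d, and its coefficient survives as the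
  coefficient of t^d.\<close>

lemma homogeneous_in_infpt:
  assumes "homogeneous d b"
  shows "b \<in> infpt \<longleftrightarrow> coeff (dehom b) d = 0"
proof -
  have "coeff (coeff b 0) i = (if i = d then coeff (dehom b) d else 0)" for i
    using assms[unfolded homogeneous_def, rule_format, where i = i and j = 0]
    by (auto simp: coeff_dehom_homogeneous[OF assms])
  then have "coeff b 0 = 0 \<longleftrightarrow> coeff (dehom b) d = 0" by (metis coeff_0 poly_eq_iff)
  then show ?thesis by (simp add: infpt_def)
qed

lemma homogeneous_not_infpt:
  assumes "homogeneous d b"
  shows "b \<notin> infpt \<longleftrightarrow> b \<noteq> 0 \<and> degree (dehom b) = d"
proof -
  have "b \<notin> infpt \<longleftrightarrow> coeff (dehom b) d \<noteq> 0"
    using homogeneous_in_infpt[OF assms] by simp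
  also have "\<dots> \<longleftrightarrow> b \<noteq> 0 \<and> degree (dehom b) = d"
    using degree_dehom[OF assms] homogeneous_dehom_0_iff[OF assms]
    by (metis coeff_0 le_degree le_antisym leading_coeff_neq_0)
  finally show ?thesis .
qed

text \<open>Separates the x^d term of a form from the rest, which is divisible by y.\<close>

lemma homogeneous_split:
  assumes "homogeneous d g"
  shows "\<exists>m h. homogeneous d h \<and> h \<in> infpt \<and> g = homog d (monom m d) + h \<and> (g \<notin> infpt \<longrightarrow> m \<noteq> 0)"
proof -
  define m where "m = coeff (dehom g) d"
  define h where "h = g + homog d (monom (- m) d)"
  have "homogeneous d h" unfolding h_def by (intro homogeneous_add homogeneous_homog assms)
  moreover have "coeff (dehom h) d = 0"
    by (simp add: h_def m_def dehom_homog degree_monom_le)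
  moreover have "g = homog d (monom m d) + h"
    by (simp add: h_def add.left_commute flip: homog_add) (simp add: add_monom)
  moreover have "h \<in> infpt" if "homogeneous d h" "coeff (dehom h) d = 0"
    using that homogeneous_in_infpt by blast
  moreover have "g \<notin> infpt \<Longrightarrow> m \<noteq> 0" using homogeneous_in_infpt[OF assms] by (simp add: m_def)
  ultimately show ?thesis by blast
qed

lemma homog_monom_mult:
  "homog d (monom a d) * homog e (monom b e) = homog (d + e) (monom (a * b) (d + e))"
  by (subst homog_mult) (auto simp: degree_monom_le mult_monom)

lemma homog_0_1: "homog 0 (monom 1 0) = 1"
  by (rule dehom_inject[of 0])
    (auto simp: homogeneous_homog homogeneous_1 dehom_homog monom_0 simp flip: one_pCons)

text \<open>Infinity is the only point outside the chart y \<noteq> 0. Forms in (y) are multiples of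
  y, which gives one inclusion. A further form in P would contribute a power of x, hence x itself,
  and then P would contain the irrelevant ideal.\<close>

lemma yvar_in_point:
  assumes P: "P \<in> P1_points" and y: "yvar \<in> P"
  shows "P = infpt"
proof
  have yf: "f \<in> P" if "homogeneous d f" "f \<in> infpt" for f d
  proof (cases "f = 0")
    case False
    then have "degree (dehom f) < d"
      using homogeneous_not_infpt[OF that(1)] that degree_dehom[OF that(1)] by fastforce
    \<comment> \<open>The degree drop leaves room for an explicit factor y.\<close>
    then have "homog (d - 1) (dehom f) * yvar = homog (d - 1 + 1) (dehom f * 1)"
      by (intro homog_mult) auto
    also have "\<dots> = f" using \<open>degree (dehom f) < d\<close> homog_dehom[OF that(1)] by simp
    finally show ?thesis using y P1_pointsD(3)[OF P] by metis
  qed (use P1_pointsD(1)[OF P] in simp)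
  show "infpt \<subseteq> P"
    by (rule point_subset_homogeneous[OF P]) (use yf infpt_point P1_pointsD(7) in auto)
  show "P \<subseteq> infpt"
  proof (rule point_subset_homogeneous[OF infpt_point])
    fix f d assume f: "f \<in> P" "homogeneous d f"
    show "f \<in> infpt"
    proof (rule ccontr)
      assume n: "f \<notin> infpt"
      obtain l h where h: "homogeneous d h" "h \<in> infpt" "f = homog d (monom l d) + h" "l \<noteq> 0"
        using homogeneous_split[OF f(2)] n by blast
      have "f + (- 1) * h \<in> P" using f(1) yf[OF h(1,2)] P1_pointsD[OF P] by blast
      then have "homog d (monom l d) \<in> P" using h by simp
      \<comment> \<open>Multiplication by the constant 1/l normalises the remaining term to
        x^d.\<close>
      then have "homog 0 (monom (inverse l) 0) * homog d (monom l d) \<in> P" using P1_pointsD(3)[OF P] by blast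
      then have xd: "homog d (monom 1 d) \<in> P" using h by (subst (asm) homog_monom_mult) simp
      have x: "xvar \<in> P"
        using xd
      proof (induction d)
        case 0
        then show ?case using P1_pointsD(6)[OF P] homog_0_1 by metis
      next
        case (Suc d)
        then have "xvar * homog d (monom 1 d) \<in> P" by (subst homog_monom_mult) simp
        then show ?case using Suc P1_pointsD(5)[OF P] by blast
      qed
      have "irrelevant_ideal \<subseteq> P"
      proof (rule point_subset_homogeneous[OF P])
        show "hom_component e g \<in> irrelevant_ideal" if "g \<in> irrelevant_ideal" for g :: "'a poly poly" and e
        proof (cases "e = 0")
          case False
          then show ?thesis by (auto simp: irrelevant_ideal_def coeff_hom_component intro!: poly_poly_eqI)
        qed (use that in \<open>auto simp: irrelevant_ideal_def\<close>)
        fix g :: "'a poly poly" and e assume g: "g \<in> irrelevant_ideal" "homogeneous e g"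
        show "g \<in> P"
        proof (cases e)
          case 0
          have "hom_component e g = g"
            using g by (intro poly_poly_eqI) (auto simp: coeff_hom_component homogeneous_def)
          then have "g = 0" using g 0 by (auto simp: irrelevant_ideal_def)
          then show ?thesis using P1_pointsD(1)[OF P] by simp
        next
          case (Suc e')
          obtain m h where h: "homogeneous e h" "h \<in> infpt" "g = homog e (monom m e) + h"
            using homogeneous_split[OF g(2)] by blast
          have "xvar * homog e' (monom m e') \<in> P" using x P1_pointsD(4)[OF P] by blast
          then have "homog e (monom m e) \<in> P" by (subst (asm) homog_monom_mult) (simp add: Suc)
          then show ?thesis using yf[OF h(1,2)] h(3) P1_pointsD(2)[OF P] by blast
        qed
      qed
      then show False using P by (simp add: P1_points_def)
    qed
  qed (use P1_pointsD(7)[OF P] in auto)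
qed

section \<open>Components of products and the point of a prime polynomial\<close>

lemma hom_component_add: "hom_component d (f + g) = hom_component d f + hom_component d g"
  by (rule poly_poly_eqI) (simp add: coeff_hom_component)

lemma hom_component_sum: "hom_component d (sum f A) = (\<Sum>x\<in>A. hom_component d (f x))"
  by (induction A rule: infinite_finite_induct) (simp_all add: hom_component_add)

lemma hom_component_homogeneous:
  "homogeneous e f \<Longrightarrow> hom_component d f = (if d = e then f else 0)"
  by (rule poly_poly_eqI) (auto simp: coeff_hom_component homogeneous_def)

text \<open>The index range may be enlarged at will, so that it can be made to contain any
  prescribed pair of degrees.\<close>

lemma hom_component_mult:
  "\<exists>N. \<forall>M\<ge>N. hom_component n (f * g) =
     (\<Sum>(i, j)\<in>{..M} \<times> {..M}. if n = i + j then hom_component i f * hom_component j g else 0)"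
proof -
  obtain N1 where N1: "\<And>M. M \<ge> N1 \<Longrightarrow> f = (\<Sum>d\<le>M. hom_component d f)" using sum_hom_components by blast
  obtain N2 where N2: "\<And>M. M \<ge> N2 \<Longrightarrow> g = (\<Sum>d\<le>M. hom_component d g)" using sum_hom_components by blast
  have "hom_component n (f * g) =
     (\<Sum>(i, j)\<in>{..M} \<times> {..M}. if n = i + j then hom_component i f * hom_component j g else 0)"
    if "M \<ge> max N1 N2" for M
  proof -
    have "f * g = (\<Sum>d\<le>M. hom_component d f) * (\<Sum>d\<le>M. hom_component d g)"
      using N1[of M] N2[of M] that by simp
    also have "\<dots> = (\<Sum>(i, j)\<in>{..M} \<times> {..M}. hom_component i f * hom_component j g)"
      by (simp add: sum_product sum.cartesian_product)
    finally have "hom_component n (f * g) =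
        (\<Sum>(i, j)\<in>{..M} \<times> {..M}. hom_component n (hom_component i f * hom_component j g))"
      by (simp add: hom_component_sum split_def)
    also have "\<dots> = (\<Sum>(i, j)\<in>{..M} \<times> {..M}. if n = i + j then hom_component i f * hom_component j g else 0)"
      by (intro sum.cong)
        (auto simp: hom_component_homogeneous[OF homogeneous_mult[OF homogeneous_hom_component homogeneous_hom_component]])
    finally show ?thesis .
  qed
  then show ?thesis by blast
qed

text \<open>For nonzero p this is the ideal generated by the form \<open>homog (degree p) p\<close>.
  Testing each component for divisibility in k[t] makes the ideal homogeneous by
  construction.\<close>

definition point_of :: "'k::field poly \<Rightarrow> 'k P1_point" where
  "point_of p = {f. \<forall>d. p dvd dehom (hom_component d f)}"

lemma homogeneous_in_point_of: "homogeneous d f \<Longrightarrow> f \<in> point_of p \<longleftrightarrow> p dvd dehom f"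
  by (auto simp: point_of_def hom_component_homogeneous)

text \<open>Compare the components of \<open>f\<close> and \<open>g\<close> of lowest degree that are not divisible by \<open>p\<close>.\<close>

lemma point_of_prime:
  assumes p: "prime_elem p" and fg: "f * g \<in> point_of p"
  shows "f \<in> point_of p \<or> g \<in> point_of p"
proof (rule ccontr)
  assume "\<not> ?thesis"
  then have ex: "\<exists>d. \<not> p dvd dehom (hom_component d f)" "\<exists>d. \<not> p dvd dehom (hom_component d g)"
    by (auto simp: point_of_def)
  define d where "d = (LEAST d. \<not> p dvd dehom (hom_component d f))"
  define e where "e = (LEAST d. \<not> p dvd dehom (hom_component d g))"
  have d: "\<not> p dvd dehom (hom_component d f)" "\<And>i. i < d \<Longrightarrow> p dvd dehom (hom_component i f)"
    using LeastI_ex[OF ex(1)] not_less_Least unfolding d_def by blast+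
  have e: "\<not> p dvd dehom (hom_component e g)" "\<And>i. i < e \<Longrightarrow> p dvd dehom (hom_component i g)"
    using LeastI_ex[OF ex(2)] not_less_Least unfolding e_def by blast+
  define h where "h = (\<lambda>(i, j). if d + e = i + j then hom_component i f * hom_component j g else 0)"
  obtain N where N: "\<And>M. M \<ge> N \<Longrightarrow> hom_component (d + e) (f * g) = sum h ({..M} \<times> {..M})"
    using hom_component_mult[of "d + e" f g] unfolding h_def by blast
  \<comment> \<open>Adding d + e to the cut-off ensures that the critical pair (d, e) is among the
    indices.\<close>
  define S where "S = {..N + d + e} \<times> {..N + d + e}"
  have S: "finite S" "(d, e) \<in> S" by (auto simp: S_def)
  have dsum: "dehom (sum h A) = (\<Sum>x\<in>A. dehom (h x))" for A
    by (induction A rule: infinite_finite_induct) simp_all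
  have rest: "p dvd (\<Sum>x\<in>S - {(d, e)}. dehom (h x))"
  proof (rule dvd_sum)
    fix x assume x: "x \<in> S - {(d, e)}"
    obtain i j where [simp]: "x = (i, j)" by (cases x)
    show "p dvd dehom (h x)"
    proof (cases "d + e = i + j")
      case True
      then have "i < d \<or> j < e" using x by auto
      then show ?thesis using True d(2) e(2) by (auto simp: h_def)
    qed (simp add: h_def)
  qed
  have "p dvd dehom (hom_component (d + e) (f * g))" using fg by (simp add: point_of_def)
  also have "dehom (hom_component (d + e) (f * g)) = dehom (h (d, e)) + (\<Sum>x\<in>S - {(d, e)}. dehom (h x))"
    using N[of "N + d + e"] S by (simp add: dsum S_def[symmetric] sum.remove)
  finally have "p dvd dehom (h (d, e))" using rest by (simp add: dvd_add_left_iff)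
  then have "p dvd dehom (hom_component d f) * dehom (hom_component e g)" by (simp add: h_def)
  then show False using d(1) e(1) p prime_elem_dvd_mult_iff by blast
qed

lemma yvar_irrelevant: "yvar \<in> irrelevant_ideal"
  unfolding irrelevant_ideal_def
  by (auto intro!: poly_poly_eqI simp: coeff_hom_component coeff_homog)

lemma yvar_not_point_of:
  assumes "prime_elem p"
  shows "yvar \<notin> point_of p"
proof -
  have "\<not> p dvd 1" using assms by (simp add: prime_elem_def)
  then show ?thesis
    using homogeneous_in_point_of[where p = p, OF homogeneous_homog[of 1 1]] by (simp add: dehom_homog)
qed

lemma point_of_closed:
  "0 \<in> point_of p" "a \<in> point_of p \<Longrightarrow> b \<in> point_of p \<Longrightarrow> a + b \<in> point_of p"
  "f \<in> point_of p \<Longrightarrow> hom_component d f \<in> point_of p"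
  by (auto simp: point_of_def hom_component_add hom_component_homogeneous[OF homogeneous_hom_component])

lemma point_of_smult:
  assumes "a \<in> point_of p"
  shows "r * a \<in> point_of p"
  unfolding point_of_def
proof (intro CollectI allI)
  fix n
  obtain N where "hom_component n (r * a) =
     (\<Sum>(i, j)\<in>{..N} \<times> {..N}. if n = i + j then hom_component i r * hom_component j a else 0)"
    using hom_component_mult by blast
  moreover have "p dvd dehom (sum h A)" if "\<And>x. x \<in> A \<Longrightarrow> p dvd dehom (h x)" for A and h :: "nat \<times> nat \<Rightarrow> _"
    using that by (induction A rule: infinite_finite_induct) auto
  moreover have "p dvd dehom (hom_component j a)" for j using assms by (simp add: point_of_def)
  ultimately show "p dvd dehom (hom_component n (r * a))" by auto
qed

lemma point_of_point:
  assumes "prime_elem p"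
  shows "point_of p \<in> P1_points"
proof (rule P1_pointsI[of _ yvar])
  show "1 \<notin> point_of p" using assms by (simp add: homogeneous_in_point_of[OF homogeneous_1] prime_elem_def)
qed (use point_of_prime[OF assms] point_of_closed point_of_smult yvar_irrelevant yvar_not_point_of[OF assms] in auto)

lemma point_of_not_infpt: "prime_elem p \<Longrightarrow> point_of p \<noteq> infpt"
  using yvar_not_point_of yvar_in_infpt by metis

subsection \<open>Points of the affine line\<close>

text \<open>The prime ideal of $k[t]$ belonging to a point other than infinity.\<close>

definition aff :: "'k::field P1_point \<Rightarrow> 'k poly set" where
  "aff P = {p. homog (degree p) p \<in> P}"

locale affine_point =
  fixes P :: "'k::field P1_point"
  assumes point: "P \<in> P1_points" and finite_point: "P \<noteq> infpt"
begin

lemmas pt = P1_pointsD[OF point]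

lemma y_notin: "yvar \<notin> P"
  using yvar_in_point[OF point] finite_point by blast

text \<open>P is prime and does not contain y, so additional factors of y do not affect
  membership.\<close>

lemma homog_in:
  assumes "degree p \<le> d"
  shows "homog d p \<in> P \<longleftrightarrow> p \<in> aff P"
  using assms
proof (induction d rule: dec_induct)
  case (step d)
  have "homog d p * yvar = homog (d + 1) (p * 1)" using step by (intro homog_mult) auto
  then show ?case using step y_notin pt(4,5) by (metis Suc_eq_plus1 mult.right_neutral)
qed (simp add: aff_def)

lemma homogeneous_in: "homogeneous d f \<Longrightarrow> f \<in> P \<longleftrightarrow> dehom f \<in> aff P"
  using homog_in[OF degree_dehom] homog_dehom by metis

lemma aff_0: "0 \<in> aff P"
  using pt(1) by (simp add: aff_def)

lemma aff_1: "1 \<notin> aff P"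
  using homogeneous_in[OF homogeneous_1] pt(6) by simp

lemma aff_add:
  assumes "p \<in> aff P" "q \<in> aff P"
  shows "p + q \<in> aff P"
proof -
  define d where "d = max (degree p) (degree q)"
  have *: "degree p \<le> d" "degree q \<le> d" by (auto simp: d_def)
  then have "degree (p + q) \<le> d" by (simp add: degree_add_le)
  then show ?thesis using assms homog_in * pt(2) homog_add by metis
qed

lemma aff_mult_iff: "p * q \<in> aff P \<longleftrightarrow> p \<in> aff P \<or> q \<in> aff P"
proof -
  have "p * q \<in> aff P \<longleftrightarrow> homog (degree p + degree q) (p * q) \<in> P"
    by (rule homog_in[symmetric]) (rule degree_mult_le)
  also have "\<dots> \<longleftrightarrow> homog (degree p) p * homog (degree q) q \<in> P" by (simp add: homog_mult)
  also have "\<dots> \<longleftrightarrow> p \<in> aff P \<or> q \<in> aff P" using pt(3,4,5) unfolding aff_def by blast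
  finally show ?thesis .
qed

lemma aff_power: "p ^ n \<in> aff P \<Longrightarrow> p \<in> aff P"
  by (induction n) (auto simp: aff_1 aff_mult_iff)

lemma aff_prod: "finite A \<Longrightarrow> (\<And>x. x \<in> A \<Longrightarrow> f x \<notin> aff P) \<Longrightarrow> prod f A \<notin> aff P"
  by (induction A rule: finite_induct) (auto simp: aff_1 aff_mult_iff)

text \<open>As k[t] is Euclidean, a nonzero element of least degree generates. The generator 0
  covers the generic point.\<close>

lemma aff_principal: "\<exists>p. aff P = {q. p dvd q} \<and> \<not> p dvd 1"
proof (cases "aff P = {0}")
  case False
  then have "\<exists>d. \<exists>p\<in>aff P. p \<noteq> 0 \<and> degree p = d" using aff_0 by blast
  define d where "d = (LEAST d. \<exists>p\<in>aff P. p \<noteq> 0 \<and> degree p = d)"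
  obtain p where p: "p \<in> aff P" "p \<noteq> 0" "degree p = d"
    using LeastI_ex[OF \<open>\<exists>d. \<exists>p\<in>aff P. p \<noteq> 0 \<and> degree p = d\<close>] unfolding d_def by blast
  have min: "d \<le> degree q" if "q \<in> aff P" "q \<noteq> 0" for q
    unfolding d_def using that by (intro Least_le) blast
  have "p dvd q" if "q \<in> aff P" for q
  proof -
    have "q + (- (q div p)) * p \<in> aff P" using that p aff_mult_iff aff_add by blast
    then have "q mod p \<in> aff P" by (simp add: minus_div_mult_eq_mod)
    then have "q mod p = 0" using min[of "q mod p"] degree_mod_less[OF p(2), of q] p(3) by linarith
    then show ?thesis by auto
  qed
  moreover have "q \<in> aff P" if "p dvd q" for q
    using that p(1) aff_mult_iff by (auto simp: dvd_def)
  ultimately show ?thesis using aff_1 by blast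
qed (auto intro: exI[of _ 0])

end

lemma affine_pointI: "P \<in> P1_points \<Longrightarrow> P \<noteq> infpt \<Longrightarrow> affine_point P"
  by unfold_locales

lemma aff_inject:
  assumes "affine_point P" "affine_point Q" "aff P = aff Q"
  shows "P = Q"
proof -
  have "P \<subseteq> Q" if "affine_point P" "affine_point Q" "aff P = aff Q" for P Q :: "'a P1_point"
  proof (rule point_subset_homogeneous)
    show "Q \<in> P1_points" using that by (simp add: affine_point_def)
    show "hom_component d f \<in> P" if "f \<in> P" for f d
      using that P1_pointsD(7) \<open>affine_point P\<close> affine_point.point by blast
    show "f \<in> Q" if "f \<in> P" "homogeneous d f" for f d
      using that affine_point.homogeneous_in \<open>affine_point P\<close> \<open>affine_point Q\<close> \<open>aff P = aff Q\<close> by metis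
  qed
  then show ?thesis using assms by (metis subset_antisym)
qed

text \<open>Nonzero primes of k[t] are maximal: write the generator as p = q r with q generating the
  larger ideal. Then q or r lies in \<open>aff P\<close>, and the second would make q a
  unit.\<close>

lemma affine_point_maximal:
  assumes P: "affine_point P" and Q: "affine_point Q" and sub: "aff P \<subseteq> aff Q" and ne: "aff P \<noteq> {0}"
  shows "P = Q"
proof -
  obtain p where p: "aff P = {r. p dvd r}" "\<not> p dvd 1" using affine_point.aff_principal[OF P] by blast
  obtain q where q: "aff Q = {r. q dvd r}" "\<not> q dvd 1" using affine_point.aff_principal[OF Q] by blast
  have "q dvd p" using sub p q by auto
  then obtain r where r: "p = q * r" by (auto simp: dvd_def)
  have "p \<noteq> 0" using ne p affine_point.aff_0[OF P] by auto
  have "q * r \<in> aff P" using r p by simp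
  then have "q \<in> aff P \<or> r \<in> aff P" using affine_point.aff_mult_iff[OF P] by blast
  then have "q \<in> aff P"
  proof
    assume "r \<in> aff P"
    then obtain s where "r = p * s" using p by (auto simp: dvd_def)
    then have "p * 1 = p * (q * s)" using r by (simp add: mult.left_commute mult.commute)
    then have "q dvd 1" using \<open>p \<noteq> 0\<close> by (simp only: mult_cancel_left) (auto simp: dvd_def)
    then show ?thesis using q by blast
  qed
  then have "aff Q \<subseteq> aff P" using p q by (auto intro: dvd_trans)
  then show ?thesis using aff_inject[OF P Q] sub by blast
qed

text \<open>Induction on the degree: the generator q of one such point is split off, and every other
  point containing g must contain the cofactor.\<close>

lemma finite_points_containing:
  "g \<noteq> 0 \<Longrightarrow> finite {P. affine_point P \<and> g \<in> aff P}"
proof (induction "degree g" arbitrary: g rule: less_induct)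
  case less
  show ?case
  proof (cases "{P. affine_point P \<and> g \<in> aff P} = {}")
    case False
    then obtain Q where Q: "affine_point Q" "g \<in> aff Q" by blast
    obtain q where q: "aff Q = {r. q dvd r}" "\<not> q dvd 1" using affine_point.aff_principal[OF Q(1)] by blast
    obtain h where h: "g = q * h" using Q q by (auto simp: dvd_def)
    have "degree q \<noteq> 0" using q h less.prems by (metis is_unit_iff_degree mult_zero_left)
    then have "finite {P. affine_point P \<and> h \<in> aff P}"
      using less.hyps[of h] less.prems h by (auto simp: degree_mult_eq)
    moreover have "P = Q \<or> h \<in> aff P" if P: "affine_point P" "g \<in> aff P" for P
    proof -
      have "q \<in> aff P \<or> h \<in> aff P" using P h affine_point.aff_mult_iff by blast
      moreover have "P = Q" if "q \<in> aff P"
      proof -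
        have "aff Q \<subseteq> aff P" using q that affine_point.aff_mult_iff[OF P(1)] by (auto simp: dvd_def)
        moreover have "aff Q \<noteq> {0}" using Q less.prems by auto
        ultimately show ?thesis using affine_point_maximal[OF Q(1) P(1)] by simp
      qed
      ultimately show ?thesis by blast
    qed
    then have "{P. affine_point P \<and> g \<in> aff P} \<subseteq> insert Q {P. affine_point P \<and> h \<in> aff P}" by blast
    ultimately show ?thesis by (metis finite_insert finite_subset)
  qed (metis finite.emptyI)
qed

subsection \<open>Local rings\<close>

text \<open>The local ring at P as a subring of K. The description by forms treats infinity and the
  finite points alike; \<open>loc_infpt\<close> and \<open>in_loc\<close> give the two concrete
  shapes.\<close>

definition loc :: "'k::field P1_point \<Rightarrow> 'k poly fract set" where
  "loc P = {c. \<exists>d a b. homogeneous d a \<and> homogeneous d b \<and> b \<notin> P \<and> iota c = Fract a b}"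

lemma locE:
  assumes "P \<in> P1_points" "c \<in> loc P"
  obtains d a b where "homogeneous d a" "homogeneous d b" "b \<notin> P" "b \<noteq> 0" "iota c = Fract a b"
  using assms P1_pointsD(1)[OF assms(1)] unfolding loc_def by blast

lemma loc_closed:
  assumes P: "P \<in> P1_points"
  shows "0 \<in> loc P" "1 \<in> loc P" "c \<in> loc P \<Longrightarrow> c' \<in> loc P \<Longrightarrow> c + c' \<in> loc P"
    "c \<in> loc P \<Longrightarrow> c' \<in> loc P \<Longrightarrow> c * c' \<in> loc P" "c \<in> loc P \<Longrightarrow> - c \<in> loc P"
proof -
  note [simp] = P1_pointsD(6)[OF P]
  show "0 \<in> loc P"
    unfolding loc_def
    by (intro CollectI exI[of _ 0] exI[of _ "0 :: 'a poly poly"] exI[of _ "1 :: 'a poly poly"])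
      (simp add: homogeneous_1 fract_collapse)
  show "1 \<in> loc P"
    unfolding loc_def
    by (intro CollectI exI[of _ 0] exI[of _ "1 :: 'a poly poly"] exI[of _ "1 :: 'a poly poly"])
      (simp add: homogeneous_1 fract_collapse)
  show "- c \<in> loc P" if "c \<in> loc P" for c
  proof -
    obtain d a b where *: "homogeneous d a" "homogeneous d b" "b \<notin> P" "b \<noteq> 0" "iota c = Fract a b"
      using locE[OF P \<open>c \<in> loc P\<close>] by blast
    have "homogeneous d (- a)" using * by (simp add: homogeneous_def)
    moreover have "iota (- c) = Fract (- a) b" using * by (simp add: iota_uminus)
    ultimately show ?thesis using * unfolding loc_def by blast
  qed
  show "c + c' \<in> loc P" "c * c' \<in> loc P" if "c \<in> loc P" "c' \<in> loc P"
  proof -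
    obtain d a b where 1: "homogeneous d a" "homogeneous d b" "b \<notin> P" "b \<noteq> 0" "iota c = Fract a b"
      using locE[OF P \<open>c \<in> loc P\<close>] by blast
    obtain e a' b' where 2: "homogeneous e a'" "homogeneous e b'" "b' \<notin> P" "b' \<noteq> 0" "iota c' = Fract a' b'"
      using locE[OF P \<open>c' \<in> loc P\<close>] by blast
    have "homogeneous (d + e) (b * b')" "homogeneous (d + e) (a * a')" "homogeneous (d + e) (a * b')"
      "homogeneous (d + e) (a' * b)"
      using 1 2 homogeneous_mult by (metis add.commute)+
    moreover have "b * b' \<notin> P" using 1 2 P1_pointsD(5)[OF P] by blast
    moreover have "iota (c + c') = Fract (a * b' + a' * b) (b * b')" "iota (c * c') = Fract (a * a') (b * b')"
      using 1 2 by (simp_all add: iota_add iota_mult)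
    ultimately show "c + c' \<in> loc P" "c * c' \<in> loc P"
      using homogeneous_add unfolding loc_def by blast+
  qed
qed

lemma loc_sum: "P \<in> P1_points \<Longrightarrow> (\<And>x. x \<in> A \<Longrightarrow> f x \<in> loc P) \<Longrightarrow> sum f A \<in> loc P"
  by (induction A rule: infinite_finite_induct) (auto intro: loc_closed)

text \<open>A denominator outside (y) has full degree after setting y = 1, so regularity at infinity
  is a condition on degrees.\<close>

lemma loc_infpt: "c \<in> loc infpt \<longleftrightarrow> deg_le c 0"
proof
  assume "c \<in> loc infpt"
  then obtain d a b where *: "homogeneous d a" "homogeneous d b" "b \<notin> infpt" "b \<noteq> 0" "iota c = Fract a b"
    using locE[OF infpt_point] by blast
  then have "c = Fract (dehom a) (dehom b)" using homogeneous_fraction iota_inject by metis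
  moreover have "degree (dehom b) = d" "dehom b \<noteq> 0"
    using * homogeneous_not_infpt homogeneous_dehom_0_iff by auto
  ultimately show "deg_le c 0" using degree_dehom[OF *(1)] by (auto simp: deg_le_Fract)
next
  assume c: "deg_le c 0"
  obtain p q where pq: "c = Fract p q" "q \<noteq> 0" by (cases c)
  \<comment> \<open>With d exactly the degree of q, the term in x^d survives in the homogenised
    denominator.\<close>
  define d where "d = degree q"
  have "degree p \<le> d" using c pq by (auto simp: deg_le_Fract d_def)
  then have "iota c = Fract (homog d p) (homog d q)" using pq by (simp add: iota_Fract d_def)
  moreover have "homog d q \<notin> infpt"
    using pq by (subst homogeneous_not_infpt[OF homogeneous_homog]) (simp add: dehom_homog d_def homog_eq_0_iff)
  ultimately show "c \<in> loc infpt" unfolding loc_def using homogeneous_homog by blast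
qed

context affine_point
begin

lemma in_loc: "c \<in> loc P \<longleftrightarrow> (\<exists>p q. q \<notin> aff P \<and> c = Fract p q)"
proof
  assume "c \<in> loc P"
  then obtain d a b where *: "homogeneous d a" "homogeneous d b" "b \<notin> P" "b \<noteq> 0" "iota c = Fract a b"
    using locE[OF point] by blast
  then have "c = Fract (dehom a) (dehom b)" using homogeneous_fraction iota_inject by metis
  moreover have "dehom b \<notin> aff P" using * homogeneous_in by blast
  ultimately show "\<exists>p q. q \<notin> aff P \<and> c = Fract p q" by blast
next
  assume "\<exists>p q. q \<notin> aff P \<and> c = Fract p q"
  then obtain p q where pq: "q \<notin> aff P" "c = Fract p q" by blast
  define d where "d = max (degree p) (degree q)"
  have "q \<noteq> 0" using pq aff_0 by auto
  then have "iota c = Fract (homog d p) (homog d q)" using pq by (simp add: iota_Fract d_def)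
  moreover have "homog d q \<notin> P" using pq homog_in by (simp add: d_def)
  ultimately show "c \<in> loc P" unfolding loc_def using homogeneous_homog by blast
qed

lemma Fract_in_loc: "q \<notin> aff P \<Longrightarrow> Fract p q \<in> loc P"
  using in_loc by blast

lemma poly_in_loc: "c \<in> poly_vals \<Longrightarrow> c \<in> loc P"
  using Fract_in_loc aff_1 by blast

text \<open>At a finite point where x does not vanish, both t and 1/t are regular. This is the
  overlap of the two standard charts.\<close>

lemma tvar_powi_in_loc:
  assumes "xvar \<notin> P"
  shows "tvar powi d \<in> loc P"
proof -
  have "monom 1 1 \<notin> aff P" using assms homog_in[of "monom 1 1" 1] by (simp add: degree_monom_eq)
  then have "inverse tvar \<in> loc P" "tvar \<in> loc P"
    using Fract_in_loc aff_1 by (auto simp: tvar_def)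
  then have "tvar ^ n \<in> loc P" "inverse tvar ^ n \<in> loc P" for n
    by (induction n) (auto intro: loc_closed[OF point])
  then show ?thesis by (simp add: power_int_def)
qed

end

lemma affine_eta: "affine_point eta"
proof (rule affine_pointI[OF eta_point])
  have "yvar \<noteq> (0 :: 'a poly poly)" by (subst homog_eq_0_iff) auto
  then show "eta \<noteq> (infpt :: 'a P1_point)" using yvar_in_infpt by (auto simp: eta_def)
qed

lemma loc_eta: "loc eta = UNIV"
proof -
  have "c \<in> loc eta" for c :: "'a poly fract"
  proof -
    obtain p q where pq: "c = Fract p q" "q \<noteq> 0" by (cases c)
    then have "q \<notin> aff eta" by (simp add: aff_def eta_def homog_eq_0_iff)
    then show ?thesis using pq affine_point.Fract_in_loc[OF affine_eta] by simp
  qed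
  then show ?thesis by blast
qed

text \<open>A divisor of least positive degree is irreducible, hence prime in k[t].\<close>

lemma prime_factor_exists:
  fixes q :: "'k::field poly"
  assumes "degree q > 0"
  shows "\<exists>p. prime_elem p \<and> p dvd q"
proof -
  define S where "S = (\<lambda>n. \<exists>p. p dvd q \<and> degree p = n \<and> degree p > 0)"
  have ex: "\<exists>n. S n" unfolding S_def using assms dvd_refl by blast
  obtain p where p: "p dvd q" "degree p = (LEAST n. S n)" "degree p > 0"
    using LeastI_ex[OF ex] unfolding S_def by blast
  have "irreducible p"
  proof (rule irreducibleI)
    show "p \<noteq> 0" using p(3) by auto
    then show "\<not> is_unit p" using p(3) by (simp add: is_unit_iff_degree)
    fix a b assume ab: "p = a * b"
    then have ne: "a \<noteq> 0" "b \<noteq> 0" using \<open>p \<noteq> 0\<close> by auto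
    have "degree a = 0 \<or> degree p \<le> degree a"
    proof (rule ccontr)
      assume *: "\<not> ?thesis"
      have "S (degree a)" unfolding S_def using * p ab by (metis dvd_mult_left gr0I)
      then have "(LEAST n. S n) \<le> degree a" by (rule Least_le)
      then show False using * p by simp
    qed
    then show "is_unit a \<or> is_unit b"
      using ne ab by (auto simp: is_unit_iff_degree degree_mult_eq)
  qed
  then have "prime_elem p" by (rule field_poly_irreducible_imp_prime)
  then show ?thesis using p by blast
qed

text \<open>Take a denominator of least degree. A prime factor r of it must cancel against the
  numerator, since the function is regular at the point of r, and this contradicts minimality. So
  the denominator is a constant.\<close>

lemma Inter_loc_affine:
  assumes "\<And>P. affine_point P \<Longrightarrow> c \<in> loc P"
  shows "c \<in> poly_vals"
proof -
  define S where "S = (\<lambda>n. \<exists>p q. q \<noteq> 0 \<and> c = Fract p q \<and> degree q = n)"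
  have "\<exists>n. S n" unfolding S_def by (cases c) blast
  from LeastI_ex[OF this] obtain p q where pq: "q \<noteq> 0" "c = Fract p q" "degree q = (LEAST n. S n)"
    unfolding S_def by blast
  have "degree q = 0"
  proof (rule ccontr)
    assume "degree q \<noteq> 0"
    then obtain r where r: "prime_elem r" "r dvd q" using prime_factor_exists by blast
    have aff: "affine_point (point_of r)"
      using r by (intro affine_pointI point_of_point point_of_not_infpt)
    have "r \<noteq> 0" "\<not> is_unit r" using r by (auto simp: prime_elem_def)
    obtain p' q' where pq': "q' \<notin> aff (point_of r)" "c = Fract p' q'"
      using affine_point.in_loc[OF aff] assms[OF aff] by blast
    have "\<not> r dvd q'"
      using pq'(1) homogeneous_in_point_of[where p = r, OF homogeneous_homog[of "degree q'" q']]
      by (auto simp: aff_def dehom_homog)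
    then have "q' \<noteq> 0" by auto
    then have "p * q' = p' * q" using pq pq' by (simp add: eq_fract)
    then have "r dvd p" using r \<open>\<not> r dvd q'\<close> by (metis dvd_mult prime_elem_dvd_mult_iff)
    then obtain p1 q1 where 1: "p = r * p1" "q = r * q1" using r by (auto simp: dvd_def)
    then have q1: "q1 \<noteq> 0" "c = Fract p1 q1" using pq \<open>r \<noteq> 0\<close> by (auto simp: eq_fract)
    have "degree q = degree r + degree q1" using 1 q1 \<open>r \<noteq> 0\<close> by (simp add: degree_mult_eq)
    moreover have "degree r > 0" using \<open>r \<noteq> 0\<close> \<open>\<not> is_unit r\<close> by (auto simp: is_unit_iff_degree)
    moreover have "(LEAST n. S n) \<le> degree q1" unfolding S_def by (rule Least_le) (use q1 in blast)
    ultimately show False using pq(3) by linarith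
  qed
  then obtain a where a: "q = [:a:]" "a \<noteq> 0" using pq(1) by (metis degree_eq_zeroE pCons_0_0)
  then have "c = Fract (Polynomial.smult (inverse a) p) 1" using pq by (simp add: eq_fract)
  then show ?thesis by blast
qed

text \<open>A power of the generator of \<open>aff Q\<close> serves as \<open>g\<close>.\<close>

lemma clear_pole:
  assumes P: "affine_point P" and Q: "affine_point Q" and f: "f \<in> aff Q" "f \<notin> aff P"
  shows "\<exists>g. g \<notin> aff P \<and> Fract g 1 * a \<in> loc Q"
proof -
  obtain q where q: "aff Q = {r. q dvd r}" "\<not> q dvd 1" using affine_point.aff_principal[OF Q] by blast
  have qP: "q \<notin> aff P" using f q affine_point.aff_mult_iff[OF P] by (auto simp: dvd_def)
  \<comment> \<open>Splits the power of q off the denominator of \<open>a\<close>; the cofactor is a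
    unit at Q.\<close>
  have "\<exists>N s'. s = q ^ N * s' \<and> \<not> q dvd s'" if "s \<noteq> 0" for s
    using that
  proof (induction "degree s" arbitrary: s rule: less_induct)
    case less
    show ?case
    proof (cases "q dvd s")
      case True
      then obtain s1 where s1: "s = q * s1" by (auto simp: dvd_def)
      have "q \<noteq> 0" "s1 \<noteq> 0" using s1 less.prems by auto
      moreover have "degree q \<noteq> 0" using q(2) \<open>q \<noteq> 0\<close> by (simp add: is_unit_iff_degree)
      ultimately obtain N s' where "s1 = q ^ N * s'" "\<not> q dvd s'"
        using less.hyps[of s1] s1 by (auto simp: degree_mult_eq)
      then show ?thesis using s1 by (intro exI[of _ "Suc N"] exI[of _ s']) (simp add: mult.assoc)
    next
      case False
      then show ?thesis by (intro exI[of _ 0] exI[of _ s]) simp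
    qed
  qed
  moreover obtain r s where rs: "a = Fract r s" "s \<noteq> 0" by (cases a)
  ultimately obtain N s' where s': "s = q ^ N * s'" "\<not> q dvd s'" by blast
  have "Fract (q ^ N) 1 * a = Fract r s'"
    using rs s' by (auto simp: eq_fract)
  then have "Fract (q ^ N) 1 * a \<in> loc Q"
    using affine_point.Fract_in_loc[OF Q] s' q by simp
  moreover have "q ^ N \<notin> aff P" using affine_point.aff_power[OF P] qP by blast
  ultimately show ?thesis by blast
qed

subsection \<open>Open sets and regular functions\<close>

lemma space_top_P1 [simp]: "space_top P1 = P1_top"
  by (simp add: P1_def)

lemma openin_P1_points: "openin P1_top U \<Longrightarrow> U \<subseteq> P1_points"
  by (auto simp: openin_P1_top)

lemma topspace_P1 [simp]: "topspace P1_top = (P1_points :: 'k::field P1_point set)"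
proof
  show "topspace P1_top \<subseteq> (P1_points :: 'k P1_point set)"
    using openin_P1_points[OF openin_topspace] .
  have "homogeneous_ideal (UNIV :: 'k poly poly set)" by (simp add: homogeneous_ideal_def ideal_kxy_iff)
  moreover have "P1_points = {P \<in> P1_points. \<not> (UNIV :: 'k poly poly set) \<subseteq> P}"
    using P1_pointsD(6) by blast
  ultimately have "openin P1_top (P1_points :: 'k P1_point set)" unfolding openin_P1_top by blast
  then show "(P1_points :: 'k P1_point set) \<subseteq> topspace P1_top" by (rule openin_subset)
qed

text \<open>An ideal not contained in some point is not contained in the zero ideal either.\<close>

lemma eta_in_open:
  assumes "openin P1_top U" "U \<noteq> {}"
  shows "eta \<in> U"
proof -
  obtain I where I: "U = {P \<in> P1_points. \<not> I \<subseteq> P}" using assms(1) by (auto simp: openin_P1_top)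
  then obtain P where "P \<in> P1_points" "\<not> I \<subseteq> P" using assms(2) by blast
  then have "\<not> I \<subseteq> eta" using P1_pointsD(1) by (auto simp: eta_def)
  then show ?thesis using I eta_point by blast
qed

lemma open_Int_nonempty:
  "openin P1_top U \<Longrightarrow> openin P1_top V \<Longrightarrow> U \<noteq> {} \<Longrightarrow> V \<noteq> {} \<Longrightarrow> U \<inter> V \<noteq> {}"
  using eta_in_open by blast

text \<open>The element b need not be a form. The intersection of all points containing it is a
  homogeneous ideal with the same zero set, and so witnesses openness.\<close>

lemma basic_open: "openin P1_top {P \<in> P1_points. b \<notin> P}"
proof -
  define I where "I = \<Inter>{P \<in> P1_points. b \<in> P}"
  have "homogeneous_ideal I"
    unfolding I_def by (rule homogeneous_ideal_Inter) (auto simp: P1_points_def)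
  moreover have "{P \<in> P1_points. b \<notin> P} = {P \<in> P1_points. \<not> I \<subseteq> P}"
    by (auto simp: I_def)
  ultimately show ?thesis unfolding openin_P1_top by blast
qed

lemma open_separating:
  assumes "openin P1_top U" "P \<in> U"
  shows "\<exists>f d. homogeneous d f \<and> f \<notin> P \<and> (\<forall>Q\<in>P1_points - U. f \<in> Q)"
proof -
  obtain I where I: "homogeneous_ideal I" "U = {P \<in> P1_points. \<not> I \<subseteq> P}"
    using assms(1) by (auto simp: openin_P1_top)
  have P: "P \<in> P1_points" "\<not> I \<subseteq> P" using assms(2) I by auto
  then obtain f d where "f \<in> I" "homogeneous d f" "f \<notin> P"
    using point_subset_homogeneous[OF P(1), of I] I(1) by (auto simp: homogeneous_ideal_def)
  then show ?thesis using I(2) by blast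
qed

definition const :: "'k::field P1_point set \<Rightarrow> 'k poly fract \<Rightarrow> 'k P1_fun" where
  "const U c = (\<lambda>P\<in>U. iota c)"

definition val :: "'k::field P1_fun \<Rightarrow> 'k poly fract" where
  "val s = (THE c. iota c = s eta)"

definition reg :: "'k::field P1_point set \<Rightarrow> 'k poly fract set" where
  "reg U = {c. \<forall>P\<in>U. c \<in> loc P}"

text \<open>Over the empty set all constants are one and the same section. This is why the empty
  open set is treated apart in the arguments below.\<close>

lemma const_eq_iff: "const U c = const U c' \<longleftrightarrow> U = {} \<or> c = c'"
  by (auto simp: const_def iota_inject restrict_def fun_eq_iff)

lemma const_empty': "const {} c = (\<lambda>_. undefined)"
  by (simp add: const_def restrict_def)

lemma const_empty: "const {} c = const {} c'"
  by (simp add: const_eq_iff)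

lemma val_const: "eta \<in> U \<Longrightarrow> val (const U c) = c"
  by (simp add: val_def const_def iota_inject)

lemma restrict_const: "V \<subseteq> U \<Longrightarrow> restrict (const U c) V = const V c"
  by (auto simp: const_def restrict_def fun_eq_iff)

lemma const_add: "V \<subseteq> U \<Longrightarrow> (\<lambda>P\<in>V. const U c P + const U c' P) = const V (c + c')"
  by (auto simp: const_def iota_add restrict_def fun_eq_iff)

lemma const_mult: "V \<subseteq> U \<Longrightarrow> (\<lambda>P\<in>V. const U c P * const U c' P) = const V (c * c')"
  by (auto simp: const_def iota_mult restrict_def fun_eq_iff)

lemma const_0: "(\<lambda>P\<in>U. 0) = const U 0" and const_1: "(\<lambda>P\<in>U. 1) = const U 1"
  by (simp_all add: const_def)

lemma loc_open:
  assumes "P \<in> P1_points" "c \<in> loc P"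
  shows "\<exists>V. openin P1_top V \<and> P \<in> V \<and> c \<in> reg V"
proof -
  obtain d a b where *: "homogeneous d a" "homogeneous d b" "b \<notin> P" "iota c = Fract a b"
    using assms(2) by (auto simp: loc_def)
  then have "c \<in> reg {P \<in> P1_points. b \<notin> P}" by (auto simp: reg_def loc_def)
  then show ?thesis using * assms(1) basic_open[of b] by blast
qed

text \<open>Since any two nonempty open sets meet, a section is globally a single fraction.\<close>

lemma P1_sections_eq:
  assumes U: "openin P1_top U"
  shows "P1_sections U = const U ` reg U"
proof (cases "U = {}")
  case True
  then show ?thesis by (auto simp: P1_sections_def const_empty' reg_def)
next
  case False
  show ?thesis
  proof (intro equalityI subsetI)
    fix s assume s: "s \<in> P1_sections U"
    \<comment> \<open>The fraction representing \<open>s\<close> near P is also valid at the generic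
      point, so the value at P equals the value there.\<close>
    have *: "\<exists>d a b. homogeneous d a \<and> homogeneous d b \<and> b \<notin> P \<and> s P = Fract a b \<and> s eta = Fract a b"
      if PU: "P \<in> U" for P
    proof -
      obtain V d a b where V: "openin P1_top V" "P \<in> V" "homogeneous d a" "homogeneous d b"
          "\<forall>Q\<in>V. b \<notin> Q \<and> s Q = Fract a b"
        using s PU unfolding P1_sections_def by blast
      then have "eta \<in> V" using eta_in_open by blast
      then show ?thesis using V by blast
    qed
    obtain d a b where ab: "homogeneous d a" "homogeneous d b" "b \<notin> eta" "s eta = Fract a b"
      using *[OF eta_in_open[OF U False]] by blast
    define c where "c = Fract (dehom a) (dehom b)"
    have c: "iota c = s eta" using ab unfolding c_def by (simp add: eta_def homogeneous_fraction)
    have "s = const U c"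
    proof
      fix P show "s P = const U c P"
        using *[of P] c s by (cases "P \<in> U") (auto simp: const_def P1_sections_def extensional_def)
    qed
    moreover have "c \<in> reg U" unfolding reg_def loc_def mem_Collect_eq c using * by blast
    ultimately show "s \<in> const U ` reg U" by blast
  next
    fix s assume "s \<in> const U ` reg U"
    then obtain c where c: "s = const U c" "c \<in> reg U" by blast
    have "\<exists>V d a b. openin P1_top V \<and> P \<in> V \<and> V \<subseteq> U \<and> homogeneous d a \<and> homogeneous d b \<and>
        (\<forall>Q\<in>V. b \<notin> Q \<and> s Q = Fract a b)" if PU: "P \<in> U" for P
    proof -
      obtain d a b where *: "homogeneous d a" "homogeneous d b" "b \<notin> P" "iota c = Fract a b"
        using c(2) PU by (auto simp: reg_def loc_def)
      define V where "V = U \<inter> {P \<in> P1_points. b \<notin> P}"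
      have "openin P1_top V" unfolding V_def using U basic_open by (rule openin_Int)
      moreover have "P \<in> V" using that * openin_P1_points[OF U] by (auto simp: V_def)
      moreover have "V \<subseteq> U" "\<forall>Q\<in>V. b \<notin> Q \<and> s Q = Fract a b"
        using * c by (auto simp: V_def const_def)
      ultimately show ?thesis using * by blast
    qed
    then show "s \<in> P1_sections U" using c by (simp add: P1_sections_def const_def)
  qed
qed

lemma ring_sec_P1:
  "openin P1_top U \<Longrightarrow> carrier (ring_sec P1 U) = const U ` reg U"
  "mult (ring_sec P1 U) s t = (\<lambda>P\<in>U. s P * t P)" "one (ring_sec P1 U) = const U 1"
  "zero (ring_sec P1 U) = const U 0" "add (ring_sec P1 U) s t = (\<lambda>P\<in>U. s P + t P)"
  "ring_res P1 U V s = restrict s V"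
  by (simp_all add: P1_def P1_sections_eq const_0 const_1)

lemma reg_closed:
  assumes "openin P1_top U"
  shows "0 \<in> reg U" "1 \<in> reg U" "c \<in> reg U \<Longrightarrow> c' \<in> reg U \<Longrightarrow> c + c' \<in> reg U"
    "c \<in> reg U \<Longrightarrow> c' \<in> reg U \<Longrightarrow> c * c' \<in> reg U" "c \<in> reg U \<Longrightarrow> - c \<in> reg U"
  using openin_P1_points[OF assms] unfolding reg_def by (auto intro: loc_closed)

lemma reg_mono: "V \<subseteq> U \<Longrightarrow> reg U \<subseteq> reg V"
  by (auto simp: reg_def)

lemma cring_ring_sec:
  assumes U: "openin P1_top U"
  shows "cring (ring_sec P1 U)"
proof (rule cringI)
  show "abelian_group (ring_sec P1 U)"
  proof (rule abelian_groupI)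
    fix s assume "s \<in> carrier (ring_sec P1 U)"
    then obtain c where c: "s = const U c" "c \<in> reg U" using U by (auto simp: ring_sec_P1)
    then have "const U (- c) \<oplus>\<^bsub>ring_sec P1 U\<^esub> s = \<zero>\<^bsub>ring_sec P1 U\<^esub>"
      by (simp add: ring_sec_P1 const_add)
    then show "\<exists>t\<in>carrier (ring_sec P1 U). t \<oplus>\<^bsub>ring_sec P1 U\<^esub> s = \<zero>\<^bsub>ring_sec P1 U\<^esub>"
      using U c reg_closed[OF U] by (auto simp: ring_sec_P1)
  qed (use U in \<open>auto simp: ring_sec_P1 const_add add_ac simp del: restrict_apply intro!: imageI reg_closed\<close>)
  show "comm_monoid (ring_sec P1 U)"
    by (rule comm_monoidI) (use U in \<open>auto simp: ring_sec_P1 const_mult mult_ac simp del: restrict_apply intro!: imageI reg_closed\<close>)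
qed (use U in \<open>auto simp: ring_sec_P1 const_mult const_add algebra_simps simp del: restrict_apply\<close>)

subsection \<open>The line bundles of given degree\<close>

text \<open>The stalks of $\mathcal{O}(d)$, all inside $k(t)$.\<close>

definition twist :: "int \<Rightarrow> 'k::field P1_point \<Rightarrow> 'k poly fract set" where
  "twist d P = (if P = infpt then {c. deg_le c d} else loc P)"

definition twist_reg :: "int \<Rightarrow> 'k::field P1_point set \<Rightarrow> 'k poly fract set" where
  "twist_reg d U = {c. \<forall>P\<in>U. c \<in> twist d P}"

text \<open>The sheaf O(d) as that of the divisor d times infinity, with sections realised as
  constant functions exactly as for regular functions.\<close>

definition line_sheaf :: "int \<Rightarrow> ('k::field P1_point, 'k P1_fun, 'k P1_fun) mod_sheaf" where
  "line_sheaf d =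
    \<lparr>sec = (\<lambda>U. \<lparr>carrier = const U ` twist_reg d U, mult = undefined, one = undefined,
                zero = const U 0, add = (\<lambda>s t. \<lambda>P\<in>U. s P + t P),
                smult = (\<lambda>s t. \<lambda>P\<in>U. s P * t P)\<rparr>),
     res = (\<lambda>U V s. restrict s V)\<rparr>"

lemma line_sheaf_simps:
  "carrier (sec (line_sheaf d) U) = const U ` twist_reg d U"
  "zero (sec (line_sheaf d) U) = const U 0"
  "add (sec (line_sheaf d) U) s t = (\<lambda>P\<in>U. s P + t P)"
  "module.smult (sec (line_sheaf d) U) s t = (\<lambda>P\<in>U. s P * t P)"
  "res (line_sheaf d) U V s = restrict s V"
  by (simp_all add: line_sheaf_def)

lemma twist_closed:
  assumes "P \<in> P1_points"
  shows "0 \<in> twist d P" "c \<in> twist d P \<Longrightarrow> c' \<in> twist d P \<Longrightarrow> c + c' \<in> twist d P"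
    "r \<in> loc P \<Longrightarrow> c \<in> twist d P \<Longrightarrow> r * c \<in> twist d P" "c \<in> twist d P \<Longrightarrow> - c \<in> twist d P"
  using loc_closed[OF assms] deg_le_mult[of r 0 c d]
  by (cases "P = infpt"; simp add: twist_def loc_infpt deg_le_add deg_le_uminus)+

lemma twist_reg_closed:
  assumes "openin P1_top U"
  shows "0 \<in> twist_reg d U" "c \<in> twist_reg d U \<Longrightarrow> c' \<in> twist_reg d U \<Longrightarrow> c + c' \<in> twist_reg d U"
    "r \<in> reg U \<Longrightarrow> c \<in> twist_reg d U \<Longrightarrow> r * c \<in> twist_reg d U"
    "c \<in> twist_reg d U \<Longrightarrow> - c \<in> twist_reg d U"
  using openin_P1_points[OF assms] twist_closed unfolding reg_def twist_reg_def by blast+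

lemma module_line_sheaf:
  assumes U: "openin P1_top U"
  shows "Module.module (ring_sec P1 U) (sec (line_sheaf d) U)"
proof (rule moduleI)
  show "cring (ring_sec P1 U)" using U by (rule cring_ring_sec)
  let ?M = "sec (line_sheaf d) U"
  show "abelian_group ?M"
  proof (rule abelian_groupI)
    fix s assume "s \<in> carrier ?M"
    then obtain c where c: "s = const U c" "c \<in> twist_reg d U" by (auto simp: line_sheaf_simps)
    then have "const U (- c) \<oplus>\<^bsub>?M\<^esub> s = \<zero>\<^bsub>?M\<^esub>"
      by (simp add: line_sheaf_simps const_add)
    then show "\<exists>t\<in>carrier ?M. t \<oplus>\<^bsub>?M\<^esub> s = \<zero>\<^bsub>?M\<^esub>"
      using U c twist_reg_closed[OF U] by (auto simp: line_sheaf_simps)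
  qed (use U in \<open>auto simp: line_sheaf_simps const_add add_ac simp del: restrict_apply intro!: imageI twist_reg_closed\<close>)
qed (use U in \<open>auto simp: ring_sec_P1 line_sheaf_simps const_mult const_add algebra_simps simp del: restrict_apply intro!: imageI twist_reg_closed\<close>)

text \<open>Nonempty members of the family meet, so all local sections come from one element of K,
  and membership in O(d) is a pointwise condition.\<close>

lemma line_sheaf_gluing:
  assumes op: "\<And>V. V \<in> \<U> \<Longrightarrow> openin P1_top V"
    and f: "\<And>V. V \<in> \<U> \<Longrightarrow> f V \<in> const V ` twist_reg d V"
    and compat: "\<And>V W. V \<in> \<U> \<Longrightarrow> W \<in> \<U> \<Longrightarrow> restrict (f V) (V \<inter> W) = restrict (f W) (V \<inter> W)"
  shows "\<exists>s \<in> const (\<Union>\<U>) ` twist_reg d (\<Union>\<U>). \<forall>V \<in> \<U>. restrict s V = f V"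
proof -
  have "\<forall>V\<in>\<U>. \<exists>c. f V = const V c \<and> c \<in> twist_reg d V" using f by blast
  from bchoice[OF this] obtain g where g: "\<And>V. V \<in> \<U> \<Longrightarrow> f V = const V (g V) \<and> g V \<in> twist_reg d V"
    by blast
  show ?thesis
  proof (cases "\<exists>V\<in>\<U>. V \<noteq> {}")
    case True
    then obtain V0 where V0: "V0 \<in> \<U>" "V0 \<noteq> {}" by blast
    have eq: "g V = g V0" if "V \<in> \<U>" "V \<noteq> {}" for V
    proof -
      have "const (V \<inter> V0) (g V) = const (V \<inter> V0) (g V0)"
        using compat[OF that(1) V0(1)] g that V0 by (simp add: restrict_const)
      moreover have "V \<inter> V0 \<noteq> {}" using open_Int_nonempty op that V0 by blast
      ultimately show ?thesis by (simp add: const_eq_iff)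
    qed
    have "restrict (const (\<Union>\<U>) (g V0)) V = f V" if "V \<in> \<U>" for V
    proof -
      have "restrict (const (\<Union>\<U>) (g V0)) V = const V (g V0)"
        using that by (intro restrict_const) blast
      also have "\<dots> = const V (g V)" using eq[OF that] by (cases "V = {}") (simp_all add: const_empty')
      finally show ?thesis using g[OF that] by simp
    qed
    moreover have "g V0 \<in> twist_reg d (\<Union>\<U>)"
      unfolding twist_reg_def
    proof (intro CollectI ballI)
      fix P assume "P \<in> \<Union>\<U>"
      then obtain V where V: "V \<in> \<U>" "P \<in> V" by blast
      then have "g V = g V0" using eq by blast
      then show "g V0 \<in> twist d P" using g[OF V(1)] V(2) by (simp add: twist_reg_def)
    qed
    ultimately show ?thesis by blast
  next
    case False
    then have "\<Union>\<U> = {}" "\<And>V. V \<in> \<U> \<Longrightarrow> V = {}" by auto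
    then have "\<forall>V\<in>\<U>. restrict (const (\<Union>\<U>) 0) V = f V"
      using g by (metis const_empty restrict_const subset_refl)
    moreover have "0 \<in> twist_reg d (\<Union>\<U>)" unfolding \<open>\<Union>\<U> = {}\<close> by (simp add: twist_reg_def)
    ultimately show ?thesis by blast
  qed
qed

lemma line_sheaf_locality:
  assumes s: "s \<in> const (\<Union>\<U>) ` C" and t: "t \<in> const (\<Union>\<U>) ` C'"
    and eq: "\<And>V. V \<in> \<U> \<Longrightarrow> restrict s V = restrict t V"
  shows "s = t"
proof -
  obtain c c' where c: "s = const (\<Union>\<U>) c" "t = const (\<Union>\<U>) c'" using s t by blast
  show ?thesis
  proof (cases "\<Union>\<U> = {}")
    case False
    then obtain V where V: "V \<in> \<U>" "V \<noteq> {}" by blast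
    then have "V \<subseteq> \<Union>\<U>" by blast
    then have "const V c = const V c'" using eq[OF V(1)] c by (simp add: restrict_const)
    then show ?thesis using V c by (simp add: const_eq_iff)
  qed (simp add: c const_eq_iff)
qed

lemma twist_reg_mono: "V \<subseteq> U \<Longrightarrow> c \<in> twist_reg d U \<Longrightarrow> c \<in> twist_reg d V"
  by (auto simp: twist_reg_def)

lemma sheaf_line_sheaf: "sheaf_of_modules P1 (line_sheaf d)"
proof (rule sheaf_of_modules.intro)
  fix \<U> :: "'a P1_point set set" and f
  assume "\<And>V. V \<in> \<U> \<Longrightarrow> openin (space_top P1) V" "\<And>V. V \<in> \<U> \<Longrightarrow> f V \<in> carrier (sec (line_sheaf d) V)"
    "\<And>V W. V \<in> \<U> \<Longrightarrow> W \<in> \<U> \<Longrightarrow> res (line_sheaf d) V (V \<inter> W) (f V) = res (line_sheaf d) W (V \<inter> W) (f W)"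
  then show "\<exists>s\<in>carrier (sec (line_sheaf d) (\<Union>\<U>)). \<forall>V\<in>\<U>. res (line_sheaf d) (\<Union>\<U>) V s = f V"
    unfolding line_sheaf_simps space_top_P1 by (rule line_sheaf_gluing)
next
  fix \<U> :: "'a P1_point set set" and s t
  assume "s \<in> carrier (sec (line_sheaf d) (\<Union>\<U>))" "t \<in> carrier (sec (line_sheaf d) (\<Union>\<U>))"
    "\<And>V. V \<in> \<U> \<Longrightarrow> res (line_sheaf d) (\<Union>\<U>) V s = res (line_sheaf d) (\<Union>\<U>) V t"
  then show "s = t" unfolding line_sheaf_simps by (rule line_sheaf_locality)
qed (auto simp: module_line_sheaf line_sheaf_simps ring_sec_P1 restrict_const const_add const_mult
    Int_absorb1 simp del: restrict_apply intro!: imageI elim: twist_reg_mono[rotated])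

subsection \<open>Free sheaves and trivialisations\<close>

lemma free_sheaf_simps:
  "carrier (sec (free_sheaf P1 n) U) = (\<Pi>\<^sub>E i\<in>{..<n}. carrier (ring_sec P1 U))"
  "add (sec (free_sheaf P1 n) U) s t = (\<lambda>i\<in>{..<n}. \<lambda>P\<in>U. s i P + t i P)"
  "module.smult (sec (free_sheaf P1 n) U) r t = (\<lambda>i\<in>{..<n}. \<lambda>P\<in>U. r P * t i P)"
  "res (free_sheaf P1 n) U V s = (\<lambda>i\<in>{..<n}. restrict (s i) V)"
  by (simp_all add: free_sheaf_def direct_sum_def structure_sheaf_def ring_sec_P1)

text \<open>Multiplication by u, the inverse of a local generator, is the trivialisation. It is used
  with u = 1 where y \<noteq> 0 and with u = t^(-d) where x \<noteq> 0.\<close>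

lemma line_sheaf_trivial:
  fixes W :: "'a::field P1_point set"
  assumes u: "u \<noteq> 0"
    and eq: "\<And>P c. P \<in> W \<Longrightarrow> c \<in> twist d P \<longleftrightarrow> u * c \<in> loc P"
  shows "sheaf_iso_on P1 W (line_sheaf d) (free_sheaf P1 1)"
proof -
  define \<phi> where "\<phi> = (\<lambda>(U :: 'a P1_point set) s. \<lambda>i\<in>{..<1::nat}. \<lambda>P\<in>U. iota u * s P)"
  have \<phi>: "\<phi> U (const U c) = (\<lambda>i\<in>{..<1}. const U (u * c))" for U c
    by (auto simp: \<phi>_def const_def iota_mult intro!: restrict_ext)
  have reg: "c \<in> twist_reg d U \<longleftrightarrow> u * c \<in> reg U" if "U \<subseteq> W" for c U
    using that eq by (auto simp: twist_reg_def reg_def)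
  have "\<phi> U \<in> module_iso (ring_sec P1 U) (sec (line_sheaf d) U) (sec (free_sheaf P1 1) U)"
    if U: "openin P1_top U" "U \<subseteq> W" for U
  proof -
    have "bij_betw (\<phi> U) (const U ` twist_reg d U) (\<Pi>\<^sub>E i\<in>{..<1}. const U ` reg U)"
      unfolding bij_betw_def
    proof
      show "inj_on (\<phi> U) (const U ` twist_reg d U)"
      proof (rule inj_onI, elim imageE)
        fix s t c c' assume st: "s = const U c" "t = const U c'" and "\<phi> U s = \<phi> U t"
        then have "const U (u * c) = const U (u * c')" by (auto simp: \<phi> dest: fun_cong[of _ _ 0])
        then show "s = t" using u st by (auto simp: const_eq_iff)
      qed
      show "\<phi> U ` (const U ` twist_reg d U) = (\<Pi>\<^sub>E i\<in>{..<1}. const U ` reg U)"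
      proof (intro equalityI subsetI)
        fix s assume "s \<in> \<phi> U ` const U ` twist_reg d U"
        then show "s \<in> (\<Pi>\<^sub>E i\<in>{..<1}. const U ` reg U)"
          using reg[OF U(2)] by (auto simp: \<phi>)
      next
        fix s assume s: "s \<in> (\<Pi>\<^sub>E i\<in>{..<1::nat}. const U ` reg U)"
        then obtain c where c: "s 0 = const U c" "c \<in> reg U" by (auto dest: PiE_mem[of _ _ _ 0])
        have "s = (\<lambda>i\<in>{..<1}. const U c)"
          using s c by (intro PiE_ext[OF s]) auto
        also have "\<dots> = \<phi> U (const U (c / u))" using u by (simp add: \<phi>)
        finally have "s = \<phi> U (const U (c / u))" .
        moreover have "c / u \<in> twist_reg d U" using reg[OF U(2), of "c / u"] c u by simp
        ultimately show "s \<in> \<phi> U ` const U ` twist_reg d U" by blast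
      qed
    qed
    then show ?thesis
      unfolding module_iso_def mem_Collect_eq line_sheaf_simps free_sheaf_simps ring_sec_P1(1)[OF U(1)]
      by (auto simp: \<phi> const_add const_mult algebra_simps intro!: restrict_ext)
  qed
  moreover have "\<phi> V (res (line_sheaf d) U V s) = res (free_sheaf P1 1) U V (\<phi> U s)"
    if "V \<subseteq> U" "s \<in> carrier (sec (line_sheaf d) U)" for U V s
    using that by (auto simp: line_sheaf_simps free_sheaf_simps \<phi> restrict_const intro!: restrict_ext)
  ultimately show ?thesis
    unfolding sheaf_iso_on_def space_top_P1 by blast
qed

lemma deg_le_tvar_mult_iff: "deg_le (tvar powi (- d) * c) 0 \<longleftrightarrow> deg_le c d"
proof
  assume "deg_le (tvar powi (- d) * c) 0"
  from deg_le_mult[OF deg_le_tvar[of d] this] show "deg_le c d"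
    by (simp add: mult.assoc[symmetric] flip: power_int_add)
next
  assume "deg_le c d"
  from deg_le_mult[OF deg_le_tvar[of "- d"] this] show "deg_le (tvar powi (- d) * c) 0" by simp
qed

lemma line_bundle_line_sheaf: "line_bundle P1 (line_sheaf d)"
  unfolding line_bundle_def
proof (intro conjI ballI)
  fix P :: "'a P1_point" assume "P \<in> topspace (space_top P1)"
  then have P: "P \<in> P1_points" by simp
  show "\<exists>U. openin (space_top P1) U \<and> P \<in> U \<and> sheaf_iso_on P1 U (line_sheaf d) (free_sheaf P1 1)"
  proof (cases "P = infpt")
    case False
    define W where "W = {P \<in> P1_points. yvar \<notin> (P :: 'a P1_point)}"
    have "sheaf_iso_on P1 W (line_sheaf d) (free_sheaf P1 1)"
      by (rule line_sheaf_trivial[of 1]) (use yvar_in_infpt in \<open>auto simp: W_def twist_def\<close>)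
    moreover have "P \<in> W" using P False yvar_in_point by (auto simp: W_def)
    ultimately show ?thesis using basic_open[of "yvar :: 'a poly poly"] by (auto simp: W_def)
  next
    case True
    define W where "W = {P \<in> P1_points. xvar \<notin> (P :: 'a P1_point)}"
    have "sheaf_iso_on P1 W (line_sheaf d) (free_sheaf P1 1)"
    proof (rule line_sheaf_trivial)
      show "tvar powi (- d) \<noteq> (0 :: 'a poly fract)" by (simp add: power_int_eq_0_iff)
      fix Q :: "'a P1_point" and c assume Q: "Q \<in> W"
      show "c \<in> twist d Q \<longleftrightarrow> tvar powi (- d) * c \<in> loc Q"
      proof (cases "Q = infpt")
        case False
        then interpret affine_point Q using Q by (auto simp: W_def affine_pointI)
        have x: "xvar \<notin> Q" using Q by (simp add: W_def)
        \<comment> \<open>Powers of t are units of the local ring at Q, so multiplying by one does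
          not change membership.\<close>
        have "tvar powi d * (tvar powi (- d) * c) = c"
          by (simp add: mult.assoc[symmetric] flip: power_int_add)
        then show ?thesis
          using False loc_closed(4)[OF point] tvar_powi_in_loc[OF x] by (metis twist_def)
      qed (simp add: twist_def loc_infpt deg_le_tvar_mult_iff)
    qed
    moreover have "P \<in> W" using P True xvar_not_infpt by (auto simp: W_def)
    ultimately show ?thesis using basic_open[of "xvar :: 'a poly poly"] by (auto simp: W_def)
  qed
qed (rule sheaf_line_sheaf)

section \<open>Coordinates of sections in a chart\<close>

locale trivialisation =
  fixes F :: "('k::field P1_point, 'k P1_fun, 'm) mod_sheaf"
    and W :: "'k P1_point set" and m :: nat and psi :: "'k P1_point set \<Rightarrow> 'm \<Rightarrow> nat \<Rightarrow> 'k P1_fun"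
  assumes sheaf: "sheaf_of_modules P1 F"
    and W_open: "openin P1_top W"
    and iso: "openin P1_top U \<Longrightarrow> U \<subseteq> W \<Longrightarrow>
      psi U \<in> module_iso (ring_sec P1 U) (sec F U) (sec (free_sheaf P1 m) U)"
    and natural: "openin P1_top U \<Longrightarrow> openin P1_top V \<Longrightarrow> V \<subseteq> U \<Longrightarrow> U \<subseteq> W \<Longrightarrow> s \<in> carrier (sec F U) \<Longrightarrow>
      psi V (res F U V s) = res (free_sheaf P1 m) U V (psi U s)"
begin

sublocale F: sheaf_of_modules P1 F
  by (rule sheaf)

lemmas F_res_closed = F.res_closed[unfolded space_top_P1]
lemmas F_res_add = F.res_add[unfolded space_top_P1]
lemmas F_res_smult = F.res_smult[unfolded space_top_P1 ring_sec_P1]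
lemmas F_res_comp = F.res_comp[unfolded space_top_P1]
lemmas F_res_id = F.res_id[unfolded space_top_P1]

lemma F_closed:
  assumes "openin P1_top U"
  shows "s \<in> carrier (sec F U) \<Longrightarrow> t \<in> carrier (sec F U) \<Longrightarrow> s \<oplus>\<^bsub>sec F U\<^esub> t \<in> carrier (sec F U)"
    "c \<in> reg U \<Longrightarrow> s \<in> carrier (sec F U) \<Longrightarrow> const U c \<odot>\<^bsub>sec F U\<^esub> s \<in> carrier (sec F U)"
    "\<zero>\<^bsub>sec F U\<^esub> \<in> carrier (sec F U)"
proof -
  interpret module "ring_sec P1 U" "sec F U" using assms by (intro F.sec_module) simp
  show "s \<in> carrier (sec F U) \<Longrightarrow> t \<in> carrier (sec F U) \<Longrightarrow> s \<oplus>\<^bsub>sec F U\<^esub> t \<in> carrier (sec F U)"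
    by (rule M.a_closed)
  show "c \<in> reg U \<Longrightarrow> s \<in> carrier (sec F U) \<Longrightarrow> const U c \<odot>\<^bsub>sec F U\<^esub> s \<in> carrier (sec F U)"
    using assms by (intro smult_closed) (auto simp: ring_sec_P1)
  show "\<zero>\<^bsub>sec F U\<^esub> \<in> carrier (sec F U)" by (rule M.zero_closed)
qed

text \<open>Padding by 0 from m on puts the coordinate vectors of all charts, whatever their ranks,
  into one type.\<close>

definition coords :: "'k P1_point set \<Rightarrow> 'm \<Rightarrow> nat \<Rightarrow> 'k poly fract" where
  "coords V s = (\<lambda>i. if i < m then val (psi V s i) else 0)"

lemma coords_ge: "m \<le> i \<Longrightarrow> coords V s i = 0"
  by (simp add: coords_def)

context
  fixes V
  assumes V: "openin P1_top V" "V \<noteq> {}" "V \<subseteq> W"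
begin

lemma psi_coords:
  assumes s: "s \<in> carrier (sec F V)"
  shows "psi V s = (\<lambda>i\<in>{..<m}. const V (coords V s i))" "i < m \<Longrightarrow> coords V s i \<in> reg V"
proof -
  have eta: "eta \<in> V" using V eta_in_open by blast
  have psi: "psi V s \<in> (\<Pi>\<^sub>E i\<in>{..<m}. const V ` reg V)"
    using iso[OF V(1,3)] s V(1)
    by (auto simp: module_iso_def free_sheaf_simps ring_sec_P1 dest: bij_betwE)
  have *: "psi V s i = const V (coords V s i) \<and> coords V s i \<in> reg V" if "i < m" for i
  proof -
    have "psi V s i \<in> const V ` reg V" using psi that by auto
    then show ?thesis using that by (auto simp: coords_def val_const[OF eta])
  qed
  show "psi V s = (\<lambda>i\<in>{..<m}. const V (coords V s i))"
    by (rule ext) (use * psi in \<open>auto simp: PiE_def extensional_def\<close>)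
  show "coords V s i \<in> reg V" if "i < m" using * that by blast
qed

lemma coords_eqI:
  assumes "psi V s = (\<lambda>i\<in>{..<m}. const V (a i))" "\<And>i. m \<le> i \<Longrightarrow> a i = 0"
  shows "coords V s = a"
proof
  have eta: "eta \<in> V" using V eta_in_open by blast
  fix i show "coords V s i = a i"
    using assms by (cases "i < m") (auto simp: coords_def val_const[OF eta])
qed

lemma coords_inj:
  assumes "s \<in> carrier (sec F V)" "t \<in> carrier (sec F V)" "coords V s = coords V t"
  shows "s = t"
proof -
  have "psi V s = psi V t" using psi_coords(1) assms by metis
  moreover have "inj_on (psi V) (carrier (sec F V))"
    using iso[OF V(1,3)] by (auto simp: module_iso_def bij_betw_def)
  ultimately show ?thesis using assms by (auto dest: inj_onD)
qed

lemma coords_surj: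
  assumes "\<And>i. i < m \<Longrightarrow> a i \<in> reg V" "\<And>i. m \<le> i \<Longrightarrow> a i = 0"
  shows "\<exists>s\<in>carrier (sec F V). coords V s = a"
proof -
  have "(\<lambda>i\<in>{..<m}. const V (a i)) \<in> carrier (sec (free_sheaf P1 m) V)"
    using assms V(1) by (auto simp: free_sheaf_simps ring_sec_P1)
  then obtain s where "s \<in> carrier (sec F V)" "psi V s = (\<lambda>i\<in>{..<m}. const V (a i))"
    using iso[OF V(1,3)] unfolding module_iso_def bij_betw_def by (smt (verit) imageE mem_Collect_eq)
  then show ?thesis using coords_eqI assms(2) by blast
qed

lemma coords_add:
  assumes "s \<in> carrier (sec F V)" "t \<in> carrier (sec F V)"
  shows "coords V (s \<oplus>\<^bsub>sec F V\<^esub> t) = coords V s + coords V t"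
proof (rule coords_eqI)
  have "psi V (s \<oplus>\<^bsub>sec F V\<^esub> t) = psi V s \<oplus>\<^bsub>sec (free_sheaf P1 m) V\<^esub> psi V t"
    using iso[OF V(1,3)] assms by (simp add: module_iso_def)
  also have "\<dots> = (\<lambda>i\<in>{..<m}. const V (coords V s i + coords V t i))"
    using psi_coords(1)[OF assms(1)] psi_coords(1)[OF assms(2)]
    by (auto simp: free_sheaf_simps const_add intro!: restrict_ext)
  finally show "psi V (s \<oplus>\<^bsub>sec F V\<^esub> t) = (\<lambda>i\<in>{..<m}. const V ((coords V s + coords V t) i))" by simp
qed (simp add: coords_def)

lemma coords_smult:
  assumes "c \<in> reg V" "s \<in> carrier (sec F V)"
  shows "coords V (const V c \<odot>\<^bsub>sec F V\<^esub> s) = scal c (coords V s)"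
proof (rule coords_eqI)
  have "psi V (const V c \<odot>\<^bsub>sec F V\<^esub> s) = const V c \<odot>\<^bsub>sec (free_sheaf P1 m) V\<^esub> psi V s"
    using iso[OF V(1,3)] assms V(1) by (simp add: module_iso_def ring_sec_P1)
  also have "\<dots> = (\<lambda>i\<in>{..<m}. const V (c * coords V s i))"
    using psi_coords(1)[OF assms(2)]
    by (auto simp: free_sheaf_simps const_mult intro!: restrict_ext)
  finally show "psi V (const V c \<odot>\<^bsub>sec F V\<^esub> s) = (\<lambda>i\<in>{..<m}. const V (scal c (coords V s) i))"
    by (simp add: scal_def)
qed (simp add: coords_def scal_def)

text \<open>Coordinates are values at the generic point, which lies in both open sets.\<close>

lemma coords_res:
  assumes "openin P1_top V'" "V \<subseteq> V'" "V' \<subseteq> W" and s: "s \<in> carrier (sec F V')"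
  shows "coords V (res F V' V s) = coords V' s"
proof -
  have "coords V (res F V' V s) i = coords V' s i" if "i < m" for i
  proof -
    have "psi V (res F V' V s) i = restrict (psi V' s i) V"
      using natural[OF assms(1) V(1) assms(2,3) s] that by (simp add: free_sheaf_simps)
    moreover have "eta \<in> V" using V eta_in_open by blast
    ultimately show ?thesis using that by (simp add: coords_def val_def)
  qed
  then show ?thesis by (auto simp: coords_def)
qed

end

end

lemma trivialisation_exists:
  assumes "vector_bundle P1 F" "P \<in> P1_points"
  shows "\<exists>W m psi. trivialisation F W m psi \<and> P \<in> W"
proof -
  obtain W m where W: "openin P1_top W" "P \<in> W" "sheaf_iso_on P1 W F (free_sheaf P1 m)"
    using assms unfolding vector_bundle_def by auto
  obtain psi where psi:
    "\<forall>U. openin P1_top U \<and> U \<subseteq> W \<longrightarrow> psi U \<in> module_iso (ring_sec P1 U) (sec F U) (sec (free_sheaf P1 m) U)"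
    "\<forall>U V. openin P1_top U \<and> openin P1_top V \<and> V \<subseteq> U \<and> U \<subseteq> W \<longrightarrow>
       (\<forall>s\<in>carrier (sec F U). psi V (res F U V s) = res (free_sheaf P1 m) U V (psi U s))"
    using W(3) unfolding sheaf_iso_on_def space_top_P1 by metis
  have "trivialisation F W m psi"
    by (rule trivialisation.intro) (use assms W psi in \<open>auto simp: vector_bundle_def\<close>)
  then show ?thesis using W by blast
qed

text \<open>A section over a nonempty open set is identified with its value at the generic point, read off
  in a fixed trivialisation near the point at infinity.\<close>

locale bundle_at_infinity = triv: trivialisation F U0 n phi
  for F :: "('k::field P1_point, 'k P1_fun, 'm) mod_sheaf" and U0 n phi +
  assumes vb: "vector_bundle P1 F" and inf_U0: "infpt \<in> U0"
begin

text \<open>\<open>V\<close> need not lie in \<open>U0\<close>, but it meets \<open>U0\<close>, and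
  by \<open>gam_inj\<close> the restriction to the intersection loses no information.\<close>

definition gam :: "'k P1_point set \<Rightarrow> 'm \<Rightarrow> nat \<Rightarrow> 'k poly fract" where
  "gam V s = triv.coords (V \<inter> U0) (res F V (V \<inter> U0) s)"

lemma V_U0:
  assumes "openin P1_top V" "V \<noteq> {}"
  shows "openin P1_top (V \<inter> U0)" "V \<inter> U0 \<noteq> {}" "V \<inter> U0 \<subseteq> U0"
  using assms open_Int_nonempty[of V U0] triv.W_open inf_U0 by (auto intro: openin_Int)

lemma gam_ge: "n \<le> j \<Longrightarrow> gam V s j = 0"
  by (simp add: gam_def triv.coords_def)

lemma gam_res:
  assumes "openin P1_top V" "openin P1_top V'" "V' \<noteq> {}" "V' \<subseteq> V" "s \<in> carrier (sec F V)"
  shows "gam V' (res F V V' s) = gam V s"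
proof -
  have ne: "V \<noteq> {}" using assms by blast
  note * = V_U0[OF assms(1) ne] V_U0[OF assms(2,3)]
  have sub: "V' \<inter> U0 \<subseteq> V'" "V' \<inter> U0 \<subseteq> V \<inter> U0" "V \<inter> U0 \<subseteq> V" using assms by auto
  have "res F V' (V' \<inter> U0) (res F V V' s) = res F (V \<inter> U0) (V' \<inter> U0) (res F V (V \<inter> U0) s)"
    using assms * sub triv.F_res_comp[of V V' "V' \<inter> U0" s] triv.F_res_comp[of V "V \<inter> U0" "V' \<inter> U0" s]
    by simp
  then show ?thesis
    unfolding gam_def
    using triv.coords_res[OF *(4,5,6,1) _ *(3), of "res F V (V \<inter> U0) s"] assms *
    by (auto simp: triv.F_res_closed)
qed

lemma gam_add:
  assumes "openin P1_top V" "V \<noteq> {}" "s \<in> carrier (sec F V)" "t \<in> carrier (sec F V)"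
  shows "gam V (s \<oplus>\<^bsub>sec F V\<^esub> t) = gam V s + gam V t"
  unfolding gam_def using assms V_U0[OF assms(1,2)]
  by (subst triv.F_res_add) (auto simp: triv.coords_add triv.F_res_closed)

lemma gam_smult:
  assumes "openin P1_top V" "V \<noteq> {}" "c \<in> reg V" "s \<in> carrier (sec F V)"
  shows "gam V (const V c \<odot>\<^bsub>sec F V\<^esub> s) = scal c (gam V s)"
proof -
  have "res F V (V \<inter> U0) (const V c \<odot>\<^bsub>sec F V\<^esub> s) = const (V \<inter> U0) c \<odot>\<^bsub>sec F (V \<inter> U0)\<^esub> res F V (V \<inter> U0) s"
    using triv.F_res_smult[of V "V \<inter> U0" "const V c" s] assms V_U0[OF assms(1,2)]
    by (simp add: ring_sec_P1 restrict_const)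
  moreover have "c \<in> reg (V \<inter> U0)" using assms reg_mono by blast
  ultimately show ?thesis
    unfolding gam_def using assms V_U0[OF assms(1,2)] by (simp add: triv.coords_smult triv.F_res_closed)
qed

text \<open>Near any point of V, a second chart is available. Equal images under \<open>gam\<close>
  give equality after restriction into \<open>U0\<close>; coordinates in the second chart are
  insensitive to this restriction, so equality already holds near the point. Locality then
  concludes.\<close>

lemma gam_inj:
  assumes V: "openin P1_top V" "V \<noteq> {}" and s: "s \<in> carrier (sec F V)" and t: "t \<in> carrier (sec F V)"
    and eq: "gam V s = gam V t"
  shows "s = t"
proof -
  define \<U> where "\<U> = {V'. openin P1_top V' \<and> V' \<subseteq> V \<and> res F V V' s = res F V V' t}"
  have "P \<in> \<Union>\<U>" if "P \<in> V" for P
  proof -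
    have "P \<in> P1_points" using that openin_P1_points[OF V(1)] by blast
    then obtain W m psi where W: "trivialisation F W m psi" "P \<in> W"
      using trivialisation_exists[OF vb] by blast
    interpret psi: trivialisation F W m psi by (rule W(1))
    define V' where "V' = V \<inter> W"
    have V': "openin P1_top V'" "V' \<noteq> {}" "V' \<subseteq> W" "V' \<subseteq> V"
      using V psi.W_open W that by (auto simp: V'_def)
    define V'' where "V'' = V' \<inter> U0"
    note V'' = V_U0[OF V'(1,2), folded V''_def]
    have sub: "V'' \<subseteq> V'" "V'' \<subseteq> W" "V'' \<subseteq> V \<inter> U0" "V'' \<subseteq> V" using V' by (auto simp: V''_def)
    have "res F V V'' s = res F V V'' t"
    proof (rule triv.coords_inj[OF V''])
      show "triv.coords V'' (res F V V'' s) = triv.coords V'' (res F V V'' t)"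
        using gam_res[OF V(1) V''(1,2) sub(4)] s t eq V V'' sub
        by (simp add: gam_def Int_absorb2 triv.F_res_comp V_U0)
    qed (use V V'' sub s t in \<open>auto intro: triv.F_res_closed\<close>)
    then have "res F V' V'' (res F V V' s) = res F V' V'' (res F V V' t)"
      using V V' V'' sub s t by (simp add: triv.F_res_comp)
    \<comment> \<open>Equal coordinates over the small set are equal coordinates over all of
      V'.\<close>
    then have "psi.coords V' (res F V V' s) = psi.coords V' (res F V V' t)"
      using psi.coords_res[OF V''(1,2) sub(2) V'(1) sub(1) V'(3)] V V' s t triv.F_res_closed by metis
    then have "res F V V' s = res F V V' t"
      using V V' s t by (intro psi.coords_inj[OF V'(1,2,3)]) (auto intro: triv.F_res_closed)
    then show ?thesis using V' that W(2) by (auto simp: \<U>_def V'_def)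
  qed
  then have U: "\<Union>\<U> = V" by (auto simp: \<U>_def)
  show ?thesis
    by (rule triv.F.locality[of \<U>]) (use s t U in \<open>auto simp: \<U>_def\<close>)
qed

text \<open>The lattice M_P, formed from germs at P. It is defined for every point,
  \<open>eta\<close> and \<open>infpt\<close> included.\<close>

definition stalk :: "'k P1_point \<Rightarrow> (nat \<Rightarrow> 'k poly fract) set" where
  "stalk P = {v. \<exists>V s. openin P1_top V \<and> P \<in> V \<and> s \<in> carrier (sec F V) \<and> v = gam V s}"

text \<open>Local sections with the common value v agree on overlaps by \<open>gam_inj\<close>, so
  they glue.\<close>

lemma gam_image:
  assumes V: "openin P1_top V" "V \<noteq> {}" and v: "\<And>P. P \<in> V \<Longrightarrow> v \<in> stalk P"
  shows "\<exists>s\<in>carrier (sec F V). gam V s = v"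
proof -
  \<comment> \<open>Empty members are excluded so that all overlaps are nonempty and
    \<open>gam\<close> is injective on them.\<close>
  define \<U> where "\<U> = {V'. openin P1_top V' \<and> V' \<noteq> {} \<and> V' \<subseteq> V \<and> (\<exists>s\<in>carrier (sec F V'). gam V' s = v)}"
  have "\<forall>V'\<in>\<U>. \<exists>s. s \<in> carrier (sec F V') \<and> gam V' s = v" by (auto simp: \<U>_def)
  from bchoice[OF this] obtain f where f: "\<And>V'. V' \<in> \<U> \<Longrightarrow> f V' \<in> carrier (sec F V') \<and> gam V' (f V') = v"
    by blast
  have op: "openin P1_top V'" "V' \<noteq> {}" if "V' \<in> \<U>" for V' using that by (auto simp: \<U>_def)
  have "P \<in> \<Union>\<U>" if PV: "P \<in> V" for P
  proof -
    obtain V' s where V': "openin P1_top V'" "P \<in> V'" "s \<in> carrier (sec F V')" "v = gam V' s"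
      using v[OF PV] by (auto simp: stalk_def)
    have *: "openin P1_top (V' \<inter> V)" "V' \<inter> V \<noteq> {}" using V V' that by auto
    then have "gam (V' \<inter> V) (res F V' (V' \<inter> V) s) = v" using gam_res V' by auto
    moreover have "res F V' (V' \<inter> V) s \<in> carrier (sec F (V' \<inter> V))"
      using * V' by (intro triv.F_res_closed) auto
    ultimately have "V' \<inter> V \<in> \<U>" using * by (auto simp: \<U>_def)
    then show ?thesis using that V' by blast
  qed
  then have U: "\<Union>\<U> = V" by (auto simp: \<U>_def)
  have "res F V' (V' \<inter> V'') (f V') = res F V'' (V' \<inter> V'') (f V'')" if "V' \<in> \<U>" "V'' \<in> \<U>" for V' V''
  proof -
    have *: "openin P1_top (V' \<inter> V'')" "V' \<inter> V'' \<noteq> {}"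
      using op[OF that(1)] op[OF that(2)] open_Int_nonempty[of V' V''] by auto
    show ?thesis
      by (rule gam_inj[OF *]) (use * f op that in \<open>auto simp: gam_res intro!: triv.F_res_closed\<close>)
  qed
  then obtain s where s: "s \<in> carrier (sec F (\<Union>\<U>))" "\<forall>V'\<in>\<U>. res F (\<Union>\<U>) V' s = f V'"
    using triv.F.gluing[of \<U> f] op f by auto
  obtain V' where V': "V' \<in> \<U>" using U V by blast
  have "gam V s = gam V' (res F V V' s)"
    using s(1) V' U by (intro gam_res[symmetric] V op) auto
  also have "\<dots> = v" using s U V' f by simp
  finally show ?thesis using s U by blast
qed

end

section \<open>Frames: comparing a chart with the chart at infinity\<close>

locale bundle_frame = bundle_at_infinity F U0 n phi + psi: trivialisation F W m psi
  for F :: "('k::field P1_point, 'k P1_fun, 'm) mod_sheaf" and U0 n phi W m psi +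
  assumes W_ne: "W \<noteq> {}"
begin

text \<open>The vectors \<open>w i\<close> are the images of the standard basis sections of the
  chart, in other words the columns of the transition matrix to the chart at infinity. Linearity of
  \<open>gam\<close> is applied one coordinate at a time.\<close>

lemma frame_exists:
  "\<exists>w. \<forall>V s. openin P1_top V \<longrightarrow> V \<noteq> {} \<longrightarrow> V \<subseteq> W \<longrightarrow> s \<in> carrier (sec F V) \<longrightarrow>
     gam V s = comb m (psi.coords V s) w"
proof -
  have "\<forall>i. \<exists>s. i < m \<longrightarrow> s \<in> carrier (sec F W) \<and> psi.coords W s = (\<lambda>j. if j = i then 1 else 0)"
  proof (intro allI)
    fix i
    have "\<exists>s\<in>carrier (sec F W). psi.coords W s = (\<lambda>j. if j = i then 1 else 0)" if "i < m"
      using that W_ne psi.W_open reg_closed[OF psi.W_open] by (intro psi.coords_surj) auto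
    then show "\<exists>s. i < m \<longrightarrow> s \<in> carrier (sec F W) \<and> psi.coords W s = (\<lambda>j. if j = i then 1 else 0)"
      by blast
  qed
  then obtain e where e: "\<And>i. i < m \<Longrightarrow> e i \<in> carrier (sec F W)"
      "\<And>i. i < m \<Longrightarrow> psi.coords W (e i) = (\<lambda>j. if j = i then 1 else 0)"
    by metis
  define w where "w i = gam W (e i)" for i
  have "gam V s = comb m (psi.coords V s) w"
    if V: "openin P1_top V" "V \<noteq> {}" "V \<subseteq> W" and s: "s \<in> carrier (sec F V)" for V s
  proof -
    have "gam V s = comb k (psi.coords V s) w"
      if "k \<le> m" "s \<in> carrier (sec F V)" "\<And>i. k \<le> i \<Longrightarrow> psi.coords V s i = 0" for k s
      using that
    proof (induction k arbitrary: s)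
      \<comment> \<open>A section with zero coordinates satisfies s + s = s, and so does its image
        in K^n.\<close>
      case 0
      have "s \<oplus>\<^bsub>sec F V\<^esub> s = s"
      proof (rule psi.coords_inj[OF V])
        show "psi.coords V (s \<oplus>\<^bsub>sec F V\<^esub> s) = psi.coords V s"
          using 0 V by (simp add: psi.coords_add fun_eq_iff)
      qed (use 0 V psi.F_closed in auto)
      then have "gam V s + gam V s = gam V s" using gam_add[OF V(1,2), of s s] 0 by simp
      then have "gam V s = 0" by simp
      then show ?case by (auto simp: comb_def)
    next
      case (Suc k)
      define c where "c = psi.coords V s k"
      have c: "c \<in> reg V" unfolding c_def using psi.psi_coords(2)[OF V Suc.prems(2)] Suc.prems(1) by simp
      have "\<exists>t\<in>carrier (sec F V). psi.coords V t = (\<lambda>i. if i < k then psi.coords V s i else 0)"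
        using psi.psi_coords(2)[OF V Suc.prems(2)] reg_closed[OF V(1)] Suc.prems(1)
        by (intro psi.coords_surj[OF V]) auto
      then obtain t where t: "t \<in> carrier (sec F V)" "psi.coords V t = (\<lambda>i. if i < k then psi.coords V s i else 0)"
        by blast
      \<comment> \<open>The contribution of coordinate k alone; \<open>t\<close> carries the
        coordinates below k.\<close>
      define u where "u = const V c \<odot>\<^bsub>sec F V\<^esub> res F W V (e k)"
      have r: "res F W V (e k) \<in> carrier (sec F V)"
        using e Suc.prems V psi.W_open by (intro psi.F_res_closed) auto
      then have u: "u \<in> carrier (sec F V)" unfolding u_def using c V psi.F_closed by blast
      have cu: "psi.coords V u = scal c (\<lambda>j. if j = k then 1 else 0)"
        unfolding u_def using psi.coords_smult[OF V c r] psi.coords_res[OF V psi.W_open V(3) subset_refl] e Suc.prems(1)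
        by simp
      have "s = t \<oplus>\<^bsub>sec F V\<^esub> u"
      proof (rule psi.coords_inj[OF V])
        show "psi.coords V s = psi.coords V (t \<oplus>\<^bsub>sec F V\<^esub> u)"
          using t u cu V Suc.prems(3) by (auto simp: psi.coords_add fun_eq_iff scal_def c_def not_less Suc_le_eq)
      qed (use Suc.prems t u V psi.F_closed in auto)
      moreover have "gam V t = comb k (psi.coords V t) w"
        using t Suc.prems(1) by (intro Suc.IH) auto
      moreover have "comb k (psi.coords V t) w = comb k (psi.coords V s) w"
        using t by (intro comb_cong) simp
      moreover have "gam V u = scal c (w k)"
        unfolding u_def w_def using gam_smult[OF V(1,2) c r] gam_res[OF psi.W_open V(1,2,3)] e Suc.prems(1) by simp
      ultimately show ?case using gam_add[OF V(1,2) t(1) u] by (simp add: comb_Suc c_def)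
    qed
    from this[of m s] show ?thesis using s V by (simp add: psi.coords_ge)
  qed
  then show ?thesis by blast
qed

lemma reg_open:
  fixes k :: nat
  assumes "Q \<in> P1_points" "\<And>i. i < k \<Longrightarrow> a i \<in> loc Q"
  shows "\<exists>V. openin P1_top V \<and> Q \<in> V \<and> (\<forall>i<k. a i \<in> reg V)"
  using assms(2)
proof (induction k)
  case 0
  then show ?case using assms(1) openin_topspace[of P1_top] by auto
next
  case (Suc k)
  then obtain V where V: "openin P1_top V" "Q \<in> V" "\<forall>i<k. a i \<in> reg V" by auto
  obtain V' where V': "openin P1_top V'" "Q \<in> V'" "a k \<in> reg V'"
    using loc_open[OF assms(1)] Suc.prems by blast
  have "reg V \<subseteq> reg (V \<inter> V')" "reg V' \<subseteq> reg (V \<inter> V')" by (auto simp: reg_def)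
  then show ?case using V V' by (intro exI[of _ "V \<inter> V'"]) (auto simp: less_Suc_eq)
qed

lemma stalk_coords:
  assumes Q: "Q \<in> W"
  shows "stalk Q = (\<Union>V\<in>{V. openin P1_top V \<and> Q \<in> V \<and> V \<subseteq> W}. gam V ` carrier (sec F V))"
proof (intro equalityI subsetI)
  fix v assume "v \<in> stalk Q"
  then obtain V s where V: "openin P1_top V" "Q \<in> V" "s \<in> carrier (sec F V)" "v = gam V s"
    by (auto simp: stalk_def)
  have "openin P1_top (V \<inter> W)" "V \<inter> W \<noteq> {}" using V Q psi.W_open by auto
  then have "v = gam (V \<inter> W) (res F V (V \<inter> W) s)" "res F V (V \<inter> W) s \<in> carrier (sec F (V \<inter> W))"
    using V by (auto simp: gam_res intro: psi.F_res_closed)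
  then show "v \<in> (\<Union>V\<in>{V. openin P1_top V \<and> Q \<in> V \<and> V \<subseteq> W}. gam V ` carrier (sec F V))"
    using \<open>openin P1_top (V \<inter> W)\<close> V Q by blast
qed (auto simp: stalk_def)

text \<open>One frame serves all points of the chart at once; only the ring of admissible
  coefficients varies with the point.\<close>

lemma stalk_frame:
  "\<exists>w. \<forall>Q\<in>W. stalk Q = {v. \<exists>a. (\<forall>i<m. a i \<in> loc Q) \<and> v = comb m a w}"
proof -
  obtain w where w: "\<And>V s. openin P1_top V \<Longrightarrow> V \<noteq> {} \<Longrightarrow> V \<subseteq> W \<Longrightarrow> s \<in> carrier (sec F V) \<Longrightarrow>
     gam V s = comb m (psi.coords V s) w"
    using frame_exists by blast
  have "stalk Q = {v. \<exists>a. (\<forall>i<m. a i \<in> loc Q) \<and> v = comb m a w}" if Q: "Q \<in> W" for Q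
  proof (intro equalityI subsetI)
    fix v assume "v \<in> stalk Q"
    then obtain V s where V: "openin P1_top V" "Q \<in> V" "V \<subseteq> W" "s \<in> carrier (sec F V)" "v = gam V s"
      by (auto simp: stalk_coords[OF Q])
    then have ne: "V \<noteq> {}" by blast
    have "v = comb m (psi.coords V s) w" using w V ne by simp
    moreover have "psi.coords V s i \<in> loc Q" if "i < m" for i
      using psi.psi_coords(2)[OF V(1) ne V(3,4) that] V(2) by (simp add: reg_def)
    ultimately show "v \<in> {v. \<exists>a. (\<forall>i<m. a i \<in> loc Q) \<and> v = comb m a w}" by blast
  next
    fix v assume "v \<in> {v. \<exists>a. (\<forall>i<m. a i \<in> loc Q) \<and> v = comb m a w}"
    then obtain a where a: "\<And>i. i < m \<Longrightarrow> a i \<in> loc Q" "v = comb m a w" by blast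
    have "Q \<in> P1_points" using Q openin_P1_points[OF psi.W_open] by blast
    then obtain V where V: "openin P1_top V" "Q \<in> V" "\<forall>i<m. a i \<in> reg V"
      using reg_open[of Q m a] a(1) by blast
    define V' where "V' = V \<inter> W"
    have V': "openin P1_top V'" "V' \<noteq> {}" "V' \<subseteq> W" "Q \<in> V'" "\<forall>i<m. a i \<in> reg V'"
      using V Q psi.W_open reg_mono[of V' V] by (auto simp: V'_def)
    define a' where "a' = (\<lambda>i. if i < m then a i else 0)"
    have "\<exists>s\<in>carrier (sec F V'). psi.coords V' s = a'"
      using V' by (intro psi.coords_surj) (auto simp: a'_def)
    then obtain s where s: "s \<in> carrier (sec F V')" "psi.coords V' s = a'" by blast
    have "gam V' s = comb m a' w" using w[OF V'(1,2,3)] s by simp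
    also have "\<dots> = v" unfolding a by (intro comb_cong) (simp add: a'_def)
    finally show "v \<in> stalk Q" using V' s by (auto simp: stalk_def)
  qed
  then show ?thesis by blast
qed

end

context bundle_at_infinity
begin

text \<open>The generic point is listed because vectors of K^n are first expanded over K at
  \<open>eta\<close>, and the coefficients are then examined at the point of interest.\<close>

lemma stalk_frame_exists:
  assumes "P \<in> P1_points"
  obtains W m w where "P \<in> W" "eta \<in> W"
    "\<forall>Q\<in>W. stalk Q = {v. \<exists>a. (\<forall>i<m. a i \<in> loc Q) \<and> v = comb m a w}"
proof -
  obtain W m psi where W: "trivialisation F W m psi" "P \<in> W"
    using trivialisation_exists[OF vb assms] by blast
  interpret psi: trivialisation F W m psi by (rule W(1))
  interpret bundle_frame F U0 n phi W m psi by unfold_locales (use W in auto)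
  have "eta \<in> W" using eta_in_open psi.W_open W_ne by blast
  moreover obtain w where "\<forall>Q\<in>W. stalk Q = {v. \<exists>a. (\<forall>i<m. a i \<in> loc Q) \<and> v = comb m a w}"
    using stalk_frame by (elim exE)
  ultimately show ?thesis using W(2) that[of W m w] by simp
qed

lemma stalk_U0:
  assumes Q: "Q \<in> U0"
  shows "stalk Q = {v. (\<forall>i<n. v i \<in> loc Q) \<and> (\<forall>i\<ge>n. v i = 0)}"
proof -
  interpret bundle_frame F U0 n phi U0 n phi by unfold_locales (use Q in auto)
  have gam: "gam V s = triv.coords V s" if "V \<subseteq> U0" "openin P1_top V" "s \<in> carrier (sec F V)" for V s
    using that by (simp add: gam_def Int_absorb2 triv.F_res_id)
  show ?thesis
  proof (intro equalityI subsetI)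
    fix v assume "v \<in> stalk Q"
    then obtain V s where V: "openin P1_top V" "Q \<in> V" "V \<subseteq> U0" "s \<in> carrier (sec F V)" "v = gam V s"
      by (auto simp: stalk_coords[OF Q])
    then have ne: "V \<noteq> {}" by blast
    have "v i \<in> loc Q" if "i < n" for i
      using triv.psi_coords(2)[OF V(1) ne V(3,4) that] V gam by (simp add: reg_def)
    then show "v \<in> {v. (\<forall>i<n. v i \<in> loc Q) \<and> (\<forall>i\<ge>n. v i = 0)}" using gam_ge V by simp
  next
    fix v assume v: "v \<in> {v. (\<forall>i<n. v i \<in> loc Q) \<and> (\<forall>i\<ge>n. v i = 0)}"
    have "Q \<in> P1_points" using Q openin_P1_points[OF triv.W_open] by blast
    then obtain V where V: "openin P1_top V" "Q \<in> V" "\<forall>i<n. v i \<in> reg V"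
      using reg_open[of Q n v] v by blast
    define V' where "V' = V \<inter> U0"
    have V': "openin P1_top V'" "V' \<noteq> {}" "V' \<subseteq> U0" "Q \<in> V'" "\<forall>i<n. v i \<in> reg V'"
      using V Q triv.W_open reg_mono[of V' V] by (auto simp: V'_def)
    have "\<exists>s\<in>carrier (sec F V'). triv.coords V' s = v"
      using V' v by (intro triv.coords_surj) auto
    then obtain s where s: "s \<in> carrier (sec F V')" "triv.coords V' s = v" by blast
    then have "gam V' s = v" using gam V' by simp
    then show "v \<in> stalk Q" using V' s by (auto simp: stalk_def)
  qed
qed

end

subsection \<open>Splitting\<close>

text \<open>A nonzero form vanishing off V becomes a nonzero polynomial, which lies in only finitely
  many primes of k[t].\<close>

lemma finite_complement:
  assumes V: "openin P1_top V" "V \<noteq> {}"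
  shows "finite {Q. affine_point Q \<and> Q \<notin> V}"
proof -
  obtain f d where f: "homogeneous d f" "f \<notin> eta" "\<And>Q. Q \<in> P1_points \<Longrightarrow> Q \<notin> V \<Longrightarrow> f \<in> Q"
    using open_separating[OF V(1) eta_in_open[OF V]] by blast
  then have "dehom f \<noteq> 0" by (simp add: eta_def homogeneous_dehom_0_iff)
  then have "finite {Q. affine_point Q \<and> dehom f \<in> aff Q}" by (rule finite_points_containing)
  moreover have "dehom f \<in> aff Q" if "affine_point Q" "Q \<notin> V" for Q
    using f that affine_point.homogeneous_in affine_point.point by blast
  ultimately show ?thesis by (elim finite_subset[rotated]) blast
qed

lemma Fract_mult_1: "Fract (a * b) 1 = Fract a 1 * Fract (b::'a::idom) 1"
  by simp

lemma Fract_prod_remove: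
  fixes g :: "'b \<Rightarrow> 'a::idom"
  assumes "finite S" "Q \<in> S"
  shows "Fract (prod g S) 1 = Fract (prod g (S - {Q})) 1 * Fract (g Q) 1"
  by (subst prod.remove[OF assms]) (simp add: mult.commute)

lemma common_denominator:
  "finite S \<Longrightarrow> \<exists>g. g \<noteq> 0 \<and> (\<forall>c\<in>S. Fract g 1 * c \<in> poly_vals)"
proof (induction S rule: finite_induct)
  case (insert c S)
  then obtain g where g: "g \<noteq> 0" "\<forall>c\<in>S. Fract g 1 * c \<in> poly_vals" by blast
  obtain p q where pq: "c = Fract p q" "q \<noteq> 0" by (cases c)
  have "Fract (g * q) 1 * c = Fract (g * p) 1"
    using pq by (simp add: eq_fract)
  then have "Fract (g * q) 1 * c \<in> poly_vals" by blast
  moreover have "Fract (g * q) 1 * x \<in> poly_vals" if "x \<in> S" for x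
  proof -
    obtain r where "Fract g 1 * x = Fract r 1" using g \<open>x \<in> S\<close> by blast
    moreover have "Fract (g * q) 1 * x = Fract q 1 * (Fract g 1 * x)"
      by (simp only: Fract_mult_1 mult_ac)
    ultimately have "Fract (g * q) 1 * x = Fract (q * r) 1" by simp
    then show ?thesis by blast
  qed
  ultimately show ?case using g pq by (intro exI[of _ "g * q"]) auto
qed (auto intro: exI[of _ 1])

lemma (in affine_point) poly_mult_in_loc: "c \<in> loc P \<Longrightarrow> Fract g 1 * c \<in> loc P"
  using loc_closed(4)[OF point] poly_in_loc by blast

context bundle_at_infinity
begin

section \<open>The stalks as lattices commensurable with the standard one\<close>

lemma stalk_ge: "v \<in> stalk P \<Longrightarrow> n \<le> j \<Longrightarrow> v j = 0"
  by (auto simp: stalk_def gam_ge)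

lemma stalk_closed:
  assumes P: "P \<in> P1_points"
  shows "0 \<in> stalk P" "v \<in> stalk P \<Longrightarrow> v' \<in> stalk P \<Longrightarrow> v + v' \<in> stalk P"
    "c \<in> loc P \<Longrightarrow> v \<in> stalk P \<Longrightarrow> scal c v \<in> stalk P"
proof -
  obtain W m w where W: "P \<in> W" "eta \<in> W"
      "\<forall>Q\<in>W. stalk Q = {v. \<exists>a. (\<forall>i<m. a i \<in> loc Q) \<and> v = comb m a w}"
    by (rule stalk_frame_exists[OF P])
  note * = bspec[OF W(3) W(1)]
  have "0 = comb m (\<lambda>_. 0) w" by (auto simp: comb_def)
  then show "0 \<in> stalk P" unfolding * using loc_closed(1)[OF P] by auto
  show "v + v' \<in> stalk P" if v: "v \<in> stalk P" "v' \<in> stalk P"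
  proof -
    obtain a a' where "\<forall>i<m. a i \<in> loc P" "v = comb m a w" "\<forall>i<m. a' i \<in> loc P" "v' = comb m a' w"
      using v unfolding * by blast
    then have "\<forall>i<m. (a + a') i \<in> loc P" "v + v' = comb m (a + a') w"
      by (simp_all add: comb_add loc_closed[OF P])
    then show ?thesis unfolding * by blast
  qed
  show "scal c v \<in> stalk P" if c: "c \<in> loc P" and v: "v \<in> stalk P"
  proof -
    obtain a where "\<forall>i<m. a i \<in> loc P" "v = comb m a w" using v unfolding * by blast
    then have "\<forall>i<m. (scal c a) i \<in> loc P"
      using c by (simp add: scal_def loc_closed[OF P])
    moreover have "scal c v = comb m (scal c a) w"
      using \<open>v = comb m a w\<close> by (simp add: comb_scal)
    ultimately show ?thesis unfolding * by blast
  qed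
qed

lemma stalk_poly_scal:
  assumes "affine_point P" "c \<in> poly_vals" "v \<in> stalk P"
  shows "scal c v \<in> stalk P"
  using assms affine_point.point affine_point.poly_in_loc stalk_closed(3) by blast

lemma stalk_comb:
  assumes "P \<in> P1_points" "\<And>i. i < k \<Longrightarrow> a i \<in> loc P" "\<And>i. i < k \<Longrightarrow> b i \<in> stalk P"
  shows "comb k a b \<in> stalk P"
  using assms(2,3)
proof (induction k)
  case 0
  have "comb 0 a b = 0" by (auto simp: comb_def)
  then show ?case using stalk_closed(1)[OF assms(1)] by metis
qed (simp add: comb_Suc stalk_closed[OF assms(1)])

lemma stalk_eta: "stalk eta = {v. \<forall>i\<ge>n. v i = 0}"
proof -
  have "eta \<in> U0" using eta_in_open triv.W_open inf_U0 by blast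
  then show ?thesis by (simp add: stalk_U0 loc_eta)
qed

text \<open>A common denominator of the entries of a frame at Q bounds the poles of all germs at
  Q.\<close>

lemma stalk_denominator:
  assumes Q: "affine_point Q"
  shows "\<exists>g. g \<noteq> 0 \<and> (\<forall>v\<in>stalk Q. \<forall>j. Fract g 1 * v j \<in> loc Q)"
proof -
  interpret affine_point Q by (rule Q)
  obtain W m w where w: "Q \<in> W" "eta \<in> W" "\<forall>Q\<in>W. stalk Q = {v. \<exists>a. (\<forall>i<m. a i \<in> loc Q) \<and> v = comb m a w}"
    by (rule stalk_frame_exists[OF point])
  have "finite (case_prod w ` ({..<m} \<times> {..<n}))" by simp
  from common_denominator[OF this] obtain g where g: "g \<noteq> 0"
      "\<And>i j. i < m \<Longrightarrow> j < n \<Longrightarrow> Fract g 1 * w i j \<in> poly_vals"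
    by force
  have "Fract g 1 * v j \<in> loc Q" if v: "v \<in> stalk Q" for v j
  proof (cases "j < n")
    case True
    obtain a where a: "\<forall>i<m. a i \<in> loc Q" "v = comb m a w" using v bspec[OF w(3) w(1)] by blast
    have "Fract g 1 * v j = (\<Sum>i<m. a i * (Fract g 1 * w i j))"
      by (simp add: a comb_def sum_distrib_left mult.left_commute)
    also have "\<dots> \<in> loc Q"
    proof (rule loc_sum[OF point])
      fix i assume "i \<in> {..<m}"
      then show "a i * (Fract g 1 * w i j) \<in> loc Q"
        using loc_closed(4)[OF point] poly_in_loc a g(2) True by (meson lessThan_iff)
    qed
    finally show ?thesis .
  next
    case False
    then show ?thesis using stalk_ge[OF v] loc_closed(1)[OF point] by simp
  qed
  then show ?thesis using g by blast
qed

text \<open>The opposite bound: the unit vectors are expanded in the frame over K, and h clears the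
  denominators of their coefficients.\<close>

lemma unit_vector_denominator:
  assumes Q: "affine_point Q"
  shows "\<exists>h. h \<noteq> 0 \<and> (\<forall>v. (\<forall>j. v j \<in> poly_vals) \<longrightarrow> (\<forall>j\<ge>n. v j = 0) \<longrightarrow> scal (Fract h 1) v \<in> stalk Q)"
proof -
  interpret affine_point Q by (rule Q)
  define e :: "nat \<Rightarrow> nat \<Rightarrow> 'k poly fract" where "e i = (\<lambda>j. if i = j then 1 else 0)" for i
  obtain W m w where w: "Q \<in> W" "eta \<in> W" "\<forall>Q\<in>W. stalk Q = {v. \<exists>a. (\<forall>i<m. a i \<in> loc Q) \<and> v = comb m a w}"
    by (rule stalk_frame_exists[OF point])
  have "\<exists>a. e i = comb m a w" if "i < n" for i
  proof -
    have "e i \<in> stalk eta" using that by (simp add: stalk_eta e_def)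
    then show ?thesis using bspec[OF w(3) w(2)] by blast
  qed
  then have "\<forall>i. \<exists>a. i < n \<longrightarrow> e i = comb m a w" by blast
  then obtain a where a: "\<And>i. i < n \<Longrightarrow> e i = comb m (a i) w" by metis
  have "finite (case_prod a ` ({..<n} \<times> {..<m}))" by simp
  from common_denominator[OF this] obtain h where h: "h \<noteq> 0"
      "\<And>i j. i < n \<Longrightarrow> j < m \<Longrightarrow> Fract h 1 * a i j \<in> poly_vals"
    by force
  have he: "scal (Fract h 1) (e i) \<in> stalk Q" if "i < n" for i
  proof -
    have "scal (Fract h 1) (e i) = comb m (scal (Fract h 1) (a i)) w" using a that by (simp add: comb_scal)
    moreover have "\<forall>j<m. scal (Fract h 1) (a i) j \<in> loc Q"
      using h(2) that by (auto simp: scal_def intro: poly_in_loc)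
    ultimately show ?thesis using bspec[OF w(3) w(1)] by blast
  qed
  have "scal (Fract h 1) v \<in> stalk Q" if v: "\<forall>j. v j \<in> poly_vals" "\<forall>j\<ge>n. v j = 0" for v
  proof -
    have "scal (Fract h 1) v = comb n v (\<lambda>i. scal (Fract h 1) (e i))"
    proof
      fix j
      have "(\<Sum>i<n. v i * (Fract h 1 * (if i = j then 1 else 0))) = (\<Sum>i<n. if i = j then Fract h 1 * v j else 0)"
        by (intro sum.cong) auto
      then show "scal (Fract h 1) v j = comb n v (\<lambda>i. scal (Fract h 1) (e i)) j"
        using v(2) by (simp add: scal_def comb_def e_def)
    qed
    also have "\<dots> \<in> stalk Q"
      using he v(1) by (intro stalk_comb point poly_in_loc) auto
    finally show ?thesis .
  qed
  then show ?thesis using h by blast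
qed

text \<open>The sections over the complement of the point at infinity.\<close>

definition M0 :: "(nat \<Rightarrow> 'k poly fract) set" where
  "M0 = {v. \<forall>P. affine_point P \<longrightarrow> v \<in> stalk P}"

lemma finite_outside: "finite {Q. affine_point Q \<and> Q \<notin> U0}"
  using triv.W_open inf_U0 by (intro finite_complement) auto

text \<open>G clears the possible poles at the finitely many finite points outside
  \<open>U0\<close>, so G v is a polynomial vector.\<close>

lemma M0_bounded: "\<exists>B. \<forall>v\<in>M0. \<forall>d<B. vdeg_le v d \<longrightarrow> v = 0"
proof -
  define S where "S = {Q. affine_point Q \<and> Q \<notin> U0}"
  have S: "finite S" unfolding S_def by (rule finite_outside)
  have "\<forall>Q\<in>S. \<exists>g. g \<noteq> 0 \<and> (\<forall>v\<in>stalk Q. \<forall>j. Fract g 1 * v j \<in> loc Q)"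
    using stalk_denominator by (auto simp: S_def)
  from bchoice[OF this] obtain g where g: "\<And>Q. Q \<in> S \<Longrightarrow> g Q \<noteq> 0"
      "\<And>Q v j. Q \<in> S \<Longrightarrow> v \<in> stalk Q \<Longrightarrow> Fract (g Q) 1 * v j \<in> loc Q"
    by blast
  define G where "G = prod g S"
  have "G \<noteq> 0" using g(1) S by (simp add: G_def)
  have Gv: "Fract G 1 * v j \<in> poly_vals" if v: "v \<in> M0" for v j
  proof (rule Inter_loc_affine)
    fix P :: "'k P1_point" assume P: "affine_point P"
    then interpret affine_point P .
    have vP: "v \<in> stalk P" using v P by (simp add: M0_def)
    show "Fract G 1 * v j \<in> loc P"
    proof (cases "P \<in> U0")
      case True
      have "v j \<in> loc P"
        using vP loc_closed(1)[OF point] by (cases "j < n") (auto simp: stalk_U0[OF True])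
      then show ?thesis by (rule poly_mult_in_loc)
    next
      case False
      then have PS: "P \<in> S" using P by (simp add: S_def)
      from Fract_prod_remove[OF S PS, of g] have "Fract G 1 * v j = Fract (prod g (S - {P})) 1 * (Fract (g P) 1 * v j)"
        by (simp only: mult.assoc G_def)
      also have "\<dots> \<in> loc P" using g(2)[OF PS vP] by (rule poly_mult_in_loc)
      finally show ?thesis .
    qed
  qed
  \<comment> \<open>A nonzero polynomial has degree at least 0, so a nonzero v has degree at least -
    deg G.\<close>
  have "v = 0" if v: "v \<in> M0" "vdeg_le v d" "d < - int (degree G)" for v d
  proof
    fix j
    obtain p where p: "Fract G 1 * v j = Fract p 1" using Gv[OF v(1)] by blast
    have "deg_le (Fract G 1 * v j) (int (degree G) + d)"
      using v(2) by (intro deg_le_mult) (auto simp: deg_le_poly vdeg_le_def)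
    then have "p = 0" using v(3) by (simp add: p deg_le_poly)
    then have "Fract G 1 * v j = 0" using p by (simp add: fract_collapse)
    then show "v j = 0 j" using \<open>G \<noteq> 0\<close> by (simp add: Fract_zero_iff)
  qed
  then show ?thesis by blast
qed

text \<open>Every vector has a polynomial multiple in \<open>M0\<close>: g makes its entries
  polynomial, and H then enforces the conditions at the points outside \<open>U0\<close>. Thus a
  basis taken from \<open>M0\<close> can also express the germs at infinity.\<close>

lemma M0_spans:
  assumes "M0 \<subseteq> spn m b" "\<forall>j\<ge>n. v j = 0"
  shows "v \<in> spn m b"
proof -
  define S where "S = {Q. affine_point Q \<and> Q \<notin> U0}"
  have S: "finite S" unfolding S_def by (rule finite_outside)
  have "\<forall>Q\<in>S. \<exists>h. h \<noteq> 0 \<and> (\<forall>v. (\<forall>j. v j \<in> poly_vals) \<longrightarrow> (\<forall>j\<ge>n. v j = 0) \<longrightarrow> scal (Fract h 1) v \<in> stalk Q)"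
    using unit_vector_denominator by (auto simp: S_def)
  from bchoice[OF this] obtain h where h: "\<And>Q. Q \<in> S \<Longrightarrow> h Q \<noteq> 0"
      "\<And>Q v. Q \<in> S \<Longrightarrow> (\<forall>j. v j \<in> poly_vals) \<Longrightarrow> (\<forall>j\<ge>n. v j = 0) \<Longrightarrow> scal (Fract (h Q) 1) v \<in> stalk Q"
    by blast
  obtain g where g: "g \<noteq> 0" "\<And>j. j < n \<Longrightarrow> Fract g 1 * v j \<in> poly_vals"
    using common_denominator[of "v ` {..<n}"] by auto
  define u where "u = scal (Fract g 1) v"
  have "(0 :: 'k poly fract) \<in> poly_vals" by (auto simp: Zero_fract_def)
  then have u: "u j \<in> poly_vals" for j
    using g(2) assms(2) by (cases "j < n") (auto simp: u_def scal_def)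
  have u0: "\<forall>j\<ge>n. u j = 0" using assms(2) by (simp add: u_def scal_def)
  define H where "H = prod h S"
  have H: "H \<noteq> 0" using h(1) S by (simp add: H_def)
  have "scal (Fract H 1) u \<in> stalk P" if P: "affine_point P" for P
  proof -
    interpret affine_point P by (rule P)
    show ?thesis
    proof (cases "P \<in> U0")
      case True
      then show ?thesis
        using u u0 by (auto simp: stalk_U0 scal_def intro!: poly_mult_in_loc intro: poly_in_loc)
    next
      case False
      then have PS: "P \<in> S" using P by (simp add: S_def)
      from Fract_prod_remove[OF S PS, of h] have "scal (Fract H 1) u = scal (Fract (prod h (S - {P})) 1) (scal (Fract (h P) 1) u)"
        by (simp only: vec.scale_scale H_def)
      also have "\<dots> \<in> stalk P" using h(2)[OF PS _ u0] u by (intro stalk_poly_scal[OF P, of "Fract (prod h (S - {P})) 1"]) auto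
      finally show ?thesis .
    qed
  qed
  then have "scal (Fract H 1) u \<in> spn m b" using assms(1) by (auto simp: M0_def)
  then have "scal (Fract 1 (H * g)) (scal (Fract H 1) u) \<in> spn m b"
    by (simp only: spn_eq_span vec.span_scale)
  moreover have "Fract 1 (H * g) * (Fract H 1 * Fract g 1) = 1"
    using H g(1) by (simp add: One_fract_def eq_fract)
  ultimately show ?thesis by (simp add: u_def mult.assoc)
qed

lemma M0_poly_lattice: "\<exists>B. poly_lattice M0 n B"
proof -
  obtain B where B: "\<forall>v\<in>M0. \<forall>d<B. vdeg_le v d \<longrightarrow> v = 0" using M0_bounded by blast
  have "poly_lattice M0 n B"
  proof
    fix c :: "'k poly fract" and v assume c: "c \<in> poly_vals" and v: "v \<in> M0"
    show "scal c v \<in> M0"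
      unfolding M0_def
      using c v stalk_poly_scal by (auto simp: M0_def)
  next
    show "v j = 0" if "v \<in> M0" "n \<le> j" for v j
      using that stalk_ge affine_eta by (auto simp: M0_def)
  next
    show "v + w \<in> M0" if "v \<in> M0" "w \<in> M0" for v w
      using that affine_point.point stalk_closed(2) unfolding M0_def by blast
  qed (use B affine_point.point stalk_closed(1) in \<open>auto simp: M0_def\<close>)
  then show ?thesis ..
qed

text \<open>A germ extends to a neighbourhood V of P with finite complement in the affine line. A
  form vanishing off V but not at P separates each omitted point from P, so
  \<open>clear_pole\<close> supplies factors that are units at P.\<close>

lemma stalk_clear_poles:
  assumes P: "affine_point P" and v: "v \<in> stalk P"
  shows "\<exists>g. g \<notin> aff P \<and> scal (Fract g 1) v \<in> M0"
proof -
  interpret P: affine_point P by (rule P)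
  obtain V s where V: "openin P1_top V" "P \<in> V" "s \<in> carrier (sec F V)" "v = gam V s"
    using v by (auto simp: stalk_def)
  then have ne: "V \<noteq> {}" by blast
  obtain f d where f: "homogeneous d f" "f \<notin> P" "\<And>Q. Q \<in> P1_points \<Longrightarrow> Q \<notin> V \<Longrightarrow> f \<in> Q"
    using open_separating[OF V(1,2)] by blast
  have fP: "dehom f \<notin> aff P" using f P.homogeneous_in by blast
  define S where "S = {Q. affine_point Q \<and> Q \<notin> V}"
  have S: "finite S" unfolding S_def by (rule finite_complement[OF V(1) ne])
  have "\<exists>g. g \<notin> aff P \<and> scal (Fract g 1) v \<in> stalk Q" if Q: "Q \<in> S" for Q
  proof -
    interpret Q: affine_point Q using Q by (simp add: S_def)
    have fQ: "dehom f \<in> aff Q" using f Q Q.homogeneous_in Q.point by (auto simp: S_def)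
    obtain W m w where w: "Q \<in> W" "eta \<in> W" "\<forall>Q\<in>W. stalk Q = {v. \<exists>a. (\<forall>i<m. a i \<in> loc Q) \<and> v = comb m a w}"
      by (rule stalk_frame_exists[OF Q.point])
    \<comment> \<open>Only over K can v be expanded in the frame at Q, because Q lies outside
      V.\<close>
    have "v \<in> stalk eta" using stalk_ge[OF v] by (simp add: stalk_eta)
    then obtain a where a: "v = comb m a w" using bspec[OF w(3) w(2)] by blast
    have "\<forall>i. \<exists>g. g \<notin> aff P \<and> Fract g 1 * a i \<in> loc Q"
      using clear_pole[OF P Q.affine_point_axioms fQ fP] by blast
    then obtain g where g: "\<And>i. g i \<notin> aff P" "\<And>i. Fract (g i) 1 * a i \<in> loc Q" by metis
    define G where "G = prod g {..<m}"
    have "Fract G 1 * a i \<in> loc Q" if "i < m" for i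
    proof -
      have "Fract G 1 * a i = Fract (prod g ({..<m} - {i})) 1 * (Fract (g i) 1 * a i)"
        using Fract_prod_remove[of "{..<m}" i g] that by (simp only: G_def mult.assoc finite_lessThan lessThan_iff)
      also have "\<dots> \<in> loc Q" using g(2) by (rule Q.poly_mult_in_loc)
      finally show ?thesis .
    qed
    then have "\<forall>i<m. scal (Fract G 1) a i \<in> loc Q" by (simp add: scal_def)
    moreover have "scal (Fract G 1) v = comb m (scal (Fract G 1) a) w" by (simp add: a comb_scal)
    ultimately have "scal (Fract G 1) v \<in> stalk Q" using bspec[OF w(3) w(1)] by blast
    moreover have "G \<notin> aff P" unfolding G_def using g(1) by (intro P.aff_prod) auto
    ultimately show ?thesis by blast
  qed
  then have "\<forall>Q\<in>S. \<exists>g. g \<notin> aff P \<and> scal (Fract g 1) v \<in> stalk Q" by blast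
  from bchoice[OF this] obtain g where g: "\<And>Q. Q \<in> S \<Longrightarrow> g Q \<notin> aff P"
      "\<And>Q. Q \<in> S \<Longrightarrow> scal (Fract (g Q) 1) v \<in> stalk Q" by blast
  define G where "G = prod g S"
  have "scal (Fract G 1) v \<in> stalk Q" if Q: "affine_point Q" for Q
  proof -
    interpret Q: affine_point Q by (rule Q)
    show ?thesis
    proof (cases "Q \<in> V")
      case True
      then have "v \<in> stalk Q" using V by (auto simp: stalk_def)
      then show ?thesis by (intro stalk_poly_scal Q) auto
    next
      case False
      then have QS: "Q \<in> S" using Q by (simp add: S_def)
      from Fract_prod_remove[OF S QS, of g] have "scal (Fract G 1) v = scal (Fract (prod g (S - {Q})) 1) (scal (Fract (g Q) 1) v)"
        by (simp only: vec.scale_scale G_def)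
      also have "\<dots> \<in> stalk Q" using g(2)[OF QS] by (intro stalk_poly_scal[OF Q, of "Fract (prod g (S - {Q})) 1"]) auto
      finally show ?thesis .
    qed
  qed
  then have "scal (Fract G 1) v \<in> M0" by (simp add: M0_def)
  moreover have "G \<notin> aff P" unfolding G_def using g(1) S by (intro P.aff_prod) auto
  ultimately show ?thesis by blast
qed

text \<open>At finite points the expansion of a vector of \<open>M0\<close> is localised; at
  infinity the norm formula decides. The same vectors b work at every point, and this makes the
  splitting global.\<close>

lemma splitting_basis:
  "\<exists>m b d. (\<forall>a. comb m a b = 0 \<longrightarrow> (\<forall>i<m. a i = 0)) \<and>
     (\<forall>P\<in>P1_points. \<forall>v. v \<in> stalk P \<longleftrightarrow> (\<exists>a. (\<forall>i<m. a i \<in> twist (d i) P) \<and> v = comb m a b))"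
proof -
  obtain B where "poly_lattice M0 n B" using M0_poly_lattice by blast
  then interpret poly_lattice M0 n B .
  obtain m b d where *: "\<forall>i<m. b i \<in> M0 \<and> vdeg_le (b i) (d i)" and span: "M0 \<subseteq> spn m b" and
    **: "\<forall>a. comb m a b \<in> M0 \<longrightarrow> (\<forall>i<m. a i \<in> poly_vals)"
      "\<forall>a e. vdeg_le (comb m a b) e \<longrightarrow> (\<forall>i<m. deg_le (a i) (e - d i))"
    using reduced_basis by (elim exE conjE) (rule that)
  have b: "b i \<in> M0" "vdeg_le (b i) (d i)" if "i < m" for i using * that by simp_all
  have gen: "a i \<in> poly_vals" if "comb m a b \<in> M0" "i < m" for a i using **(1) that by blast
  have orth: "deg_le (a i) (e - d i)" if "vdeg_le (comb m a b) e" "i < m" for a e i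
    using **(2) that by blast
  have ind: "a i = 0" if "comb m a b = 0" "i < m" for a i
  proof (rule deg_le_all_imp_0)
    fix e
    have "vdeg_le (comb m a b) (e + d i)" using that(1) by (simp add: vdeg_le_def)
    from orth[OF this that(2)] show "deg_le (a i) e" by simp
  qed
  have "v \<in> stalk P \<longleftrightarrow> (\<exists>a. (\<forall>i<m. a i \<in> twist (- d i) P) \<and> v = comb m a b)" if P: "P \<in> P1_points" for P v
  proof (cases "P = infpt")
    case False
    then interpret P: affine_point P using P by (simp add: affine_pointI)
    show ?thesis
    proof
      assume v: "v \<in> stalk P"
      obtain g where g: "g \<notin> aff P" "scal (Fract g 1) v \<in> M0"
        using stalk_clear_poles[OF P.affine_point_axioms v] by blast
      then obtain a where a: "scal (Fract g 1) v = comb m a b" using span by (auto simp: spn_def)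
      have "g \<noteq> 0" using g P.aff_0 by blast
      then have "Fract 1 g * Fract g 1 = 1" by (simp add: One_fract_def eq_fract)
      \<comment> \<open>Dividing by g is harmless, since g is a unit of the local ring at P.\<close>
      then have "v = scal (Fract 1 g) (scal (Fract g 1) v)"
        by (simp only: vec.scale_scale vec.scale_one)
      then have "v = comb m (scal (Fract 1 g) a) b" by (simp add: a comb_scal)
      moreover have "scal (Fract 1 g) a i \<in> twist (- d i) P" if "i < m" for i
      proof -
        have "a i \<in> poly_vals" using gen g(2) a that by metis
        then show ?thesis
          using False g(1) P.Fract_in_loc P.poly_in_loc by (simp add: twist_def scal_def loc_closed[OF P])
      qed
      ultimately show "\<exists>a. (\<forall>i<m. a i \<in> twist (- d i) P) \<and> v = comb m a b" by blast
    next
      assume "\<exists>a. (\<forall>i<m. a i \<in> twist (- d i) P) \<and> v = comb m a b"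
      then obtain a where "\<forall>i<m. a i \<in> loc P" "v = comb m a b" using False by (auto simp: twist_def)
      then show "v \<in> stalk P"
        using b(1) P.affine_point_axioms by (auto intro!: stalk_comb P simp: M0_def)
    qed
  next
    case True
    have st: "v \<in> stalk infpt \<longleftrightarrow> (\<forall>j\<ge>n. v j = 0) \<and> vdeg_le v 0" for v
      unfolding stalk_U0[OF inf_U0] vdeg_le_def mem_Collect_eq loc_infpt
      by (metis deg_le_0 not_le)
    show ?thesis
    proof
      assume "v \<in> stalk P"
      then have v: "\<forall>j\<ge>n. v j = 0" "vdeg_le v 0" using st True by auto
      obtain a where a: "v = comb m a b" using M0_spans[OF span v(1)] by (auto simp: spn_def)
      have "deg_le (a i) (- d i)" if "i < m" for i using orth[of a 0 i] v(2) a that by simp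
      then show "\<exists>a. (\<forall>i<m. a i \<in> twist (- d i) P) \<and> v = comb m a b"
        using a True by (auto simp: twist_def)
    next
      assume "\<exists>a. (\<forall>i<m. a i \<in> twist (- d i) P) \<and> v = comb m a b"
      then obtain a where a: "\<And>i. i < m \<Longrightarrow> deg_le (a i) (0 - d i)" "v = comb m a b"
        using True by (auto simp: twist_def)
      have "vdeg_le v 0" unfolding a(2) by (rule vdeg_le_comb[of m a 0 d]) (use a(1) b(2) in auto)
      moreover have "v j = 0" if "n \<le> j" for j
        using supp[OF b(1) that] a(2) by (simp add: comb_def)
      ultimately show "v \<in> stalk P" using st True by simp
    qed
  qed
  \<comment> \<open>A basis vector of norm d i spans a copy of O(- d i): a coefficient must
    compensate the norm at infinity.\<close>
  then show ?thesis using ind by (intro exI[of _ m] exI[of _ b] exI[of _ "\<lambda>i. - d i"]) simp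
qed

end

section \<open>The isomorphism with a direct sum of twists\<close>

lemma direct_sum_line_sheaf_simps:
  "carrier (sec (direct_sum {..<m} (\<lambda>i. line_sheaf (d i))) U) = (\<Pi>\<^sub>E i\<in>{..<m}. const U ` twist_reg (d i) U)"
  "add (sec (direct_sum {..<m} (\<lambda>i. line_sheaf (d i))) U) s t = (\<lambda>i\<in>{..<m}. \<lambda>P\<in>U. s i P + t i P)"
  "module.smult (sec (direct_sum {..<m} (\<lambda>i. line_sheaf (d i))) U) r t = (\<lambda>i\<in>{..<m}. \<lambda>P\<in>U. r P * t i P)"
  "res (direct_sum {..<m} (\<lambda>i. line_sheaf (d i))) U V s = (\<lambda>i\<in>{..<m}. restrict (s i) V)"
  by (simp_all add: direct_sum_def line_sheaf_simps)

context bundle_at_infinity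
begin

lemma sections_empty:
  assumes "s \<in> carrier (sec F {})" "t \<in> carrier (sec F {})"
  shows "s = t"
  using triv.F.locality[of "{}" s t] assms by simp

text \<open>A section is sent to the coefficients of its generic value in the splitting basis. By
  \<open>gam_inj\<close> and \<open>gam_image\<close> this is bijective over each nonempty open
  set.\<close>

lemma splits:
  "\<exists>(m::nat) d. sheaf_iso P1 F (direct_sum {..<m} (\<lambda>i. line_sheaf (d i)))"
proof -
  obtain m b d where *: "\<forall>a. comb m a b = 0 \<longrightarrow> (\<forall>i<m. a i = 0)"
     "\<forall>P\<in>P1_points. \<forall>v. v \<in> stalk P \<longleftrightarrow> (\<exists>a. (\<forall>i<m. a i \<in> twist (d i) P) \<and> v = comb m a b)"
    using splitting_basis by (elim exE conjE) (rule that)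
  have ind: "\<forall>i<m. a i = 0" if "comb m a b = 0" for a using *(1) that by blast
  have st: "v \<in> stalk P \<longleftrightarrow> (\<exists>a. (\<forall>i<m. a i \<in> twist (d i) P) \<and> v = comb m a b)"
    if "P \<in> P1_points" for P v using *(2) that by blast
  let ?G = "direct_sum {..<m} (\<lambda>i. line_sheaf (d i)) :: ('k P1_point, 'k P1_fun, nat \<Rightarrow> 'k P1_fun) mod_sheaf"
  have uniq: "a i = a' i" if "comb m a b = comb m a' b" "i < m" for a a' i
    using ind[of "a - a'"] that by (simp add: comb_diff[symmetric])
  \<comment> \<open>On the span, the choice is unique below m; the other entries never
    enter.\<close>
  define cf where "cf v = (SOME a. v = comb m a b)" for v
  have cf: "cf (comb m a b) i = a i" if "i < m" for a i
  proof (rule uniq[OF _ that, symmetric])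
    show "comb m a b = comb m (cf (comb m a b)) b"      unfolding cf_def by (rule someI[of "\<lambda>x. comb m a b = comb m x b" a]) simp
  qed
  define \<Phi> where "\<Phi> V s = (\<lambda>i\<in>{..<m}. const V (cf (gam V s) i))" for V s
  have gam_cf: "gam V s = comb m (cf (gam V s)) b \<and> (\<forall>i<m. cf (gam V s) i \<in> twist_reg (d i) V)"
    if V: "openin P1_top V" "V \<noteq> {}" and s: "s \<in> carrier (sec F V)" for V s
  proof -

    \<comment> \<open>The stalk description yields coefficients for each P separately. By
      independence they are the same for all P, hence sections of the twists over V.\<close>
    have *: "gam V s = comb m (cf (gam V s)) b \<and> (\<forall>i<m. cf (gam V s) i \<in> twist (d i) P)" if P: "P \<in> V" for P
    proof -
      have "gam V s \<in> stalk P" unfolding stalk_def using V(1) s P by blast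
      then obtain a where a: "\<forall>i<m. a i \<in> twist (d i) P" "gam V s = comb m a b"
        using st P openin_P1_points[OF V(1)] by blast
      have "cf (gam V s) i = a i" if "i < m" for i using cf[OF that] a(2) by simp
      moreover from this have "comb m (cf (gam V s)) b = comb m a b" by (rule comb_cong)
      ultimately show ?thesis using a by simp
    qed
    then show ?thesis using V(2) by (auto simp: twist_reg_def)
  qed
  have iso: "\<Phi> V \<in> module_iso (ring_sec P1 V) (sec F V) (sec ?G V)" if V: "openin P1_top V" for V
  proof (cases "V = {}")
    case True
    \<comment> \<open>Over the empty set both modules have exactly one element.\<close>
    have G: "s = t" if "s \<in> carrier (sec ?G V)" "t \<in> carrier (sec ?G V)" for s t
      using that unfolding direct_sum_line_sheaf_simps True
      by (intro PiE_ext[OF that[unfolded direct_sum_line_sheaf_simps]]) (auto simp: const_empty' dest!: PiE_mem)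
    have \<Phi>: "\<Phi> V s \<in> carrier (sec ?G V)" for s
      using True by (auto simp: direct_sum_line_sheaf_simps \<Phi>_def twist_reg_def)
    have "bij_betw (\<Phi> V) (carrier (sec F V)) (carrier (sec ?G V))"
      unfolding bij_betw_def
    proof
      show "inj_on (\<Phi> V) (carrier (sec F V))" using sections_empty True by (auto intro: inj_onI)
      show "\<Phi> V ` carrier (sec F V) = carrier (sec ?G V)"
        using \<Phi> G triv.F_closed(3)[OF V] by blast
    qed
    then show ?thesis
      using True by (auto simp: module_iso_def direct_sum_line_sheaf_simps \<Phi>_def const_empty' intro!: restrict_ext)
  next
    case False
    note gam_cf = gam_cf[OF V False]
    have "bij_betw (\<Phi> V) (carrier (sec F V)) (carrier (sec ?G V))"
      unfolding bij_betw_def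
    proof
      show "inj_on (\<Phi> V) (carrier (sec F V))"
      proof (rule inj_onI)
        fix s t assume s: "s \<in> carrier (sec F V)" and t: "t \<in> carrier (sec F V)" and eq: "\<Phi> V s = \<Phi> V t"
        have "cf (gam V s) i = cf (gam V t) i" if "i < m" for i
          using fun_cong[OF eq, of i] that False by (simp add: \<Phi>_def const_eq_iff)
        then have *: "comb m (cf (gam V s)) b = comb m (cf (gam V t)) b" by (rule comb_cong)
        have "gam V s = gam V t"
          by (rule trans[OF conjunct1[OF gam_cf[OF s]] trans[OF * sym[OF conjunct1[OF gam_cf[OF t]]]]])
        then show "s = t" using gam_inj[OF V False s t] by simp
      qed
      show "\<Phi> V ` carrier (sec F V) = carrier (sec ?G V)"
      proof (intro equalityI subsetI)
        fix x assume "x \<in> \<Phi> V ` carrier (sec F V)"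
        then show "x \<in> carrier (sec ?G V)"
          using gam_cf by (auto simp: direct_sum_line_sheaf_simps \<Phi>_def)
      next
        fix x assume x: "x \<in> carrier (sec ?G V)"
        then have xP: "x \<in> (\<Pi>\<^sub>E i\<in>{..<m}. const V ` twist_reg (d i) V)" by (simp add: direct_sum_line_sheaf_simps)
        then have "\<forall>i\<in>{..<m}. \<exists>c. x i = const V c \<and> c \<in> twist_reg (d i) V" by (auto dest!: PiE_mem)
        from bchoice[OF this] obtain c where c: "\<And>i. i < m \<Longrightarrow> x i = const V (c i)" "\<And>i. i < m \<Longrightarrow> c i \<in> twist_reg (d i) V"
          by auto
        have "comb m c b \<in> stalk P" if "P \<in> V" for P
        proof -
          have P: "P \<in> P1_points" using openin_P1_points[OF V] that by blast
          show ?thesis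
            unfolding st[OF P] using c(2) that by (intro exI[of _ c]) (auto simp: twist_reg_def)
        qed
        from gam_image[OF V False this]
        obtain s where s: "s \<in> carrier (sec F V)" "gam V s = comb m c b" by blast
        have "x = \<Phi> V s"
          by (rule ext) (use xP s c(1) cf in \<open>auto simp: \<Phi>_def PiE_def extensional_def\<close>)
        then show "x \<in> \<Phi> V ` carrier (sec F V)" using s by blast
      qed
    qed
    moreover have "\<Phi> V (s \<oplus>\<^bsub>sec F V\<^esub> t) = \<Phi> V s \<oplus>\<^bsub>sec ?G V\<^esub> \<Phi> V t"
      if s: "s \<in> carrier (sec F V)" and t: "t \<in> carrier (sec F V)" for s t
    proof -
      have "gam V (s \<oplus>\<^bsub>sec F V\<^esub> t) = gam V s + gam V t" by (rule gam_add[OF V False s t])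
      also have "\<dots> = comb m (cf (gam V s)) b + comb m (cf (gam V t)) b"
        by (rule arg_cong2[of _ _ _ _ "(+)", OF conjunct1[OF gam_cf[OF s]] conjunct1[OF gam_cf[OF t]]])
      finally have "gam V (s \<oplus>\<^bsub>sec F V\<^esub> t) = comb m (cf (gam V s) + cf (gam V t)) b"
        by (simp only: comb_add)
      then have "cf (gam V (s \<oplus>\<^bsub>sec F V\<^esub> t)) i = cf (gam V s) i + cf (gam V t) i" if "i < m" for i
        using cf[OF that] by simp
      then show ?thesis by (auto simp: \<Phi>_def direct_sum_line_sheaf_simps const_add intro!: restrict_ext)
    qed
    moreover have "\<Phi> V (r \<odot>\<^bsub>sec F V\<^esub> s) = r \<odot>\<^bsub>sec ?G V\<^esub> \<Phi> V s"
      if r: "r \<in> carrier (ring_sec P1 V)" and s: "s \<in> carrier (sec F V)" for r s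
    proof -
      obtain c where c: "r = const V c" "c \<in> reg V" using r V by (auto simp: ring_sec_P1)
      have "gam V (r \<odot>\<^bsub>sec F V\<^esub> s) = scal c (gam V s)"
        unfolding c(1) by (rule gam_smult[OF V False c(2) s])
      also have "\<dots> = scal c (comb m (cf (gam V s)) b)"
        by (rule arg_cong[OF conjunct1[OF gam_cf[OF s]]])
      finally have "gam V (r \<odot>\<^bsub>sec F V\<^esub> s) = comb m (scal c (cf (gam V s))) b"
        by (simp only: comb_scal)
      then have "cf (gam V (r \<odot>\<^bsub>sec F V\<^esub> s)) i = c * cf (gam V s) i" if "i < m" for i
        using cf[OF that] by (simp add: scal_def)
      then show ?thesis by (auto simp: \<Phi>_def c direct_sum_line_sheaf_simps const_mult intro!: restrict_ext)
    qed
    ultimately show ?thesis by (simp add: module_iso_def)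
  qed
  have natural: "\<Phi> V (res F U V s) = res ?G U V (\<Phi> U s)"
    if U: "openin P1_top U" and V: "openin P1_top V" "V \<subseteq> U" and s: "s \<in> carrier (sec F U)" for U V s
  proof (cases "V = {}")
    case True
    then show ?thesis by (auto simp: \<Phi>_def direct_sum_line_sheaf_simps const_empty' restrict_def)
  next
    case False
    then have "gam V (res F U V s) = gam U s" using gam_res U V s by blast
    then show ?thesis
      using V by (auto simp: \<Phi>_def direct_sum_line_sheaf_simps restrict_const intro!: restrict_ext)
  qed
  have "sheaf_iso P1 F ?G"
    unfolding sheaf_iso_on_def space_top_P1 using iso natural by (intro exI[of _ \<Phi>]) blast
  then show ?thesis by blast
qed

end

theorem theorem8:
  fixes F :: "('k::field P1_point, 'k P1_fun, 'm) mod_sheaf"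
  assumes "vector_bundle P1 F"
  shows "\<exists>(n::nat) (L :: nat \<Rightarrow> ('k P1_point, 'k P1_fun, 'k P1_fun) mod_sheaf).
           (\<forall>i<n. line_bundle P1 (L i)) \<and> sheaf_iso P1 F (direct_sum {..<n} L)"
proof -
  obtain U0 n phi where triv: "trivialisation F U0 n phi" "infpt \<in> U0"
    using trivialisation_exists[OF assms infpt_point] by (elim exE conjE) (rule that)
  interpret trivialisation F U0 n phi by (rule triv(1))
  interpret bundle_at_infinity F U0 n phi by unfold_locales (use assms triv in auto)
  obtain m :: nat and d where "sheaf_iso P1 F (direct_sum {..<m} (\<lambda>i. line_sheaf (d i)))" using splits by blast
  then show ?thesis
    by (intro exI[of _ m] exI[of _ "\<lambda>i. line_sheaf (d i)"] conjI allI impI line_bundle_line_sheaf)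
qed

end
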